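(* Let $l_0,l_1,l_2,l_3\in\mathbb{C}$, $\alpha_0\in\{-l_0,l_0+1\}$, and set $$l_0'=\tfrac{-\alpha_0-l_1-l_2-l_3}{2}-1,\quad l_1'=\tfrac{\alpha_0+l_1-l_2-l_3}{2}-1,\quad l_2'=\tfrac{\alpha_0-l_1+l_2-l_3}{2}-1,\quad l_3'=\tfrac{\alpha_0-l_1-l_2+l_3}{2}-1,$$ $$\eta=\tfrac{\alpha_0-l_1-l_2-l_3}{2}.$$ If $\tilde f(x)$ satisfies $H^{(l_0',l_1',l_2',l_3')}\tilde f(x)=E\tilde f(x)$, then for each $i\in\{0,1,2,3\}$ the function $$f(x)=\sigma(x)^{\alpha_0}\sigma_1(x)^{-l_1}\sigma_2(x)^{-l_2}\sigma_3(x)^{-l_3}\int_{I_i}\tilde f(\xi)\,\sigma(\xi)^{l_0'+1}\sigma_1(\xi)^{l_1'+1}\sigma_2(\xi)^{l_2'+1}\sigma_3(\xi)^{l_3'+1}\big(\sigma(x+\xi)\sigma(x-\xi)\big)^{-\eta}\,d\xi$$ satisfies $H^{(l_0,l_1,l_2,l_3)}f(x)=Ef(x)$.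
   Context: $\wp(x)$ is the Weierstrass elliptic function with periods $(2\omega_1,2\omega_3)$; $\omega_0=0$, $\omega_2=-\omega_1-\omega_3$, $e_i=\wp(\omega_i)$ ($i=1,2,3$). $\sigma(x)$ is the Weierstrass sigma function and $\sigma_i(x)$ ($i=1,2,3$) is the Weierstrass co-sigma function which has a zero at $x=\omega_i$, so $\wp(x)-e_i=(\sigma_i(x)/\sigma(x))^2$. For complex $m_0,\dots,m_3$, $$H^{(m_0,m_1,m_2,m_3)}=-\frac{d^2}{dx^2}+\sum_{i=0}^3m_i(m_i+1)\wp(x+\omega_i).$$ $E\in\mathbb{C}$ is arbitrary. The cycle $I_i$ ($i=0,1,2,3$) is the closed contour in the $\xi$-plane enclosing the points $\xi=x$ and $\xi=-x+2\omega_i$ and not enclosing any point of $\mathbb{Z}\omega_1+\mathbb{Z}\omega_3$. Precisely, it is the contour corresponding under $w=(\wp(\xi)-e_1)/(e_2-e_1)$, $z=(\wp(x)-e_1)/(e_2-e_1)$ to the Pochhammer contour $[\gamma_z,\gamma_{p_i}]=\gamma_z\gamma_{p_i}\gamma_z^{-1}\gamma_{p_i}^{-1}$ in the $w$-plane, where $(p_0,p_1,p_2,p_3)=(\infty,0,1,t)$, $t=(e_3-e_1)/(e_2-e_1)$ and $\gamma_p$ is a loop once counterclockwise around $p$; i.e. a figure-eight contour going once around $x$ and once, in the opposite direction, around $-x+2\omega_i$, on which the (analytically continued) integrand is single-valued. *)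

theory Defs
  imports "HOL-Complex_Analysis.Complex_Analysis"
begin

subsection \<open>Weierstrass functions with periods \<open>(2\<omega>\<^sub>1, 2\<omega>\<^sub>3)\<close>\<close>

text \<open>
  Below, \<open>\<omega>\<^sub>1\<close> and \<open>\<omega>\<^sub>3\<close> are always meant to be linearly independent over the reals;
  users state this as \<open>Im (\<omega>\<^sub>3 / \<omega>\<^sub>1) \<noteq> 0\<close>.
\<close>

definition lattice_span :: "complex \<Rightarrow> complex \<Rightarrow> complex set" where
  "lattice_span a b = {of_int m * a + of_int n * b | m n. True}"

abbreviation period_lattice :: "complex \<Rightarrow> complex \<Rightarrow> complex set" where
  "period_lattice \<omega>\<^sub>1 \<omega>\<^sub>3 \<equiv> lattice_span (2 * \<omega>\<^sub>1) (2 * \<omega>\<^sub>3)"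

abbreviation half_period_lattice :: "complex \<Rightarrow> complex \<Rightarrow> complex set" where
  "half_period_lattice \<omega>\<^sub>1 \<omega>\<^sub>3 \<equiv> lattice_span \<omega>\<^sub>1 \<omega>\<^sub>3"

definition half_period :: "complex \<Rightarrow> complex \<Rightarrow> nat \<Rightarrow> complex" where
  "half_period \<omega>\<^sub>1 \<omega>\<^sub>3 i =
     (if i = 0 then 0 else if i = 1 then \<omega>\<^sub>1 else if i = 2 then - \<omega>\<^sub>1 - \<omega>\<^sub>3 else \<omega>\<^sub>3)"

definition weierstrass_p :: "complex \<Rightarrow> complex \<Rightarrow> complex \<Rightarrow> complex" where
  "weierstrass_p \<omega>\<^sub>1 \<omega>\<^sub>3 x =
     1 / x\<^sup>2 + (\<Sum>\<^sub>\<infinity>u\<in>period_lattice \<omega>\<^sub>1 \<omega>\<^sub>3 - {0}. 1 / (x - u)\<^sup>2 - 1 / u\<^sup>2)"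

text \<open>The infinite product is the unordered one, i.e. the limit along the finite subsets.\<close>

definition weierstrass_sigma :: "complex \<Rightarrow> complex \<Rightarrow> complex \<Rightarrow> complex" where
  "weierstrass_sigma \<omega>\<^sub>1 \<omega>\<^sub>3 x =
     x * Lim (finite_subsets_at_top (period_lattice \<omega>\<^sub>1 \<omega>\<^sub>3 - {0}))
           (\<lambda>F. \<Prod>u\<in>F. (1 - x / u) * exp (x / u + x\<^sup>2 / (2 * u\<^sup>2)))"

definition weierstrass_zeta :: "complex \<Rightarrow> complex \<Rightarrow> complex \<Rightarrow> complex" where
  "weierstrass_zeta \<omega>\<^sub>1 \<omega>\<^sub>3 x =
     deriv (weierstrass_sigma \<omega>\<^sub>1 \<omega>\<^sub>3) x / weierstrass_sigma \<omega>\<^sub>1 \<omega>\<^sub>3 x"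

text \<open>
  Index \<open>0\<close> is \<open>\<sigma>\<close> itself; for \<open>i = 1, 2, 3\<close> this is the co-sigma function \<open>\<sigma>\<^sub>i\<close>, normalised
  (by \<open>\<sigma>\<^sub>i(0) = 1\<close> and the exponential factor) so that \<open>\<wp>(x) - e\<^sub>i = (\<sigma>\<^sub>i(x) / \<sigma>(x))\<^sup>2\<close>.
\<close>

definition cosigma :: "complex \<Rightarrow> complex \<Rightarrow> nat \<Rightarrow> complex \<Rightarrow> complex" where
  "cosigma \<omega>\<^sub>1 \<omega>\<^sub>3 i x =
     (if i = 0 then weierstrass_sigma \<omega>\<^sub>1 \<omega>\<^sub>3 x
      else let \<omega> = half_period \<omega>\<^sub>1 \<omega>\<^sub>3 i in
        exp (- weierstrass_zeta \<omega>\<^sub>1 \<omega>\<^sub>3 \<omega> * x) *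
        weierstrass_sigma \<omega>\<^sub>1 \<omega>\<^sub>3 (x + \<omega>) / weierstrass_sigma \<omega>\<^sub>1 \<omega>\<^sub>3 \<omega>)"

definition weierstrass_e :: "complex \<Rightarrow> complex \<Rightarrow> nat \<Rightarrow> complex" where
  "weierstrass_e \<omega>\<^sub>1 \<omega>\<^sub>3 i = weierstrass_p \<omega>\<^sub>1 \<omega>\<^sub>3 (half_period \<omega>\<^sub>1 \<omega>\<^sub>3 i)"


subsection \<open>The operator \<open>H\<^bsup>(m\<^sub>0,m\<^sub>1,m\<^sub>2,m\<^sub>3)\<^esup>\<close>\<close>

definition heun_operator ::
  "complex \<Rightarrow> complex \<Rightarrow> (nat \<Rightarrow> complex) \<Rightarrow> (complex \<Rightarrow> complex) \<Rightarrow> complex \<Rightarrow> complex" where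
  "heun_operator \<omega>\<^sub>1 \<omega>\<^sub>3 m f x =
     - (deriv ^^ 2) f x +
     (\<Sum>i\<le>3. m i * (m i + 1) * weierstrass_p \<omega>\<^sub>1 \<omega>\<^sub>3 (x + half_period \<omega>\<^sub>1 \<omega>\<^sub>3 i)) * f x"

definition heun_solution ::
  "complex \<Rightarrow> complex \<Rightarrow> (nat \<Rightarrow> complex) \<Rightarrow> complex \<Rightarrow> complex set \<Rightarrow> (complex \<Rightarrow> complex) \<Rightarrow> bool" where
  "heun_solution \<omega>\<^sub>1 \<omega>\<^sub>3 m E S f \<longleftrightarrow>
     f holomorphic_on S \<and> (\<forall>x\<in>S. heun_operator \<omega>\<^sub>1 \<omega>\<^sub>3 m f x = E * f x)"


subsection \<open>Branches of multivalued functions\<close>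

text \<open>
  A branch, along a continuous map \<open>g\<close> from a parameter space \<open>P\<close> to the plane, of a multivalued
  solution of \<open>H f = E f\<close>: to each parameter \<open>p\<close> belongs the germ \<open>F p\<close> at \<open>g p\<close> of a solution,
  and germs at nearby parameters are direct analytic continuations of one another.  For
  \<open>P = {0..1}\<close> this is analytic continuation along the path \<open>g\<close>.
\<close>

definition heun_solution_branch ::
  "complex \<Rightarrow> complex \<Rightarrow> (nat \<Rightarrow> complex) \<Rightarrow> complex \<Rightarrow>
   'a::topological_space set \<Rightarrow> ('a \<Rightarrow> complex) \<Rightarrow> ('a \<Rightarrow> complex \<Rightarrow> complex) \<Rightarrow> bool" where
  "heun_solution_branch \<omega>\<^sub>1 \<omega>\<^sub>3 m E P g F \<longleftrightarrow>
     (\<forall>p\<in>P. \<exists>r>0. heun_solution \<omega>\<^sub>1 \<omega>\<^sub>3 m E (ball (g p) r) (F p) \<and>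
        (\<forall>\<^sub>F q in at p within P. \<forall>\<xi>\<in>ball (g p) r. F q \<xi> = F p \<xi>))"

text \<open>
  The branches of the power \<open>h\<^sup>a\<close> continued over \<open>P\<close> are the functions \<open>\<lambda>p. exp (a * L p)\<close>, where
  \<open>L\<close> is a continuous logarithm of \<open>h\<close>.
\<close>

definition log_branch ::
  "'a::topological_space set \<Rightarrow> ('a \<Rightarrow> complex) \<Rightarrow> ('a \<Rightarrow> complex) \<Rightarrow> bool" where
  "log_branch P h L \<longleftrightarrow> continuous_on P L \<and> (\<forall>p\<in>P. exp (L p) = h p)"

text \<open>
  The integral along a path of an integrand which depends on the parameter \<open>t\<close> of the path and not
  only on the point \<open>\<gamma> t\<close>, as does a multivalued function continued along \<open>\<gamma>\<close>.  If \<open>\<phi> t = h (\<gamma> t)\<close>,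
  this is \<open>contour_integral \<gamma> h\<close>.
\<close>

definition branch_integral :: "(real \<Rightarrow> complex) \<Rightarrow> (real \<Rightarrow> complex) \<Rightarrow> complex" where
  "branch_integral \<gamma> \<phi> = integral {0..1} (\<lambda>t. \<phi> t * vector_derivative \<gamma> (at t within {0..1}))"


subsection \<open>Pochhammer contours and the cycles \<open>I\<^sub>i\<close>\<close>

definition loop_once_around :: "complex set \<Rightarrow> complex \<Rightarrow> (real \<Rightarrow> complex) \<Rightarrow> bool" where
  "loop_once_around S p \<gamma> \<longleftrightarrow>
     (\<forall>\<^sub>F r in at_right 0. homotopic_loops S \<gamma> (circlepath p r))"

text \<open>Counterclockwise around \<open>\<infinity>\<close> means clockwise along large circles.\<close>

definition loop_once_around_infinity :: "complex set \<Rightarrow> (real \<Rightarrow> complex) \<Rightarrow> bool" where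
  "loop_once_around_infinity S \<gamma> \<longleftrightarrow>
     (\<forall>\<^sub>F R in at_top. homotopic_loops S \<gamma> (reversepath (circlepath 0 R)))"

definition pochhammer_contour :: "(real \<Rightarrow> complex) \<Rightarrow> (real \<Rightarrow> complex) \<Rightarrow> real \<Rightarrow> complex" where
  "pochhammer_contour \<gamma> \<delta> = \<gamma> +++ \<delta> +++ reversepath \<gamma> +++ reversepath \<delta>"

definition w_coord :: "complex \<Rightarrow> complex \<Rightarrow> complex \<Rightarrow> complex" where
  "w_coord \<omega>\<^sub>1 \<omega>\<^sub>3 \<xi> =
     (weierstrass_p \<omega>\<^sub>1 \<omega>\<^sub>3 \<xi> - weierstrass_e \<omega>\<^sub>1 \<omega>\<^sub>3 1) /
     (weierstrass_e \<omega>\<^sub>1 \<omega>\<^sub>3 2 - weierstrass_e \<omega>\<^sub>1 \<omega>\<^sub>3 1)"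

text \<open>
  The contours \<open>I\<^sub>i\<close> belonging to the point \<open>x\<close>.  The punctures \<open>p\<^sub>1, p\<^sub>2, p\<^sub>3 = 0, 1, t\<close> of the
  \<open>w\<close>-plane are the images of \<open>\<omega>\<^sub>1, \<omega>\<^sub>2, \<omega>\<^sub>3\<close>, and \<open>p\<^sub>0 = \<infinity>\<close>.  The winding numbers single out,
  among the lifts of the Pochhammer contour to the \<open>\<xi>\<close>-plane (which differ by \<open>\<xi> \<mapsto> \<plusminus>\<xi> + u\<close> with
  \<open>u\<close> a period), the one that encloses \<open>x\<close> and \<open>-x + 2\<omega>\<^sub>i\<close>.
\<close>

definition cycle_I :: "complex \<Rightarrow> complex \<Rightarrow> nat \<Rightarrow> complex \<Rightarrow> (real \<Rightarrow> complex) \<Rightarrow> bool" where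
  "cycle_I \<omega>\<^sub>1 \<omega>\<^sub>3 i x \<Gamma> \<longleftrightarrow>
     (let z = w_coord \<omega>\<^sub>1 \<omega>\<^sub>3 x;
          p = (\<lambda>j. w_coord \<omega>\<^sub>1 \<omega>\<^sub>3 (half_period \<omega>\<^sub>1 \<omega>\<^sub>3 j));
          W = - {p 1, p 2, p 3, z}
      in valid_path \<Gamma> \<and> pathfinish \<Gamma> = pathstart \<Gamma> \<and>
         path_image \<Gamma> \<inter> half_period_lattice \<omega>\<^sub>1 \<omega>\<^sub>3 = {} \<and>
         (\<exists>\<gamma>\<^sub>z \<gamma>\<^sub>p. loop_once_around W z \<gamma>\<^sub>z \<and>
            (if i = 0 then loop_once_around_infinity W \<gamma>\<^sub>p else loop_once_around W (p i) \<gamma>\<^sub>p) \<and>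
            pathstart \<gamma>\<^sub>z = pathstart \<gamma>\<^sub>p \<and>
            homotopic_loops W (w_coord \<omega>\<^sub>1 \<omega>\<^sub>3 \<circ> \<Gamma>) (pochhammer_contour \<gamma>\<^sub>z \<gamma>\<^sub>p)) \<and>
         winding_number \<Gamma> x = 1 \<and>
         winding_number \<Gamma> (- x + 2 * half_period \<omega>\<^sub>1 \<omega>\<^sub>3 i) = -1 \<and>
         (\<forall>\<omega>\<in>half_period_lattice \<omega>\<^sub>1 \<omega>\<^sub>3. winding_number \<Gamma> \<omega> = 0))"

end

theory Submission
  imports Defs
begin

text \<open>
  Let \<open>K(x, \<xi>)\<close> be the prefactor times the integrand without the factor \<open>F\<close>.  By the addition
  formula of \<open>\<zeta>\<close>, both \<open>\<partial>\<^sub>x log K\<close> and \<open>\<partial>\<^sub>\<xi> log K\<close> are free of \<open>\<zeta>\<close>, and the parameters \<open>l'\<close> are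
  chosen exactly so that the rational identity \<open>H\<^sub>x K = H'\<^sub>\<xi> K\<close> holds, with \<open>H\<close>, \<open>H'\<close> the operators of
  parameters \<open>l\<close>, \<open>l'\<close>.  Hence \<open>(H\<^sub>x - E) (F K) = \<partial>\<^sub>\<xi> (F' K - F \<partial>\<^sub>\<xi>K)\<close>, whose integral over a closed
  contour vanishes as soon as \<open>F\<close> and \<open>K\<close> return to themselves.  For \<open>F\<close> and the \<open>\<sigma>\<^sub>j(\<xi>)\<close> this holds
  because the Pochhammer commutator becomes null-homotopic once the puncture \<open>z\<close> is filled in, and this
  homotopy lifts through the covering \<open>\<xi> \<mapsto> w\<close>; for \<open>\<sigma>(x + \<xi>) \<sigma>(x - \<xi>)\<close>, which is \<open>w - z\<close> up to factors
  already treated, because a commutator winds zero times around \<open>z\<close>.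
\<close>

subsection \<open>Sums and products over lattices\<close>

text \<open>The obstacle is regularity: \<open>\<Gamma> x\<close> varies only continuously with
  \<open>x\<close>, and the integrand is a family of branches labelled by the path parameter, so one
  cannot differentiate under the integral as it stands. Around a fixed \<open>x\<^sub>0\<close>
  every factor is therefore replaced by holomorphic functions \<open>Fh t\<close>,
  \<open>Lh j t\<close>, \<open>Mh t\<close> on balls of one common radius \<open>\<rho>\<close>
  about \<open>\<Gamma> x\<^sub>0 t\<close>, which agree on overlaps for neighbouring
  \<open>t\<close>. Inside this tube a single polynomial path \<open>g\<close> stands for all nearby
  contours, and only the integrand still depends on \<open>x\<close>. The contraction of the contour
  may pass through the zeros of the kernel. There \<open>F\<close> and the co-sigma functions are
  regular and the latter do not vanish, so their branches survive; the kernel itself is not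
  controlled by it and needs the winding number in the \<open>w\<close>-plane. The cancellation of
  \<zeta> is a count of exponents: \<open>\<alpha>\<^sub>0 - l 1 - l 2 - l 3 = 2 * \<eta>\<close> in
  \<open>x\<close>, and the four numbers \<open>l' j + 1\<close> also add up to
  \<open>2 * \<eta>\<close> in \<xi>.\<close>

lemma lattice_span_norm_bound:
  assumes "Im (b / a) \<noteq> 0"
  obtains c where "c > 0"
    "\<And>m n :: int. c * max \<bar>of_int m\<bar> \<bar>of_int n\<bar> \<le> norm (of_int m * a + of_int n * b)"
proof -
  have a: "a \<noteq> 0" and b: "b \<noteq> 0" using assms by auto
  \<comment> \<open>Dividing by \<open>a\<close> leaves \<open>m + n * (b / a)\<close>, whose
    imaginary part is \<open>n * Im (b / a)\<close>. The claim is general in the generators so that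
    exchanging them bounds \<open>m\<close> as well.\<close>
  have *: "\<bar>of_int n\<bar> * (norm a * \<bar>Im (b / a)\<bar>) \<le> norm (of_int m * a + of_int n * b)"
    if "a \<noteq> 0" for m n :: int and a b :: complex
  proof -
    have "of_int m * a + of_int n * b = a * (of_int m + of_int n * (b / a))"
      using that by (simp add: field_simps)
    then have "norm (of_int m * a + of_int n * b) = norm a * norm (of_int m + of_int n * (b / a))"
      by (simp add: norm_mult)
    moreover have "\<bar>Im (of_int m + of_int n * (b / a))\<bar> \<le> norm (of_int m + of_int n * (b / a))"
      by (rule abs_Im_le_cmod)
    moreover have "Im (of_int n * z) = of_int n * Im z" for z by simp
    then have "Im (of_int m + of_int n * (b / a)) = of_int n * Im (b / a)"
      unfolding plus_complex.sel by (simp del: times_divide_eq_right)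
    ultimately show ?thesis
      by (metis (no_types, opaque_lifting) abs_mult mult.left_commute mult_left_mono norm_ge_zero)
  qed
  have nz: "Im (a / b) \<noteq> 0"
  proof
    assume "Im (a / b) = 0"
    then have "a / b \<in> \<real>" by (simp add: complex_is_Real_iff)
    then have "b / a \<in> \<real>" using Reals_inverse[of "a / b"] by simp
    with assms show False by (simp add: complex_is_Real_iff)
  qed
  define c where "c = min (norm a * \<bar>Im (b / a)\<bar>) (norm b * \<bar>Im (a / b)\<bar>)"
  show ?thesis
  proof
    show "c > 0" using a b assms nz by (simp add: c_def)
    fix m n :: int
    have 1: "\<bar>of_int n\<bar> * c \<le> norm (of_int m * a + of_int n * b)"
      by (rule order_trans[OF _ *[OF a]]) (auto simp: c_def intro!: mult_left_mono)
    have 2: "\<bar>of_int m\<bar> * c \<le> norm (of_int m * a + of_int n * b)"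
      by (subst add.commute, rule order_trans[OF _ *[OF b]]) (auto simp: c_def intro!: mult_left_mono)
    show "c * max \<bar>of_int m\<bar> \<bar>of_int n\<bar> \<le> norm (of_int m * a + of_int n * b)"
      using 1 2 by (auto simp: max_def mult.commute)
  qed
qed

text \<open>The exponent 3/2 is half of the exponent 3 of the lattice sum: a product of two such
  terms, one for each coordinate, dominates a multiple of \<open>1 / norm u ^ 3\<close>, and 3/2
  still exceeds 1.\<close>

lemma summable_on_int_powr:
  "(\<lambda>n::int. (1 + \<bar>real_of_int n\<bar>) powr (- (3 / 2))) summable_on UNIV"
proof -
  have "summable (\<lambda>n. real (Suc n) powr (- (3 / 2)))"
    by (subst summable_Suc_iff) (simp add: summable_real_powr_iff)
  then have *: "(\<lambda>n::nat. (1 + real n) powr (- (3 / 2))) summable_on UNIV"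
    by (intro summable_nonneg_imp_summable_on) simp_all
  have "(\<lambda>n::int. (1 + \<bar>real_of_int n\<bar>) powr (- (3 / 2))) summable_on (range int)"
    by (subst summable_on_reindex) (use * in \<open>auto simp: o_def\<close>)
  moreover have "(\<lambda>n::int. (1 + \<bar>real_of_int n\<bar>) powr (- (3 / 2))) summable_on (range (\<lambda>n. - int n))"
    by (subst summable_on_reindex) (use * in \<open>auto simp: o_def inj_def\<close>)
  ultimately have "(\<lambda>n::int. (1 + \<bar>real_of_int n\<bar>) powr (- (3 / 2))) summable_on
      (range int \<union> range (\<lambda>n. - int n))"
    by (rule summable_on_union)
  moreover have "range int \<union> range (\<lambda>n. - int n) = UNIV"
  proof -
    have "n \<in> range int \<union> range (\<lambda>n. - int n)" for n
      using rangeI[of int "nat n"] rangeI[of "\<lambda>n. - int n" "nat (- n)"] by (cases "n \<ge> 0") simp_all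
    then show ?thesis by blast
  qed
  ultimately show ?thesis by simp
qed

text \<open>
  With \<open>k = max \<bar>m\<bar> \<bar>n\<bar>\<close>, the bound \<open>(1 + \<bar>m\<bar>) (1 + \<bar>n\<bar>) \<le> 4 k\<^sup>2\<close> for \<open>(m, n) \<noteq> 0\<close> decouples the double sum.
\<close>

lemma summable_on_lattice_inverse_cube:
  assumes "Im (b / a) \<noteq> 0"
  shows "(\<lambda>u. 1 / norm u ^ 3) summable_on (lattice_span a b - {0})"
proof -
  obtain c where c: "c > 0" and
    bound: "\<And>m n :: int. c * max \<bar>of_int m\<bar> \<bar>of_int n\<bar> \<le> norm (of_int m * a + of_int n * b)"
    using lattice_span_norm_bound[OF assms] by metis
  define g where "g = (\<lambda>(m :: int, n :: int). of_int m * a + of_int n * b)"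
  define h where "h = (\<lambda>n::int. (1 + \<bar>real_of_int n\<bar>) powr (- (3 / 2)))"
  have inj: "inj g"
  proof (rule injI, clarify)
    fix m n m' n' assume "g (m, n) = g (m', n')"
    then have "norm (of_int (m - m') * a + of_int (n - n') * b) = 0"
      by (simp add: g_def algebra_simps)
    with bound[of "m - m'" "n - n'"] have "c * max \<bar>of_int (m - m')\<bar> \<bar>of_int (n - n')\<bar> \<le> 0"
      by metis
    with c have "max \<bar>real_of_int (m - m')\<bar> \<bar>of_int (n - n')\<bar> \<le> 0"
      by (simp add: mult_le_0_iff)
    then show "m = m' \<and> n = n'" by simp
  qed
  have g0: "g p = 0 \<longleftrightarrow> p = (0, 0)" for p
    using inj_eq[OF inj, of p "(0,0)"] by (simp add: g_def)
  have lat: "lattice_span a b - {0} = g ` (UNIV - {(0, 0)})"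
    using g0 unfolding lattice_span_def g_def by (auto simp: image_iff split: prod.splits)
  have "(\<lambda>p. case p of (m, n) \<Rightarrow> h m * h n) summable_on (UNIV \<times> UNIV)"
  proof (rule summable_on_SigmaI[where g = "\<lambda>m. h m * infsum h UNIV"])
    show "((\<lambda>n. case (m, n) of (m, n) \<Rightarrow> h m * h n) has_sum h m * infsum h UNIV) UNIV" for m
      using summable_on_int_powr by (auto simp: h_def[symmetric] intro!: has_sum_cmult_right)
    show "(\<lambda>m. h m * infsum h UNIV) summable_on UNIV"
      using summable_on_int_powr by (auto simp: h_def[symmetric] intro!: summable_on_cmult_left)
  qed (auto simp: h_def)
  then have "(\<lambda>p. case p of (m, n) \<Rightarrow> h m * h n) summable_on (UNIV - {(0, 0)})"
    by (rule summable_on_subset) auto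
  then have "(\<lambda>p. 8 / c ^ 3 * (case p of (m, n) \<Rightarrow> h m * h n)) summable_on (UNIV - {(0, 0)})"
    by (rule summable_on_cmult_right)
  then have "(\<lambda>p. 1 / norm (g p) ^ 3) summable_on (UNIV - {(0, 0)})"
  proof (rule summable_on_comparison_test)
    fix p assume "p \<in> UNIV - {(0::int, 0::int)}"
    obtain m n where p: "p = (m, n)" by (cases p)
    define k where "k = max \<bar>real_of_int m\<bar> \<bar>real_of_int n\<bar>"
    have "m \<noteq> 0 \<or> n \<noteq> 0" using \<open>p \<in> _\<close> p by auto
    then have "1 \<le> \<bar>m\<bar> \<or> 1 \<le> \<bar>n\<bar>" by linarith
    then have k: "k \<ge> 1" unfolding k_def
      by (metis le_max_iff_disj of_int_1_le_iff of_int_abs)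
    have e: "((2 * k) powr (- (3/2))) * ((2 * k) powr (- (3/2))) = 1 / (8 * k ^ 3)"
    proof -
      have "((2 * k) powr (- (3/2))) * ((2 * k) powr (- (3/2))) = (2 * k) powr (- 3)"
        by (simp flip: powr_add)
      also have "\<dots> = 1 / (2 * k) ^ 3" using k
        by (simp add: powr_minus_divide powr_numeral)
      finally show ?thesis by (simp add: power_mult_distrib)
    qed
    have h: "(2 * k) powr (- (3/2)) \<le> h n'" if "\<bar>real_of_int n'\<bar> \<le> k" for n'
      unfolding h_def using that k by (intro powr_mono2') auto
    have "1 / (8 * k ^ 3) \<le> h m * h n" 
      unfolding e[symmetric] by (intro mult_mono h) (auto simp: k_def h_def)
    moreover have "1 / norm (g p) ^ 3 \<le> 1 / (c * k) ^ 3"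
    proof (rule divide_left_mono)
      show "(c * k) ^ 3 \<le> norm (g p) ^ 3"
        using bound[of m n] c k by (intro power_mono) (auto simp: g_def p k_def)
      have "c * k > 0" using c k by simp
      moreover have "norm (g p) > 0" using g0[of p] \<open>p \<in> _\<close> by auto
      ultimately show "0 < norm (g p) ^ 3 * (c * k) ^ 3" by (metis mult_pos_pos zero_less_power)
    qed auto
    moreover have "1 / (c * k) ^ 3 = 8 / c ^ 3 * (1 / (8 * k ^ 3))"
      by (simp add: power_mult_distrib)
    ultimately show "1 / norm (g p) ^ 3 \<le> 8 / c ^ 3 * (case p of (m, n) \<Rightarrow> h m * h n)"
      using c by (smt (verit) divide_pos_pos mult_left_mono p prod.case zero_less_power)
  qed auto
  then show ?thesis
    unfolding lat by (subst summable_on_reindex) (auto simp: o_def intro: inj_on_subset[OF inj])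
qed

lemma finite_lattice_Int_bounded:
  assumes "Im (b / a) \<noteq> 0"
  shows "finite {u \<in> lattice_span a b. norm u \<le> R}"
proof -
  obtain c where c: "c > 0" and
    bound: "\<And>m n :: int. c * max \<bar>of_int m\<bar> \<bar>of_int n\<bar> \<le> norm (of_int m * a + of_int n * b)"
    using lattice_span_norm_bound[OF assms] by metis
  define N where "N = \<lceil>R / c\<rceil>"
  have "{u \<in> lattice_span a b. norm u \<le> R} \<subseteq> (\<lambda>(m, n). of_int m * a + of_int n * b) ` ({-N..N} \<times> {-N..N})"
  proof
    fix u assume u: "u \<in> {u \<in> lattice_span a b. norm u \<le> R}"
    then obtain m n where mn: "u = of_int m * a + of_int n * b" by (auto simp: lattice_span_def)
    have "c * max \<bar>of_int m\<bar> \<bar>of_int n\<bar> \<le> R" using bound[of m n] u mn by (metis (no_types, lifting) mem_Collect_eq order_trans)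
    then have "max \<bar>real_of_int m\<bar> \<bar>of_int n\<bar> \<le> R / c"
      by (subst pos_le_divide_eq[OF c]) (simp only: mult.commute)
    then have "\<bar>m\<bar> \<le> N" "\<bar>n\<bar> \<le> N" unfolding N_def by linarith+
    then show "u \<in> (\<lambda>(m, n). of_int m * a + of_int n * b) ` ({-N..N} \<times> {-N..N})"
      unfolding mn by (intro image_eqI[of _ _ "(m, n)"]) auto
  qed
  then show ?thesis by (rule finite_subset) simp
qed

section \<open>Lattices as discrete subgroups of the plane\<close>

lemma lattice_span_0 [simp]: "0 \<in> lattice_span a b"
  unfolding lattice_span_def by (auto intro!: exI[of _ 0])

lemma lattice_span_add: "u \<in> lattice_span a b \<Longrightarrow> v \<in> lattice_span a b \<Longrightarrow> u + v \<in> lattice_span a b"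
proof -
  assume "u \<in> lattice_span a b" "v \<in> lattice_span a b"
  then obtain m n m' n' :: int where "u = of_int m * a + of_int n * b" "v = of_int m' * a + of_int n' * b"
    unfolding lattice_span_def by auto
  then have "u + v = of_int (m + m') * a + of_int (n + n') * b" by (simp add: algebra_simps)
  then show ?thesis unfolding lattice_span_def by blast
qed

lemma lattice_span_minus: "u \<in> lattice_span a b \<Longrightarrow> - u \<in> lattice_span a b"
proof -
  assume "u \<in> lattice_span a b"
  then obtain m n :: int where "u = of_int m * a + of_int n * b"
    unfolding lattice_span_def by auto
  then have "- u = of_int (- m) * a + of_int (- n) * b" by simp
  then show ?thesis unfolding lattice_span_def by blast
qed

lemma lattice_span_diff: "u \<in> lattice_span a b \<Longrightarrow> v \<in> lattice_span a b \<Longrightarrow> u - v \<in> lattice_span a b"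
  using lattice_span_add[of u a b "- v"] lattice_span_minus[of v a b] by simp

lemma lattice_span_minus_iff [simp]: "- u \<in> lattice_span a b \<longleftrightarrow> u \<in> lattice_span a b"
  using lattice_span_minus by fastforce

lemma lattice_span_add_iff: "v \<in> lattice_span a b \<Longrightarrow> u + v \<in> lattice_span a b \<longleftrightarrow> u \<in> lattice_span a b"
  using lattice_span_add lattice_span_diff by fastforce

text \<open>Bounded regions contain finitely many lattice points, so no subset of a lattice has a
  limit point. The form for subsets also covers \<open>\<Lambda> - {0}\<close>, whose closedness
  isolates 0 within the lattice.\<close>

lemma closed_lattice_span:
  assumes "Im (b / a) \<noteq> 0" and "A \<subseteq> lattice_span a b"
  shows "closed A"
proof -
  have "\<not> x islimpt A" for x
  proof
    assume "x islimpt A"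
    then have "infinite (A \<inter> ball x 1)" by (simp add: islimpt_eq_infinite_ball)
    moreover have "A \<inter> ball x 1 \<subseteq> {u \<in> lattice_span a b. norm u \<le> norm x + 1}"
    proof safe
      fix u assume "u \<in> A" "u \<in> ball x 1"
      then show "norm u \<le> norm x + 1"
        using norm_triangle_ineq3[of u x] by (simp add: dist_norm norm_minus_commute)
    qed (use assms in auto)
    ultimately show False using finite_lattice_Int_bounded[OF assms(1)] finite_subset by blast
  qed
  then show ?thesis by (simp add: closed_limpt)
qed

lemma countable_lattice_span: "countable (lattice_span a b)"
proof -
  have "lattice_span a b = range (\<lambda>(m::int, n::int). of_int m * a + of_int n * b)"
    by (auto simp: lattice_span_def image_iff)
  then show ?thesis by simp
qed

section \<open>Locally uniform sums and unordered products\<close>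

text \<open>Weierstrass's convergence theorem along the filter of finite subsets: the M-test gives
  uniform convergence, which passes to all derivatives. The lattice series and the Picard series of
  the differential equation are both differentiated through it.\<close>

lemma holomorphic_infsum:
  fixes f :: "'a \<Rightarrow> complex \<Rightarrow> complex"
  assumes S: "open S" and hol: "\<And>u. u \<in> A \<Longrightarrow> f u holomorphic_on S"
    and bound: "\<And>u x. u \<in> A \<Longrightarrow> x \<in> S \<Longrightarrow> norm (f u x) \<le> M u" and M: "M summable_on A"
  shows "(\<lambda>x. \<Sum>\<^sub>\<infinity>u\<in>A. f u x) holomorphic_on S"
    and "x \<in> S \<Longrightarrow> ((\<lambda>u. (deriv ^^ n) (f u) x) has_sum (deriv ^^ n) (\<lambda>x. \<Sum>\<^sub>\<infinity>u\<in>A. f u x) x) A"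
proof -
  have lim: "uniform_limit S (\<lambda>F x. \<Sum>u\<in>F. f u x) (\<lambda>x. \<Sum>\<^sub>\<infinity>u\<in>A. f u x) (finite_subsets_at_top A)"
    using bound M by (rule Weierstrass_m_test_general)
  have ev: "\<forall>\<^sub>F F in finite_subsets_at_top A. (\<lambda>x. \<Sum>u\<in>F. f u x) holomorphic_on S"
    by (rule eventually_finite_subsets_at_top_weakI) (use hol in \<open>auto intro!: holomorphic_on_sum\<close>)
  show hol': "(\<lambda>x. \<Sum>\<^sub>\<infinity>u\<in>A. f u x) holomorphic_on S"
  proof -
    have "(\<lambda>x. \<Sum>\<^sub>\<infinity>u\<in>A. f u x) field_differentiable at z" if z: "z \<in> S" for z
    proof -
      obtain r where r: "r > 0" "cball z r \<subseteq> S" using S z by (meson open_contains_cball)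
      have "\<forall>\<^sub>F F in finite_subsets_at_top A. continuous_on (cball z r) (\<lambda>x. \<Sum>u\<in>F. f u x) \<and>
          (\<lambda>x. \<Sum>u\<in>F. f u x) holomorphic_on ball z r"
        using ev
      proof eventually_elim
        case (elim F)
        then have "(\<lambda>x. \<Sum>u\<in>F. f u x) holomorphic_on cball z r"
          using r(2) holomorphic_on_subset by blast
        then show ?case
          using holomorphic_on_imp_continuous_on holomorphic_on_subset ball_subset_cball by blast
      qed
      then have "(\<lambda>x. \<Sum>\<^sub>\<infinity>u\<in>A. f u x) holomorphic_on ball z r"
        by (rule holomorphic_uniform_limit[OF _ uniform_limit_on_subset[OF lim r(2)]]) auto
      then show ?thesis using r(1)
        by (intro holomorphic_on_imp_differentiable_at[OF _ open_ball]) auto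
    qed
    then show ?thesis by (metis field_differentiable_at_within holomorphic_on_def)
  qed
  assume x: "x \<in> S"
  have "((\<lambda>F. (deriv ^^ n) (\<lambda>x. \<Sum>u\<in>F. f u x) x) \<longlongrightarrow> (deriv ^^ n) (\<lambda>x. \<Sum>\<^sub>\<infinity>u\<in>A. f u x) x) (finite_subsets_at_top A)"
    by (rule higher_deriv_complex_uniform_limit[OF lim ev _ S x]) simp
  moreover
  have "(deriv ^^ n) (\<lambda>x. \<Sum>u\<in>F. f u x) x = (\<Sum>u\<in>F. (deriv ^^ n) (f u) x)"
    if "finite F" "F \<subseteq> A" for F
    using that
  proof (induction F rule: finite_induct)
    case (insert u F)
    have "(deriv ^^ n) (\<lambda>x. f u x + (\<Sum>u\<in>F. f u x)) x
        = (deriv ^^ n) (f u) x + (deriv ^^ n) (\<lambda>x. \<Sum>u\<in>F. f u x) x"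
      by (rule higher_deriv_add[OF _ _ S x]) (use insert hol in \<open>auto intro!: holomorphic_on_sum\<close>)
    with insert show ?case by simp
  next
    case empty
    have "(deriv ^^ n) (\<lambda>x. 0 :: complex) x = 0"
      by (simp add: higher_deriv_const)
    then show ?case by simp
  qed
  then have "\<forall>\<^sub>F F in finite_subsets_at_top A. (deriv ^^ n) (\<lambda>x. \<Sum>u\<in>F. f u x) x = (\<Sum>u\<in>F. (deriv ^^ n) (f u) x)"
    by (rule eventually_finite_subsets_at_top_weakI)
  ultimately show "((\<lambda>u. (deriv ^^ n) (f u) x) has_sum (deriv ^^ n) (\<lambda>x. \<Sum>\<^sub>\<infinity>u\<in>A. f u x) x) A"
    unfolding has_sum_def by (rule Lim_transform_eventually)
qed

text \<open>Finite subsets eventually contain \<open>S\<close>, so the factors over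
  \<open>S\<close>, which may vanish, split off as a finite product. The logarithms of the others
  form a convergent sum, and \<open>exp\<close> carries its limit to the product.\<close>

lemma tendsto_prod_exp:
  fixes e g :: "'a \<Rightarrow> complex"
  assumes S: "finite S" "S \<subseteq> A" and g: "(g has_sum G) (A - S)"
    and e: "\<And>u. u \<in> A - S \<Longrightarrow> e u = exp (g u)"
  shows "((\<lambda>F. \<Prod>u\<in>F. e u) \<longlongrightarrow> (\<Prod>u\<in>S. e u) * exp G) (finite_subsets_at_top A)"
proof -
  define h where "h u = (if u \<in> S then 0 else g u)" for u
  have "(h has_sum G) A"
    using g by (subst has_sum_cong_neutral[where T = "A - S" and g = g]) (auto simp: h_def)
  then have "((\<lambda>F. (\<Prod>u\<in>S. e u) * exp (sum h F)) \<longlongrightarrow> (\<Prod>u\<in>S. e u) * exp G) (finite_subsets_at_top A)"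
    unfolding has_sum_def by (intro tendsto_intros)
  then show ?thesis
  proof (rule Lim_transform_eventually)
    show "\<forall>\<^sub>F F in finite_subsets_at_top A. (\<Prod>u\<in>S. e u) * exp (sum h F) = (\<Prod>u\<in>F. e u)"
      unfolding eventually_finite_subsets_at_top
    proof (intro exI[of _ S] conjI allI impI)
      fix F assume F: "finite F \<and> S \<subseteq> F \<and> F \<subseteq> A"
      have "exp (sum h F) = (\<Prod>u\<in>F. exp (h u))" using F by (simp add: exp_sum)
      also have "\<dots> = (\<Prod>u\<in>F - S. exp (h u)) * (\<Prod>u\<in>S. exp (h u))"
        using F by (intro prod.subset_diff) auto
      also have "(\<Prod>u\<in>S. exp (h u)) = 1" by (auto simp: h_def intro!: prod.neutral)
      also have "(\<Prod>u\<in>F - S. exp (h u)) = (\<Prod>u\<in>F - S. e u)"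
        using F e by (intro prod.cong) (auto simp: h_def)
      finally show "(\<Prod>u\<in>S. e u) * exp (sum h F) = (\<Prod>u\<in>F. e u)"
        using F prod.subset_diff[of S F e] by (simp only: mult_1_right mult_1_left mult.commute)
    qed (use S in auto)
  qed
qed

subsection \<open>The Weierstrass functions\<close>

text \<open>The logarithm of Weierstrass's primary factor of genus 2: the added terms cancel the
  Taylor polynomial of \<open>Ln (1 - z)\<close> up to second order and leave a remainder of order
  3.\<close>

definition log_factor :: "complex \<Rightarrow> complex" where
  "log_factor z = Ln (1 - z) + z + z\<^sup>2 / 2"

lemma one_minus_notin_nonpos_Reals: "norm (z :: complex) < 1 \<Longrightarrow> 1 - z \<notin> \<real>\<^sub>\<le>\<^sub>0"
  using complex_Re_le_cmod[of z] by (auto simp: complex_nonpos_Reals_iff)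

lemma has_field_derivative_log_factor:
  assumes "norm z < 1"
  shows "(log_factor has_field_derivative - z\<^sup>2 / (1 - z)) (at z)"
proof -
  have "1 - z \<noteq> 0" using assms by auto
  then show ?thesis
    unfolding log_factor_def
    by (auto intro!: derivative_eq_intros one_minus_notin_nonpos_Reals[OF assms]
        simp: divide_simps power2_eq_square) (simp add: algebra_simps)
qed

text \<open>The function vanishes at 0 and its derivative is at most \<open>2 * norm z ^ 2\<close>
  on the disc of radius \<open>norm z\<close>. The cubic order matches the convergent lattice sum of
  inverse cubes.\<close>

lemma norm_log_factor_le:
  assumes "norm z \<le> 1 / 2"
  shows "norm (log_factor z) \<le> 2 * norm z ^ 3"
proof -
  have "norm (log_factor z - log_factor 0) \<le> (2 * norm z ^ 2) * norm (z - 0)"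
  proof (rule field_differentiable_bound)
    fix w :: complex assume w: "w \<in> cball 0 (norm z)"
    then have w1: "norm w \<le> norm z" "norm w < 1" using assms by auto
    show "(log_factor has_field_derivative - w\<^sup>2 / (1 - w)) (at w within cball 0 (norm z))"
      by (rule has_field_derivative_at_within[OF has_field_derivative_log_factor[OF w1(2)]])
    have "1 / 2 \<le> norm (1 - w)"
      using norm_triangle_ineq2[of 1 w] assms w1 by simp
    then have "norm w ^ 2 / norm (1 - w) \<le> norm z ^ 2 / (1 / 2)"
      using w1 by (intro frac_le power_mono) auto
    then show "norm (- w\<^sup>2 / (1 - w)) \<le> 2 * norm z ^ 2"
      by (simp add: norm_divide norm_power)
  qed auto
  then show ?thesis by (simp add: log_factor_def power2_eq_square power3_eq_cube)
qed

locale period_pair =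
  fixes \<omega>\<^sub>1 \<omega>\<^sub>3 :: complex
  assumes indep: "Im (\<omega>\<^sub>3 / \<omega>\<^sub>1) \<noteq> 0"
begin

abbreviation "\<Lambda> \<equiv> period_lattice \<omega>\<^sub>1 \<omega>\<^sub>3"
abbreviation "H \<equiv> half_period_lattice \<omega>\<^sub>1 \<omega>\<^sub>3"
abbreviation "\<sigma> \<equiv> weierstrass_sigma \<omega>\<^sub>1 \<omega>\<^sub>3"
abbreviation "\<P> \<equiv> weierstrass_p \<omega>\<^sub>1 \<omega>\<^sub>3"
abbreviation "\<zeta> \<equiv> weierstrass_zeta \<omega>\<^sub>1 \<omega>\<^sub>3"
abbreviation "\<omega> \<equiv> half_period \<omega>\<^sub>1 \<omega>\<^sub>3"

text \<open>The factor 2 keeps \<open>x / u\<close> in the disc of radius 1/2 for \<open>x\<close>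
  in the ball of radius \<open>R\<close> and \<open>u\<close> in \<open>far R\<close>, where the
  principal logarithm of \<open>1 - x / u\<close> is holomorphic.\<close>

definition near :: "real \<Rightarrow> complex set" where "near R = {u \<in> \<Lambda> - {0}. norm u \<le> 2 * R}"

definition far :: "real \<Rightarrow> complex set" where "far R = {u \<in> \<Lambda> - {0}. norm u > 2 * R}"

definition sigma_tail :: "real \<Rightarrow> complex \<Rightarrow> complex" where
  "sigma_tail R x = (\<Sum>\<^sub>\<infinity>u\<in>far R. log_factor (x / u))"

definition sigma_factor :: "complex \<Rightarrow> complex \<Rightarrow> complex" where
  "sigma_factor x u = (1 - x / u) * exp (x / u + x\<^sup>2 / (2 * u\<^sup>2))"

lemma indep2: "Im ((2 * \<omega>\<^sub>3) / (2 * \<omega>\<^sub>1)) \<noteq> 0"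
  using indep by (simp add: mult_divide_mult_cancel_left)

lemma closed_lattice [simp]: "closed \<Lambda>"
  and closed_half_lattice [simp]: "closed H"
  using closed_lattice_span[OF indep2] closed_lattice_span[OF indep] by blast+

lemma open_Compl_lattice [simp]: "open (- \<Lambda>)" by (simp add: open_Compl)

lemma open_Compl_half_lattice [simp]: "open (- H)" by (simp add: open_Compl)

lemma finite_near [simp]: "finite (near R)"
  by (rule finite_subset[OF _ finite_lattice_Int_bounded[OF indep2, of "2 * R"]]) (auto simp: near_def)

lemma near_Un_far: "near R \<union> far R = \<Lambda> - {0}" "near R \<inter> far R = {}" "\<Lambda> - {0} - near R = far R"
  by (auto simp: near_def far_def)

lemma summable_inverse_cube: "A \<subseteq> \<Lambda> - {0} \<Longrightarrow> (\<lambda>u. C * (1 / norm u ^ 3)) summable_on A"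
  by (intro summable_on_cmult_right summable_on_subset[OF summable_on_lattice_inverse_cube[OF indep2]])

lemma far_bound:
  assumes "u \<in> far R" "x \<in> ball 0 R"
  shows "norm (x / u) < 1 / 2" "u \<noteq> 0" "x \<noteq> u" "norm (log_factor (x / u)) \<le> 2 * R ^ 3 * (1 / norm u ^ 3)"
proof -
  have u: "norm u > 2 * R" "u \<noteq> 0" "norm x < R" using assms by (auto simp: far_def)
  then show 1: "norm (x / u) < 1 / 2" by (simp add: norm_divide field_simps)
  show "u \<noteq> 0" "x \<noteq> u" using u norm_ge_zero[of x] by (auto simp del: norm_ge_zero)
  have "norm (log_factor (x / u)) \<le> 2 * norm (x / u) ^ 3" using 1 by (intro norm_log_factor_le) simp
  also have "\<dots> = 2 * (norm x ^ 3) * (1 / norm u ^ 3)" by (simp add: norm_divide power_divide)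
  also have "\<dots> \<le> 2 * R ^ 3 * (1 / norm u ^ 3)"
    using u by (intro mult_right_mono mult_left_mono power_mono) auto
  finally show "norm (log_factor (x / u)) \<le> 2 * R ^ 3 * (1 / norm u ^ 3)" .
qed

lemma log_factor_quotient_deriv:
  assumes "u \<in> far R" "x \<in> ball 0 R"
  shows "((\<lambda>x. log_factor (x / u)) has_field_derivative (1 / (x - u) + 1 / u + x / u\<^sup>2)) (at x)"
proof -
  note fb = far_bound[OF assms]
  have "((\<lambda>x. log_factor (x / u)) has_field_derivative (- (x / u)\<^sup>2 / (1 - x / u)) * (1 / u)) (at x)"
    using fb(1) by (intro DERIV_chain2[OF has_field_derivative_log_factor])
      (auto intro!: derivative_eq_intros fb(2))
  moreover have "(- (x / u)\<^sup>2 / (1 - x / u)) * (1 / u) = 1 / (x - u) + 1 / u + x / u\<^sup>2"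
  proof -
    have "1 - x / u = (u - x) / u" using fb(2) by (simp add: field_simps)
    moreover have "u - x \<noteq> 0" "x - u \<noteq> 0" using fb(3) by auto
    ultimately show ?thesis using fb(2)
      by (simp add: divide_simps power2_eq_square) (simp add: algebra_simps)
  qed
  ultimately show ?thesis by simp
qed

lemma holomorphic_log_factor_quotient:
  "u \<in> far R \<Longrightarrow> (\<lambda>x. log_factor (x / u)) holomorphic_on ball 0 R"
  unfolding holomorphic_on_open[OF open_ball] using log_factor_quotient_deriv by blast

lemma holomorphic_sigma_tail: "sigma_tail R holomorphic_on ball 0 R"
  unfolding sigma_tail_def[abs_def]
  by (rule holomorphic_infsum(1)[OF open_ball holomorphic_log_factor_quotient far_bound(4) summable_inverse_cube])
    (auto simp: far_def)

lemma deriv_sigma_tail: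
  assumes "x \<in> ball 0 R"
  shows "((\<lambda>u. 1 / (x - u) + 1 / u + x / u\<^sup>2) has_sum deriv (sigma_tail R) x) (far R)"
proof -
  have "((\<lambda>u. (deriv ^^ 1) (\<lambda>x. log_factor (x / u)) x) has_sum (deriv ^^ 1) (sigma_tail R) x) (far R)"
    unfolding sigma_tail_def[abs_def]
    by (rule holomorphic_infsum(2)[OF open_ball holomorphic_log_factor_quotient far_bound(4) summable_inverse_cube])
      (use assms in \<open>auto simp: far_def\<close>)
  then have "((\<lambda>u. deriv (\<lambda>x. log_factor (x / u)) x) has_sum deriv (sigma_tail R) x) (far R)"
    by simp
  then show ?thesis
    using log_factor_quotient_deriv[OF _ assms, THEN DERIV_imp_deriv] by (simp cong: has_sum_cong)
qed

text \<open>On a ball the product splits into finitely many factors, which carry all zeros, and the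
  exponential of a holomorphic function. Holomorphy, zeros, parity and the logarithmic derivative of
  \<sigma> are read off from this form.\<close>

lemma weierstrass_sigma_eq:
  assumes "x \<in> ball 0 R"
  shows "\<sigma> x = x * (\<Prod>u\<in>near R. sigma_factor x u) * exp (sigma_tail R x)"
proof -
  have "((\<lambda>u. log_factor (x / u)) has_sum sigma_tail R x) (\<Lambda> - {0} - near R)"
    unfolding near_Un_far sigma_tail_def
  proof (rule has_sum_infsum, rule abs_summable_summable, rule summable_on_comparison_test[OF summable_inverse_cube])
    show "norm (log_factor (x / u)) \<le> 2 * R ^ 3 * (1 / norm u ^ 3)" if "u \<in> far R" for u
      using far_bound(4)[OF that assms] .
  qed (auto simp: far_def)
  moreover have "sigma_factor x u = exp (log_factor (x / u))" if "u \<in> \<Lambda> - {0} - near R" for u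
  proof -
    have u: "norm (x / u) < 1 / 2" using far_bound[of u R x] that assms by (simp add: near_Un_far)
    then have "1 - x / u \<noteq> 0" by (metis eq_iff_diff_eq_0 less_numeral_extra(3) less_trans norm_one half_gt_zero_iff less_irrefl divide_less_eq_1 one_less_numeral_iff semiring_norm(76) zero_less_one)
    then have "exp (log_factor (x / u)) = (1 - x / u) * exp (x / u + (x / u)\<^sup>2 / 2)"
      unfolding log_factor_def by (simp add: exp_add mult.assoc)
    then show ?thesis by (simp add: sigma_factor_def power_divide mult.commute)
  qed
  ultimately have "((\<lambda>F. \<Prod>u\<in>F. sigma_factor x u) \<longlongrightarrow> (\<Prod>u\<in>near R. sigma_factor x u) * exp (sigma_tail R x))
      (finite_subsets_at_top (\<Lambda> - {0}))"
    by (intro tendsto_prod_exp finite_near) (auto simp: near_def)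
  from tendsto_Lim[OF _ this] show ?thesis
    unfolding weierstrass_sigma_def sigma_factor_def by (simp add: mult.assoc)
qed

lemma holomorphic_sigma_factor [holomorphic_intros]: 
  "(\<lambda>x. sigma_factor x u) holomorphic_on A" if "u \<noteq> 0"
  unfolding sigma_factor_def using that by (intro holomorphic_intros) auto

lemma holomorphic_sigma: "\<sigma> holomorphic_on A"
proof -
  have "\<sigma> field_differentiable at x" for x
  proof -
    define R where "R = norm x + 1"
    have "(\<lambda>x. x * (\<Prod>u\<in>near R. sigma_factor x u) * exp (sigma_tail R x)) holomorphic_on ball 0 R"
      by (intro holomorphic_intros holomorphic_sigma_tail) (auto simp: near_def)
    then have "\<sigma> holomorphic_on ball 0 R"
      by (rule holomorphic_transform) (use weierstrass_sigma_eq in auto)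
    moreover have "x \<in> ball 0 R" by (simp add: R_def)
    ultimately show ?thesis by (intro holomorphic_on_imp_differentiable_at[OF _ open_ball])
  qed
  then show ?thesis by (simp add: field_differentiable_at_within holomorphic_on_def)
qed

lemma sigma_factor_eq_0_iff: "u \<noteq> 0 \<Longrightarrow> sigma_factor x u = 0 \<longleftrightarrow> x = u"
  by (auto simp: sigma_factor_def)

lemma sigma_eq_0_iff: "\<sigma> x = 0 \<longleftrightarrow> x \<in> \<Lambda>"
proof -
  have x: "x \<in> ball 0 (norm x + 1)" by simp
  have "\<sigma> x = 0 \<longleftrightarrow> x = 0 \<or> (\<exists>u\<in>near (norm x + 1). sigma_factor x u = 0)"
    unfolding weierstrass_sigma_eq[OF x] by auto
  also have "\<dots> \<longleftrightarrow> x = 0 \<or> x \<in> near (norm x + 1)"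
    using sigma_factor_eq_0_iff by (auto simp: near_def)
  also have "\<dots> \<longleftrightarrow> x \<in> \<Lambda>"
    by (auto simp: near_def)
  finally show ?thesis .
qed

lemma sigma_0: "\<sigma> 0 = 0" by (simp add: sigma_eq_0_iff)

lemma deriv_sigma_0: "deriv \<sigma> 0 = 1"
proof -
  define g where "g x = (\<Prod>u\<in>near 1. sigma_factor x u) * exp (sigma_tail 1 x)" for x
  have "g holomorphic_on ball 0 1"
    unfolding g_def by (intro holomorphic_intros holomorphic_sigma_tail) (auto simp: near_def)
  then obtain g' where "(g has_field_derivative g') (at 0)"
    by (metis centre_in_ball holomorphic_on_open open_ball zero_less_one)
  then have "((\<lambda>x. x * g x) has_field_derivative g 0) (at 0)"
    by (auto intro!: derivative_eq_intros)
  moreover have "g 0 = 1"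
  proof -
    have "sigma_tail 1 0 = 0" unfolding sigma_tail_def by (simp add: log_factor_def)
    moreover have "(\<Prod>u\<in>near 1. sigma_factor 0 u) = 1" by (intro prod.neutral) (simp add: sigma_factor_def)
    ultimately show ?thesis by (simp add: g_def)
  qed
  ultimately have "((\<lambda>x. x * g x) has_field_derivative 1) (at 0)" by simp
  then have "(\<sigma> has_field_derivative 1) (at 0)"
    by (rule has_field_derivative_transform_within_open[OF _ open_ball[of 0 1]])
      (auto simp: g_def weierstrass_sigma_eq mult.assoc)
  then show ?thesis by (rule DERIV_imp_deriv)
qed

section \<open>The zeta function and the derivatives of its series\<close>

text \<open>This is \<zeta> without its pole at 0, the common object through which the series of
  \<open>\<P>\<close> and the product of \<open>\<sigma>\<close> are compared.\<close>

definition zeta_sum :: "complex \<Rightarrow> complex" where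
  "zeta_sum x = (\<Sum>\<^sub>\<infinity>u\<in>\<Lambda> - {0}. 1 / (x - u) + 1 / u + x / u\<^sup>2)"

text \<open>Each term equals \<open>y\<^sup>2 / u\<^sup>2 * (1 / (y - u))\<close>. On a ball that
  keeps distance \<open>e\<close> from the lattice and on which \<open>norm y \<le> M\<close>, the
  triangle inequality gives \<open>norm u \<le> (M / e + 1) * norm (y - u)\<close>, so one cubic
  majorant serves all lattice points, near and far alike.\<close>

lemma zeta_sum_locally:
  assumes "x \<notin> \<Lambda>"
  shows "\<exists>e>0. ball x e \<subseteq> - \<Lambda> \<and> zeta_sum holomorphic_on ball x e \<and>
    (\<forall>n. ((\<lambda>u. (deriv ^^ n) (\<lambda>x. 1 / (x - u) + 1 / u + x / u\<^sup>2) x) has_sum (deriv ^^ n) zeta_sum x) (\<Lambda> - {0}))"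
proof -
  obtain e0 where e0: "e0 > 0" "ball x e0 \<subseteq> - \<Lambda>"
    using assms open_Compl_lattice by (metis ComplI open_contains_ball)
  define e where "e = e0 / 2"
  have e: "e > 0" "ball x (2 * e) \<subseteq> - \<Lambda>" using e0 by (auto simp: e_def)
  define M where "M = norm x + e"
  define C where "C = M\<^sup>2 * (M / e + 1)"
  have M: "M > 0" using e by (simp add: M_def add_nonneg_pos)
  have hol: "(\<lambda>x. 1 / (x - u) + 1 / u + x / u\<^sup>2) holomorphic_on ball x e" if "u \<in> \<Lambda> - {0}" for u
  proof -
    have "ball x e \<subseteq> ball x (2 * e)" using e(1) by (intro subset_ball) simp
    then have "y \<noteq> u" if "y \<in> ball x e" for y using that \<open>u \<in> \<Lambda> - {0}\<close> e(2) by blast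
    then show ?thesis using that by (intro holomorphic_intros) auto
  qed
  have bound: "norm (1 / (y - u) + 1 / u + y / u\<^sup>2) \<le> C * (1 / norm u ^ 3)"
    if u: "u \<in> \<Lambda> - {0}" and y: "y \<in> ball x e" for u y
  proof -
    have "dist x u \<ge> 2 * e" using u e(2) by (meson ComplD DiffD1 linorder_not_less mem_ball subsetD)
    moreover have "dist x u \<le> dist x y + dist y u" by (rule dist_triangle)
    ultimately have "dist y u \<ge> e" using y by simp
    then have yu: "norm (y - u) \<ge> e" by (simp add: dist_norm)
    have "norm y \<le> norm x + norm (y - x)" by (metis add.commute diff_add_cancel norm_triangle_ineq)
    then have yM: "norm y \<le> M" using y by (simp add: M_def dist_norm norm_minus_commute)
    have "norm u \<le> norm y + norm (y - u)"
      by (metis add.commute diff_add_cancel norm_minus_commute norm_triangle_ineq)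
    also have "\<dots> \<le> M / e * norm (y - u) + norm (y - u)"
    proof -
      have "M / e * e \<le> M / e * norm (y - u)" using yu M e by (intro mult_left_mono) auto
      then show ?thesis using yM e by simp
    qed
    finally have "norm u \<le> (M / e + 1) * norm (y - u)" by (simp add: algebra_simps)
    moreover have yu0: "norm (y - u) > 0" "y \<noteq> u" "u \<noteq> 0" using yu e u by auto
    ultimately have *: "1 / norm (y - u) \<le> (M / e + 1) / norm u"
      by (simp add: divide_simps)
    have "1 / (y - u) + 1 / u + y / u\<^sup>2 = y\<^sup>2 / u\<^sup>2 * (1 / (y - u))"
      using yu0 by (simp add: divide_simps power2_eq_square) (simp add: algebra_simps)
    then have "norm (1 / (y - u) + 1 / u + y / u\<^sup>2) = (norm y)\<^sup>2 / (norm u)\<^sup>2 * (1 / norm (y - u))"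
      by (simp add: norm_mult norm_divide norm_power)
    also have "\<dots> \<le> M\<^sup>2 / (norm u)\<^sup>2 * ((M / e + 1) / norm u)"
      using * yM by (intro mult_mono divide_right_mono power_mono) auto
    also have "\<dots> = C * (1 / norm u ^ 3)" by (simp add: C_def power2_eq_square power3_eq_cube)
    finally show ?thesis .
  qed
  have "zeta_sum holomorphic_on ball x e"
    unfolding zeta_sum_def[abs_def]
    by (rule holomorphic_infsum(1)[OF open_ball hol bound summable_inverse_cube]) auto
  moreover have "((\<lambda>u. (deriv ^^ n) (\<lambda>x. 1 / (x - u) + 1 / u + x / u\<^sup>2) x) has_sum (deriv ^^ n) zeta_sum x) (\<Lambda> - {0})" for n
    unfolding zeta_sum_def[abs_def]
    by (rule holomorphic_infsum(2)[OF open_ball hol bound summable_inverse_cube]) (use e in auto)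
  moreover have "ball x e \<subseteq> - \<Lambda>"
    using order_trans[OF subset_ball[of e "2 * e" x] e(2)] e(1) by simp
  ultimately show ?thesis using e by (intro exI[of _ e]) auto
qed

lemma holomorphic_zeta_sum: "zeta_sum holomorphic_on (- \<Lambda>)"
  unfolding holomorphic_on_open[OF open_Compl_lattice]
  by (metis ComplD zeta_sum_locally centre_in_ball holomorphic_on_open open_ball)

lemma deriv_zeta_term:
  assumes "x \<noteq> u" "u \<noteq> (0 :: complex)"
  shows "(deriv ^^ 1) (\<lambda>x. 1 / (x - u) + 1 / u + x / u\<^sup>2) x = - (1 / (x - u)\<^sup>2 - 1 / u\<^sup>2)"
    and "(deriv ^^ 2) (\<lambda>x. 1 / (x - u) + 1 / u + x / u\<^sup>2) x = 2 / (x - u) ^ 3"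
proof -
  have *: "((\<lambda>x. 1 / (x - u) + 1 / u + x / u\<^sup>2) has_field_derivative - (1 / (x - u)\<^sup>2 - 1 / u\<^sup>2)) (at x)" if "x \<noteq> u" for x
    using that assms(2) by (auto intro!: derivative_eq_intros simp: power2_eq_square)
  then show "(deriv ^^ 1) (\<lambda>x. 1 / (x - u) + 1 / u + x / u\<^sup>2) x = - (1 / (x - u)\<^sup>2 - 1 / u\<^sup>2)"
    using assms by (simp add: DERIV_imp_deriv)
  have "((\<lambda>x. - (1 / (x - u)\<^sup>2 - 1 / u\<^sup>2)) has_field_derivative 2 / (x - u) ^ 3) (at x)"
    using assms by (auto intro!: derivative_eq_intros) (simp add: divide_simps power2_eq_square power3_eq_cube, simp add: algebra_simps power4_eq_xxxx)
  then have "(deriv (\<lambda>x. 1 / (x - u) + 1 / u + x / u\<^sup>2) has_field_derivative 2 / (x - u) ^ 3) (at x)"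
    by (rule has_field_derivative_transform_within_open[of _ _ _ "- {u}"])
      (use DERIV_imp_deriv[OF *] assms in auto)
  then show "(deriv ^^ 2) (\<lambda>x. 1 / (x - u) + 1 / u + x / u\<^sup>2) x = 2 / (x - u) ^ 3"
    by (simp add: numeral_2_eq_2 DERIV_imp_deriv)
qed

lemma weierstrass_p_eq: "x \<notin> \<Lambda> \<Longrightarrow> \<P> x = 1 / x\<^sup>2 - deriv zeta_sum x"
proof -
  assume x: "x \<notin> \<Lambda>"
  have "((\<lambda>u. (deriv ^^ 1) (\<lambda>x. 1 / (x - u) + 1 / u + x / u\<^sup>2) x) has_sum (deriv ^^ 1) zeta_sum x) (\<Lambda> - {0})"
    using zeta_sum_locally[OF x] by blast
  moreover have "(deriv ^^ 1) (\<lambda>x. 1 / (x - u) + 1 / u + x / u\<^sup>2) x = - (1 / (x - u)\<^sup>2 - 1 / u\<^sup>2)" if "u \<in> \<Lambda> - {0}" for u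
    by (rule deriv_zeta_term) (use that x in auto)
  then have "((\<lambda>u. (deriv ^^ 1) (\<lambda>x. 1 / (x - u) + 1 / u + x / u\<^sup>2) x) has_sum (deriv ^^ 1) zeta_sum x) (\<Lambda> - {0})
      \<longleftrightarrow> ((\<lambda>u. - (1 / (x - u)\<^sup>2 - 1 / u\<^sup>2)) has_sum (deriv ^^ 1) zeta_sum x) (\<Lambda> - {0})"
    by (rule has_sum_cong)
  ultimately have "((\<lambda>u. - (1 / (x - u)\<^sup>2 - 1 / u\<^sup>2)) has_sum deriv zeta_sum x) (\<Lambda> - {0})"
    by simp
  then have "(\<Sum>\<^sub>\<infinity>u\<in>\<Lambda> - {0}. - (1 / (x - u)\<^sup>2 - 1 / u\<^sup>2)) = deriv zeta_sum x" by (rule infsumI)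
  then have "- (\<Sum>\<^sub>\<infinity>u\<in>\<Lambda> - {0}. (1 / (x - u)\<^sup>2 - 1 / u\<^sup>2)) = deriv zeta_sum x" by (simp only: infsum_uminus)
  then show ?thesis unfolding weierstrass_p_def by (simp add: minus_equation_iff)
qed

lemma holomorphic_p: "\<P> holomorphic_on (- \<Lambda>)"
proof (rule holomorphic_transform)
  show "(\<lambda>x. 1 / x\<^sup>2 - deriv zeta_sum x) holomorphic_on (- \<Lambda>)"
    using lattice_span_0 by (intro holomorphic_intros holomorphic_deriv[OF holomorphic_zeta_sum]) auto
qed (simp add: weierstrass_p_eq)

text \<open>In the derivative the compensating terms drop out and the pole at 0 joins the other
  terms, so the series runs over the whole lattice and its periodicity is visible.\<close>

lemma deriv_p_has_sum:
  assumes x: "x \<notin> \<Lambda>"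
  shows "((\<lambda>u. - 2 / (x - u) ^ 3) has_sum deriv \<P> x) \<Lambda>"
proof -
  have x0: "x \<noteq> 0" using x lattice_span_0 by blast
  have "((\<lambda>u. (deriv ^^ 2) (\<lambda>x. 1 / (x - u) + 1 / u + x / u\<^sup>2) x) has_sum (deriv ^^ 2) zeta_sum x) (\<Lambda> - {0})"
    using zeta_sum_locally[OF x] by blast
  moreover have "(deriv ^^ 2) (\<lambda>x. 1 / (x - u) + 1 / u + x / u\<^sup>2) x = 2 / (x - u) ^ 3" if "u \<in> \<Lambda> - {0}" for u
    by (rule deriv_zeta_term) (use that x in auto)
  then have "((\<lambda>u. (deriv ^^ 2) (\<lambda>x. 1 / (x - u) + 1 / u + x / u\<^sup>2) x) has_sum (deriv ^^ 2) zeta_sum x) (\<Lambda> - {0})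
      \<longleftrightarrow> ((\<lambda>u. 2 / (x - u) ^ 3) has_sum (deriv ^^ 2) zeta_sum x) (\<Lambda> - {0})"
    by (rule has_sum_cong)
  ultimately have "((\<lambda>u. 2 / (x - u) ^ 3) has_sum (deriv ^^ 2) zeta_sum x) (\<Lambda> - {0})"
    by simp
  then have "((\<lambda>u. - (2 / (x - u) ^ 3)) has_sum - deriv (deriv zeta_sum) x) (\<Lambda> - {0})"
    by (intro has_sum_uminusI) (simp add: numeral_2_eq_2)
  then have "((\<lambda>u. - (2 / (x - u) ^ 3)) has_sum (- (2 / (x - 0) ^ 3) + - deriv (deriv zeta_sum) x)) (insert 0 (\<Lambda> - {0}))"
    by (intro has_sum_insert) auto
  moreover have "(\<P> has_field_derivative (- (2 / (x - 0) ^ 3) + - deriv (deriv zeta_sum) x)) (at x)"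
  proof (rule has_field_derivative_transform_within_open[OF _ open_Compl_lattice])
    have "(deriv zeta_sum has_field_derivative deriv (deriv zeta_sum) x) (at x)"
      using x by (intro holomorphic_derivI[OF holomorphic_deriv[OF holomorphic_zeta_sum]]) auto
    then show "((\<lambda>x. 1 / x\<^sup>2 - deriv zeta_sum x) has_field_derivative (- (2 / (x - 0) ^ 3) + - deriv (deriv zeta_sum) x)) (at x)"
      using x0 by (auto intro!: derivative_eq_intros) (simp add: divide_simps power2_eq_square power3_eq_cube, simp add: algebra_simps power4_eq_xxxx)
  qed (use x in \<open>auto simp: weierstrass_p_eq\<close>)
  moreover have "insert 0 (\<Lambda> - {0}) = \<Lambda>" by (simp add: insert_absorb)
  ultimately show ?thesis by (simp add: DERIV_imp_deriv)
qed

text \<open>Logarithmic differentiation of the local product form. The auxiliary radius disappears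
  because the contributions of \<open>near R\<close> and \<open>far R\<close> recombine to the sum
  over all nonzero periods.\<close>

lemma zeta_eq:
  assumes x: "x \<notin> \<Lambda>"
  shows "\<zeta> x = 1 / x + zeta_sum x"
proof -
  define R where "R = norm x + 1"
  have xR: "x \<in> ball 0 R" by (simp add: R_def)
  have x0: "x \<noteq> 0" using x lattice_span_0 by blast
  have fac: "((\<lambda>x. sigma_factor x u) has_field_derivative sigma_factor x u * (1 / (x - u) + 1 / u + x / u\<^sup>2)) (at x)"
    if u: "u \<in> near R" for u
  proof -
    have u0: "u \<noteq> 0" "x \<noteq> u" using u x by (auto simp: near_def)
    have "(1 - x / u) * (1 / (x - u)) = - 1 / u"
      using u0 by (simp add: divide_simps)
    moreover have "c * e + p * (e * q) = (p * e) * (r + q)" if "p * r = c" for p q r e c :: complex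
      unfolding that[symmetric] by (simp add: algebra_simps)
    ultimately have "- 1 / u * e + (1 - x / u) * (e * (1 / u + 2 * x / (2 * u\<^sup>2))) =
        ((1 - x / u) * e) * (1 / (x - u) + (1 / u + 2 * x / (2 * u\<^sup>2)))" for e
      by blast
    moreover have "2 * x / (2 * u\<^sup>2) = x / u\<^sup>2" by (rule mult_divide_mult_cancel_left) simp
    ultimately have *: "- 1 / u * e + (1 - x / u) * (e * (1 / u + 2 * x / (2 * u\<^sup>2))) =
        ((1 - x / u) * e) * (1 / (x - u) + 1 / u + x / u\<^sup>2)" for e
      by (simp only: add.assoc)
    moreover have "((\<lambda>x. sigma_factor x u) has_field_derivative
      - 1 / u * exp (x / u + x\<^sup>2 / (2 * u\<^sup>2)) + (1 - x / u) * (exp (x / u + x\<^sup>2 / (2 * u\<^sup>2)) * (1 / u + 2 * x / (2 * u\<^sup>2)))) (at x)"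
      unfolding sigma_factor_def using u0
      by (auto intro!: derivative_eq_intros) (simp add: divide_simps power2_eq_square power4_eq_xxxx)
    ultimately show ?thesis unfolding sigma_factor_def by (simp only: *)
  qed
  define P where "P x = (\<Prod>u\<in>near R. sigma_factor x u)" for x
  define Sn where "Sn = (\<Sum>u\<in>near R. 1 / (x - u) + 1 / u + x / u\<^sup>2)"
  have P: "(P has_field_derivative P x * Sn) (at x)"
  proof -
    have nz: "sigma_factor x u \<noteq> 0" if "u \<in> near R" for u
      using that x sigma_factor_eq_0_iff[of u x] by (auto simp: near_def)
    have "(P has_field_derivative P x * (\<Sum>u\<in>near R. (sigma_factor x u * (1 / (x - u) + 1 / u + x / u\<^sup>2)) / sigma_factor x u)) (at x)"
      unfolding P_def by (rule has_field_derivative_prod') (use fac nz in auto)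
    moreover have "(\<Sum>u\<in>near R. (sigma_factor x u * (1 / (x - u) + 1 / u + x / u\<^sup>2)) / sigma_factor x u) = Sn"
      unfolding Sn_def by (intro sum.cong refl) (use nz in simp)
    ultimately show ?thesis by simp
  qed
  have T: "(sigma_tail R has_field_derivative deriv (sigma_tail R) x) (at x)"
    by (rule holomorphic_derivI[OF holomorphic_sigma_tail open_ball xR])
  have "((\<lambda>x. x * P x * exp (sigma_tail R x)) has_field_derivative
     (x * P x * exp (sigma_tail R x)) * (1 / x + Sn + deriv (sigma_tail R) x)) (at x)"
    using x0 by (auto intro!: derivative_eq_intros P T simp: algebra_simps)
  then have "(\<sigma> has_field_derivative (x * P x * exp (sigma_tail R x)) * (1 / x + Sn + deriv (sigma_tail R) x)) (at x)"
    by (rule has_field_derivative_transform_within_open[OF _ open_ball[of 0 R]])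
      (use xR in \<open>auto simp: P_def weierstrass_sigma_eq\<close>)
  then have "deriv \<sigma> x = \<sigma> x * (1 / x + Sn + deriv (sigma_tail R) x)"
    using weierstrass_sigma_eq[OF xR] by (simp add: P_def DERIV_imp_deriv)
  then have "\<zeta> x = 1 / x + (Sn + deriv (sigma_tail R) x)"
    using x sigma_eq_0_iff[of x] unfolding weierstrass_zeta_def by simp
  moreover have "((\<lambda>u. 1 / (x - u) + 1 / u + x / u\<^sup>2) has_sum (Sn + deriv (sigma_tail R) x)) (near R \<union> far R)"
    unfolding Sn_def using deriv_sigma_tail[OF xR] near_Un_far by (intro has_sum_Un_disjoint) auto
  then have "zeta_sum x = Sn + deriv (sigma_tail R) x"
    unfolding zeta_sum_def near_Un_far by (rule infsumI)
  ultimately show ?thesis by simp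
qed

lemma zeta_deriv:
  assumes "x \<notin> \<Lambda>"
  shows "(\<zeta> has_field_derivative - \<P> x) (at x)"
proof (rule has_field_derivative_transform_within_open[OF _ open_Compl_lattice])
  have x0: "x \<noteq> 0" using assms lattice_span_0 by blast
  have "(zeta_sum has_field_derivative deriv zeta_sum x) (at x)"
    using assms by (intro holomorphic_derivI[OF holomorphic_zeta_sum]) auto
  then show "((\<lambda>x. 1 / x + zeta_sum x) has_field_derivative - \<P> x) (at x)"
    using x0 unfolding weierstrass_p_eq[OF assms]
    by (auto intro!: derivative_eq_intros simp: power2_eq_square)
qed (use assms in \<open>auto simp: zeta_eq\<close>)

lemma sigma_deriv: "(\<sigma> has_field_derivative deriv \<sigma> x) (at x)"
  by (rule holomorphic_derivI[OF holomorphic_sigma[of UNIV]]) auto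

lemma deriv_sigma_eq: "x \<notin> \<Lambda> \<Longrightarrow> deriv \<sigma> x = \<zeta> x * \<sigma> x"
  using sigma_eq_0_iff[of x] by (simp add: weierstrass_zeta_def)

lemma sigma_deriv': "x \<notin> \<Lambda> \<Longrightarrow> (\<sigma> has_field_derivative \<zeta> x * \<sigma> x) (at x)"
  using sigma_deriv deriv_sigma_eq by metis

end

subsection \<open>Periodicity and the addition formulas\<close>

text \<open>Every ball is uncountable, so the complement of a countable set is dense.\<close>

lemma eq_off_countable:
  fixes f g :: "complex \<Rightarrow> complex"
  assumes f: "continuous_on UNIV f" and g: "continuous_on UNIV g"
    and C: "countable C" and eq: "\<And>x. x \<notin> C \<Longrightarrow> f x = g x"
  shows "f x = g x"
proof (rule ccontr)
  assume "f x \<noteq> g x"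
  moreover have "open {x. f x \<noteq> g x}" using f g by (rule open_Collect_neq)
  ultimately obtain e where e: "e > 0" "ball x e \<subseteq> {x. f x \<noteq> g x}"
    unfolding open_contains_ball by blast
  then have "ball x e \<subseteq> C" using eq by blast
  with uncountable_ball[OF e(1), of x] C show False using countable_subset by blast
qed

text \<open>Removing a countable closed set leaves the plane connected, so the local constants are
  all the same.\<close>

lemma constant_if_deriv_0_off_countable:
  assumes S: "open S" "countable (- S)" and der: "\<And>x. x \<in> S \<Longrightarrow> (f has_field_derivative 0) (at x)"
  obtains c :: complex where "\<And>x. x \<in> S \<Longrightarrow> f x = c"
proof -
  have "connected S"
    using connected_open_diff_countable[of "UNIV :: complex set" "- S"] S by (simp add: Compl_eq_Diff_UNIV double_diff connected_UNIV)
  moreover have "continuous_on S f"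
    using der by (meson DERIV_isCont continuous_at_imp_continuous_on)
  ultimately show ?thesis
    using that DERIV_zero_connected_constant[of S "{}" f] S(1) der by auto
qed

text \<open>The zeros of \<open>g\<close> are simple and shared by \<open>f\<close>, hence removable
  in the quotient; comparing difference quotients gives the value
  \<open>deriv f x / deriv g x\<close> there.\<close>

lemma entire_quotient:
  assumes f: "f holomorphic_on UNIV" and g: "g holomorphic_on UNIV"
    and zeros: "\<And>x. g x = 0 \<Longrightarrow> f x = 0 \<and> deriv g x \<noteq> 0"
  obtains h where "h holomorphic_on UNIV" "\<And>x. f x = g x * h x"
proof -
  define h where "h x = (if g x = 0 then deriv f x / deriv g x else f x / g x)" for x
  have "h field_differentiable at a" for a
  proof (cases "g a = 0")
    case False
    have op: "open {x. g x \<noteq> 0}"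
      by (intro open_Collect_neq continuous_intros holomorphic_on_imp_continuous_on g)
    have "(\<lambda>x. f x / g x) holomorphic_on {x. g x \<noteq> 0}"
      by (intro holomorphic_intros holomorphic_on_subset[OF f] holomorphic_on_subset[OF g]) auto
    then have "h holomorphic_on {x. g x \<noteq> 0}"
      by (rule holomorphic_transform) (auto simp: h_def)
    from holomorphic_on_imp_differentiable_at[OF this op] show ?thesis using False by simp
  next
    case True
    have f': "(f has_field_derivative deriv f a) (at a)" and g': "(g has_field_derivative deriv g a) (at a)"
      using f g by (auto intro: holomorphic_derivI)
    have fl: "((\<lambda>x. (f x - f a) / (x - a)) \<longlongrightarrow> deriv f a) (at a)"
      and gl: "((\<lambda>x. (g x - g a) / (x - a)) \<longlongrightarrow> deriv g a) (at a)"
      using f' g' by (simp_all add: has_field_derivative_iff)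
    have nz: "deriv g a \<noteq> 0" and fa: "f a = 0" using zeros[OF True] by auto
    have "\<forall>\<^sub>F x in at a. (g x - g a) / (x - a) \<noteq> 0"
      using gl nz by (rule tendsto_imp_eventually_ne)
    then have "\<forall>\<^sub>F x in at a. g x \<noteq> 0"
      by eventually_elim (use True in auto)
    then obtain e where e: "e > 0" and ne: "\<And>x. x \<in> ball a e \<Longrightarrow> x \<noteq> a \<Longrightarrow> g x \<noteq> 0"
      unfolding eventually_at by (auto simp: dist_commute)
    have "h holomorphic_on ball a e"
    proof (rule no_isolated_singularity'[of "{a}"])
      have "((\<lambda>x. ((f x - f a) / (x - a)) / ((g x - g a) / (x - a))) \<longlongrightarrow> deriv f a / deriv g a) (at a)"
        by (intro tendsto_intros fl gl nz)
      then have "(h \<longlongrightarrow> deriv f a / deriv g a) (at a)"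
      proof (rule Lim_transform_eventually)
        show "\<forall>\<^sub>F x in at a. ((f x - f a) / (x - a)) / ((g x - g a) / (x - a)) = h x"
          unfolding eventually_at using e ne fa True
          by (intro exI[of _ e]) (auto simp: h_def dist_commute)
      qed
      then show "(h \<longlongrightarrow> h z) (at z within ball a e)" if "z \<in> {a}" for z
        using that True by (auto simp: h_def intro: tendsto_within_subset)
      have "(\<lambda>x. f x / g x) holomorphic_on ball a e - {a}"
        by (intro holomorphic_intros holomorphic_on_subset[OF f] holomorphic_on_subset[OF g]) (use ne in auto)
      then show "h holomorphic_on ball a e - {a}"
        by (rule holomorphic_transform) (use ne in \<open>auto simp: h_def\<close>)
    qed auto
    then show ?thesis using e by (auto intro: holomorphic_on_imp_differentiable_at)
  qed
  then have "h holomorphic_on UNIV" by (simp add: field_differentiable_at_within holomorphic_on_def)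
  moreover have "f x = g x * h x" for x using zeros[of x] by (simp add: h_def)
  ultimately show ?thesis by (rule that)
qed

context period_pair
begin

section \<open>Parity and periods\<close>

lemma bij_uminus_lattice: "bij_betw uminus (\<Lambda> - {0}) (\<Lambda> - {0})"
  by (rule bij_betwI[of _ _ _ uminus]) auto

lemma p_minus: "\<P> (- x) = \<P> x"
proof -
  have "(\<Sum>\<^sub>\<infinity>u\<in>\<Lambda> - {0}. 1 / (- x - u)\<^sup>2 - 1 / u\<^sup>2)
      = (\<Sum>\<^sub>\<infinity>u\<in>\<Lambda> - {0}. 1 / (- x - (- u))\<^sup>2 - 1 / (- u)\<^sup>2)"
    by (rule infsum_reindex_bij_betw[OF bij_uminus_lattice, symmetric])
  also have "\<dots> = (\<Sum>\<^sub>\<infinity>u\<in>\<Lambda> - {0}. 1 / (x - u)\<^sup>2 - 1 / u\<^sup>2)"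
    by (intro infsum_cong) (simp add: power2_commute)
  finally show ?thesis by (simp add: weierstrass_p_def)
qed

lemma sigma_minus: "\<sigma> (- x) = - \<sigma> x"
proof -
  define R where "R = norm x + 1"
  have "(\<Prod>u\<in>near R. sigma_factor (- x) u) = (\<Prod>u\<in>near R. sigma_factor (- x) (- u))"
    by (rule prod.reindex_bij_betw[symmetric]) (rule bij_betwI[of _ _ _ uminus], auto simp: near_def)
  also have "\<dots> = (\<Prod>u\<in>near R. sigma_factor x u)" by (simp add: sigma_factor_def)
  finally have 1: "(\<Prod>u\<in>near R. sigma_factor (- x) u) = (\<Prod>u\<in>near R. sigma_factor x u)" .
  have "sigma_tail R (- x) = (\<Sum>\<^sub>\<infinity>u\<in>far R. log_factor ((- x) / (- u)))"
    unfolding sigma_tail_def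
    by (rule infsum_reindex_bij_betw[symmetric]) (rule bij_betwI[of _ _ _ uminus], auto simp: far_def)
  then have 2: "sigma_tail R (- x) = sigma_tail R x" by (simp add: sigma_tail_def)
  show ?thesis
    using weierstrass_sigma_eq[of x R] weierstrass_sigma_eq[of "- x" R] 1 2 by (simp add: R_def)
qed

lemma deriv_p_periodic:
  assumes v: "v \<in> \<Lambda>" and x: "x \<notin> \<Lambda>"
  shows "deriv \<P> (x + v) = deriv \<P> x"
proof -
  have "x + v \<notin> \<Lambda>" using x lattice_span_add_iff[OF v] by blast
  then have "((\<lambda>u. - 2 / (x + v - u) ^ 3) has_sum deriv \<P> (x + v)) \<Lambda>" by (rule deriv_p_has_sum)
  moreover have "bij_betw (\<lambda>u. u + v) \<Lambda> \<Lambda>"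
    by (rule bij_betwI[of _ _ _ "\<lambda>u. u - v"]) (use v in \<open>auto intro: lattice_span_add lattice_span_diff\<close>)
  ultimately have "((\<lambda>u. - 2 / (x + v - (u + v)) ^ 3) has_sum deriv \<P> (x + v)) \<Lambda>"
    using has_sum_reindex_bij_betw[of "\<lambda>u. u + v" \<Lambda> \<Lambda> "\<lambda>u. - 2 / (x + v - u) ^ 3"] by simp
  then have "((\<lambda>u. - 2 / (x - u) ^ 3) has_sum deriv \<P> (x + v)) \<Lambda>" by simp
  then show ?thesis using deriv_p_has_sum[OF x] has_sum_unique by blast
qed

lemma p_deriv: "x \<notin> \<Lambda> \<Longrightarrow> (\<P> has_field_derivative deriv \<P> x) (at x)"
  by (rule holomorphic_derivI[OF holomorphic_p]) auto

lemma lattice_shift_notin: "v \<in> \<Lambda> \<Longrightarrow> x + v \<notin> \<Lambda> \<longleftrightarrow> x \<notin> \<Lambda>"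
  using lattice_span_add_iff by blast

lemma DERIV_shift_at: "(f has_field_derivative D) (at (x + v)) \<Longrightarrow> ((\<lambda>x. f (x + v)) has_field_derivative D) (at x)"
  for x v D :: complex
  using DERIV_shift[of f D x v] by simp

text \<open>
  The difference \<open>\<wp>(x + v) - \<wp>(x)\<close> is a constant, which is its own negative because \<open>\<wp>\<close> is even.
\<close>

lemma p_periodic:
  assumes v: "v \<in> \<Lambda>" and x: "x \<notin> \<Lambda>"
  shows "\<P> (x + v) = \<P> x"
proof -
  have "((\<lambda>x. \<P> (x + v) - \<P> x) has_field_derivative 0) (at x)" if "x \<in> - \<Lambda>" for x
  proof -
    have "x \<notin> \<Lambda>" "x + v \<notin> \<Lambda>" using that lattice_shift_notin[OF v] by auto
    from DERIV_diff[OF DERIV_shift_at[OF p_deriv[OF this(2)]] p_deriv[OF this(1)]] show ?thesis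
      using deriv_p_periodic[OF v \<open>x \<notin> \<Lambda>\<close>] by simp
  qed
  then obtain c where c: "\<And>x. x \<in> - \<Lambda> \<Longrightarrow> \<P> (x + v) - \<P> x = c"
    using constant_if_deriv_0_off_countable[of "- \<Lambda>"] countable_lattice_span by auto
  have "\<P> (x + v) - \<P> x = c" using c x by simp
  moreover have "\<P> ((- x - v) + v) - \<P> (- x - v) = c"
  proof (rule c)
    have "- (x + v) \<notin> \<Lambda>" using x lattice_span_add_iff[OF v, of x] lattice_span_minus_iff by blast
    then show "- x - v \<in> - \<Lambda>" by simp
  qed
  moreover have "\<P> (- x - v) = \<P> (x + v)" using p_minus[of "x + v"] by simp
  ultimately have "\<P> (x + v) - \<P> x = \<P> x - \<P> (x + v)" using p_minus[of x] by simp
  then have "2 * \<P> (x + v) = 2 * \<P> x" by (simp add: algebra_simps)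
  then show ?thesis by simp
qed

lemma zeta_quasi_periodic:
  assumes v: "v \<in> \<Lambda>"
  obtains c where "\<And>x. x \<notin> \<Lambda> \<Longrightarrow> \<zeta> (x + v) = \<zeta> x + c"
proof -
  have "((\<lambda>x. \<zeta> (x + v) - \<zeta> x) has_field_derivative 0) (at x)" if "x \<in> - \<Lambda>" for x
  proof -
    have "x \<notin> \<Lambda>" "x + v \<notin> \<Lambda>" using that lattice_shift_notin[OF v] by auto
    from DERIV_diff[OF DERIV_shift_at[OF zeta_deriv[OF this(2)]] zeta_deriv[OF this(1)]] show ?thesis
      using p_periodic[OF v \<open>x \<notin> \<Lambda>\<close>] by simp
  qed
  then obtain c where c: "\<And>x. x \<in> - \<Lambda> \<Longrightarrow> \<zeta> (x + v) - \<zeta> x = c"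
    using constant_if_deriv_0_off_countable[of "- \<Lambda>"] countable_lattice_span by auto
  show ?thesis by (rule that[of c]) (use c in \<open>force simp: algebra_simps\<close>)
qed

text \<open>This integrates the additive law of \<zeta> once more. The values of \<open>A\<close>
  and \<open>c\<close> do not matter later: in quotients of functions with the same exponential
  factor they cancel, and simplicity of zeros needs only \<open>A \<noteq> 0\<close>.\<close>

lemma sigma_quasi_periodic:
  assumes v: "v \<in> \<Lambda>"
  obtains A c where "A \<noteq> 0" "\<And>x. \<sigma> (x + v) = A * exp (c * x) * \<sigma> x"
proof -
  obtain c where c: "\<And>x. x \<notin> \<Lambda> \<Longrightarrow> \<zeta> (x + v) = \<zeta> x + c" using zeta_quasi_periodic[OF v] by metis
  have "((\<lambda>x. \<sigma> (x + v) / (exp (c * x) * \<sigma> x)) has_field_derivative 0) (at x)" if "x \<in> - \<Lambda>" for x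
  proof -
    have x: "x \<notin> \<Lambda>" "x + v \<notin> \<Lambda>" using that lattice_shift_notin[OF v] by auto
    then have nz: "exp (c * x) * \<sigma> x \<noteq> 0" using sigma_eq_0_iff by simp
    have "((\<lambda>x. exp (c * x) * \<sigma> x) has_field_derivative (c + \<zeta> x) * (exp (c * x) * \<sigma> x)) (at x)"
      by (auto intro!: derivative_eq_intros sigma_deriv' x simp: algebra_simps)
    from DERIV_divide[OF DERIV_shift_at[OF sigma_deriv'[OF x(2)]] this nz]
    show ?thesis using c[OF x(1)] by (simp add: algebra_simps)
  qed
  then obtain A where A: "\<And>x. x \<in> - \<Lambda> \<Longrightarrow> \<sigma> (x + v) / (exp (c * x) * \<sigma> x) = A"
    using constant_if_deriv_0_off_countable[of "- \<Lambda>"] countable_lattice_span by auto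
  have eq: "\<sigma> (x + v) = A * exp (c * x) * \<sigma> x" for x
  proof (cases "x \<in> \<Lambda>")
    case True
    then have "\<sigma> x = 0" "\<sigma> (x + v) = 0" using lattice_shift_notin[OF v, of x] by (auto simp: sigma_eq_0_iff)
    then show ?thesis by simp
  next
    case False
    then show ?thesis using A[of x] sigma_eq_0_iff[of x] by (simp add: field_simps)
  qed
  have "A \<noteq> 0"
  proof
    assume "A = 0"
    then have "\<sigma> x = 0" for x using eq[of "x - v"] by simp
    then have "\<Lambda> = UNIV" using sigma_eq_0_iff by blast
    then show False using countable_lattice_span[of "2 * \<omega>\<^sub>1" "2 * \<omega>\<^sub>3"] uncountable_UNIV_complex by simp
  qed
  then show ?thesis using eq that by blast
qed

text \<open>The ball of radius \<open>B\<close> contains a fundamental parallelogram, so all values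
  are attained on a compact set and Liouville's theorem applies.\<close>

lemma periodic_entire_const:
  assumes f: "f holomorphic_on UNIV" and per: "\<And>v x. v \<in> \<Lambda> \<Longrightarrow> f (x + v) = f x"
  obtains c where "\<And>x. f x = c"
proof -
  define B where "B = norm (2 * \<omega>\<^sub>1) + norm (2 * \<omega>\<^sub>3)"
  have w1: "\<omega>\<^sub>1 \<noteq> 0" using indep by auto
  have rep: "\<exists>y\<in>cball 0 B. f x = f y" for x
  proof -
    \<comment> \<open>Real coordinates \<open>r\<close>, \<open>s\<close> of \<open>x\<close> with
      respect to the two periods exist because \<open>t\<close> is not real; their fractional parts
      give the representative in the fundamental parallelogram.\<close>
    define t where "t = \<omega>\<^sub>3 / \<omega>\<^sub>1"
    define z where "z = x / (2 * \<omega>\<^sub>1)"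
    define s where "s = Im z / Im t"
    define r where "r = Re z - s * Re t"
    have "z = of_real r + of_real s * t"
      using indep unfolding t_def[symmetric] by (simp add: complex_eq_iff r_def s_def)
    then have "2 * \<omega>\<^sub>1 * z = of_real r * (2 * \<omega>\<^sub>1) + of_real s * (2 * \<omega>\<^sub>1 * t)" by (simp add: algebra_simps)
    then have x: "x = of_real r * (2 * \<omega>\<^sub>1) + of_real s * (2 * \<omega>\<^sub>3)"
      using w1 by (simp add: z_def t_def)
    define v where "v = of_int \<lfloor>r\<rfloor> * (2 * \<omega>\<^sub>1) + of_int \<lfloor>s\<rfloor> * (2 * \<omega>\<^sub>3)"
    define y where "y = of_real (frac r) * (2 * \<omega>\<^sub>1) + of_real (frac s) * (2 * \<omega>\<^sub>3)"
    have "x = y + v" unfolding x y_def v_def frac_def by (simp add: algebra_simps)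
    moreover have "v \<in> \<Lambda>" unfolding v_def lattice_span_def by blast
    ultimately have "f x = f y" using per by simp
    moreover have "norm y \<le> frac r * norm (2 * \<omega>\<^sub>1) + frac s * norm (2 * \<omega>\<^sub>3)"
      unfolding y_def by (rule norm_triangle_le) (simp add: norm_mult)
    then have "norm y \<le> B"
      using mult_right_mono[OF less_imp_le[OF frac_lt_1[of r]], of "norm (2 * \<omega>\<^sub>1)"]
        mult_right_mono[OF less_imp_le[OF frac_lt_1[of s]], of "norm (2 * \<omega>\<^sub>3)"]
      unfolding B_def by (simp only: norm_ge_zero mult_1_left simp_thms True_implies_equals)
    ultimately show ?thesis by (intro bexI[of _ y]) auto
  qed
  have "compact (f ` cball 0 B)"
    by (intro compact_continuous_image holomorphic_on_imp_continuous_on holomorphic_on_subset[OF f]) auto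
  moreover have "range f \<subseteq> f ` cball 0 B" using rep by blast
  ultimately have "bounded (range f)" by (meson bounded_subset compact_imp_bounded)
  then have "f constant_on UNIV" by (rule Liouville_theorem[OF f])
  then show ?thesis using that unfolding constant_on_def by auto
qed

text \<open>
  This is the entire extension of \<open>\<wp> \<sigma>\<^sup>2\<close>, from \<open>\<wp> = - (\<sigma>' / \<sigma>)'\<close>.
\<close>

definition sigma2_p :: "complex \<Rightarrow> complex" where
  "sigma2_p x = (deriv \<sigma> x)\<^sup>2 - \<sigma> x * deriv (deriv \<sigma>) x"

lemma holomorphic_deriv_sigma: "deriv \<sigma> holomorphic_on UNIV"
  by (intro holomorphic_deriv holomorphic_sigma) auto

lemma holomorphic_sigma2_p: "sigma2_p holomorphic_on UNIV"
  unfolding sigma2_p_def[abs_def]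
  by (intro holomorphic_intros holomorphic_sigma holomorphic_deriv holomorphic_deriv_sigma) auto

lemma sigma2_p_eq:
  assumes x: "x \<notin> \<Lambda>"
  shows "sigma2_p x = \<P> x * (\<sigma> x)\<^sup>2"
proof -
  have nz: "\<sigma> x \<noteq> 0" using x sigma_eq_0_iff by simp
  have "(deriv \<sigma> has_field_derivative deriv (deriv \<sigma>) x) (at x)"
    by (rule holomorphic_derivI[OF holomorphic_deriv_sigma]) auto
  moreover have "(deriv \<sigma> has_field_derivative (- \<P> x * \<sigma> x + (\<zeta> x * \<sigma> x) * \<zeta> x)) (at x)"
  proof (rule has_field_derivative_transform_within_open[OF _ open_Compl_lattice])
    show "((\<lambda>x. \<zeta> x * \<sigma> x) has_field_derivative (- \<P> x * \<sigma> x + (\<zeta> x * \<sigma> x) * \<zeta> x)) (at x)"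
      by (intro DERIV_mult zeta_deriv sigma_deriv' x)
  qed (use x in \<open>auto simp: deriv_sigma_eq\<close>)
  ultimately have "deriv (deriv \<sigma>) x = - \<P> x * \<sigma> x + (\<zeta> x * \<sigma> x) * \<zeta> x"
    by (rule DERIV_unique)
  then show ?thesis
    unfolding sigma2_p_def deriv_sigma_eq[OF x] by (simp only:) (simp add: algebra_simps power2_eq_square)
qed

text \<open>Quasi-periodicity carries the simple zero at 0 to every lattice point. This is the
  hypothesis on the denominator in \<open>entire_quotient\<close>.\<close>

lemma deriv_sigma_lattice_ne_0:
  assumes v: "v \<in> \<Lambda>"
  shows "deriv \<sigma> v \<noteq> 0"
proof -
  obtain A c where A: "A \<noteq> 0" "\<And>x. \<sigma> (x + v) = A * exp (c * x) * \<sigma> x" using sigma_quasi_periodic[OF v] by blast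
  have "((\<lambda>x. \<sigma> (x + v)) has_field_derivative deriv \<sigma> v) (at 0)"
    using sigma_deriv[of "0 + v"] by (intro DERIV_shift_at) simp
  moreover have "((\<lambda>x. A * exp (c * x) * \<sigma> x) has_field_derivative A) (at 0)"
    using sigma_deriv[of 0] unfolding deriv_sigma_0
    by (auto intro!: derivative_eq_intros simp: sigma_0)
  ultimately have "deriv \<sigma> v = A" unfolding A(2) by (rule DERIV_unique)
  then show ?thesis using A(1) by simp
qed

lemma double_mem_lattice_iff: "2 * y \<in> \<Lambda> \<longleftrightarrow> y \<in> H"
proof -
  have "2 * y = of_int m * (2 * \<omega>\<^sub>1) + of_int n * (2 * \<omega>\<^sub>3) \<longleftrightarrow> y = of_int m * \<omega>\<^sub>1 + of_int n * \<omega>\<^sub>3" for m n :: int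
  proof -
    have "of_int m * (2 * \<omega>\<^sub>1) + of_int n * (2 * \<omega>\<^sub>3) = 2 * (of_int m * \<omega>\<^sub>1 + of_int n * \<omega>\<^sub>3)"
      by (simp add: algebra_simps)
    then show ?thesis by (metis mult_cancel_left zero_neq_numeral)
  qed
  then show ?thesis unfolding lattice_span_def by simp
qed

lemma lattice_subset_half: "x \<in> \<Lambda> \<Longrightarrow> x \<in> H"
  using lattice_span_add[of x _ _ x] by (simp flip: double_mem_lattice_iff mult_2)

text \<open>
  For fixed \<open>y \<notin> H\<close> the quotient of the two sides is entire and periodic in \<open>x\<close>, hence a constant,
  which is \<open>1\<close> at \<open>x = 0\<close>.  The other \<open>y\<close> are limits of these.
\<close>

lemma p_sigma_identity: "sigma2_p x * (\<sigma> y)\<^sup>2 - sigma2_p y * (\<sigma> x)\<^sup>2 = - (\<sigma> (x + y) * \<sigma> (x - y))"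
proof -
  have main: "(sigma2_p x - \<P> y * (\<sigma> x)\<^sup>2) * (\<sigma> y)\<^sup>2 = - (\<sigma> (x + y) * \<sigma> (x - y))" if y: "y \<notin> H" for x y
  proof -
    define f where "f x = (sigma2_p x - \<P> y * (\<sigma> x)\<^sup>2) * (\<sigma> y)\<^sup>2" for x
    define g where "g x = - (\<sigma> (x + y) * \<sigma> (x - y))" for x
    have yL: "y \<notin> \<Lambda>" using y lattice_subset_half by blast
    have f: "f holomorphic_on UNIV"
      unfolding f_def by (intro holomorphic_intros holomorphic_sigma2_p holomorphic_sigma)
    have comp: "(\<lambda>x. \<sigma> (x + y)) holomorphic_on UNIV" for y
      by (rule holomorphic_on_compose_gen[OF _ holomorphic_sigma[of UNIV], unfolded o_def]) (auto intro!: holomorphic_intros)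
    have g: "g holomorphic_on UNIV"
      unfolding g_def using comp[of y] comp[of "- y"] by (auto intro!: holomorphic_intros)
    have zeros: "f x = 0 \<and> deriv g x \<noteq> 0" if "g x = 0" for x
    proof -
      have d: "deriv g x = - (deriv \<sigma> (x + y) * \<sigma> (x - y) + deriv \<sigma> (x - y) * \<sigma> (x + y))"
      proof (rule DERIV_imp_deriv)
        have "((\<lambda>x. \<sigma> (x - y)) has_field_derivative deriv \<sigma> (x - y)) (at x)"
          using DERIV_shift_at[OF sigma_deriv[of "x + - y"]] by simp
        from DERIV_minus[OF DERIV_mult[OF DERIV_shift_at[OF sigma_deriv[of "x + y"]] this]]
        show "(g has_field_derivative - (deriv \<sigma> (x + y) * \<sigma> (x - y) + deriv \<sigma> (x - y) * \<sigma> (x + y))) (at x)"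
          unfolding g_def[abs_def] .
      qed
      have dich: "x + y \<in> \<Lambda> \<or> x - y \<in> \<Lambda>" using that by (auto simp: g_def sigma_eq_0_iff)
      \<comment> \<open>If both factors of \<open>g\<close> vanished, their arguments would differ
        by the period \<open>2 * y\<close>. Excluding this makes every zero of \<open>g\<close>
        simple.\<close>
      have excl: "\<not> (x + y \<in> \<Lambda> \<and> x - y \<in> \<Lambda>)"
      proof
        assume "x + y \<in> \<Lambda> \<and> x - y \<in> \<Lambda>"
        then have "(x + y) - (x - y) \<in> \<Lambda>" by (blast intro: lattice_span_diff)
        then show False using y double_mem_lattice_iff[of y] by (simp add: algebra_simps)
      qed
      have 1: "deriv g x \<noteq> 0"
        using dich excl deriv_sigma_lattice_ne_0 unfolding d
        by (cases "x + y \<in> \<Lambda>") (auto simp: sigma_eq_0_iff[THEN iffD2] sigma_eq_0_iff)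
      have xL: "x \<notin> \<Lambda>"
        using dich yL lattice_span_diff[of "x + y" _ _ x] lattice_span_diff[of x _ _ "x - y"] by auto
      have "\<P> x = \<P> y"
        using dich
      proof
        assume "x + y \<in> \<Lambda>"
        from p_periodic[OF this, of "- y"] show ?thesis using yL by (simp add: p_minus)
      next
        assume "x - y \<in> \<Lambda>"
        from p_periodic[OF this, of y] show ?thesis using yL by simp
      qed
      then have "f x = 0" by (simp add: f_def sigma2_p_eq[OF xL])
      with 1 show ?thesis by simp
    qed
    obtain h where h: "h holomorphic_on UNIV" "\<And>x. f x = g x * h x"
      using entire_quotient[OF f g zeros] by blast
    have per: "h (x + v) = h x" if v: "v \<in> \<Lambda>" for x v
    proof (rule eq_off_countable[where f = "\<lambda>x. h (x + v)" and g = h and C = "\<Lambda> \<union> {x. g x = 0}"])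
      show "continuous_on UNIV (\<lambda>x. h (x + v))"
        by (rule continuous_on_compose2[OF holomorphic_on_imp_continuous_on[OF h(1)]]) (auto intro!: continuous_intros)
      show "continuous_on UNIV h" by (rule holomorphic_on_imp_continuous_on[OF h(1)])
      have "{x. g x = 0} \<subseteq> (\<lambda>u. u - y) ` \<Lambda> \<union> (\<lambda>u. u + y) ` \<Lambda>"
      proof
        fix x assume "x \<in> {x. g x = 0}"
        then have "x + y \<in> \<Lambda> \<or> x - y \<in> \<Lambda>" by (auto simp: g_def sigma_eq_0_iff)
        then show "x \<in> (\<lambda>u. u - y) ` \<Lambda> \<union> (\<lambda>u. u + y) ` \<Lambda>"
          using image_eqI[of x "\<lambda>u. u - y" "x + y" \<Lambda>] image_eqI[of x "\<lambda>u. u + y" "x - y" \<Lambda>] by auto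
      qed
      then show "countable (\<Lambda> \<union> {x. g x = 0})"
        using countable_lattice_span countable_subset by (metis countable_Un_iff countable_image)
      obtain A c where A: "A \<noteq> 0" "\<And>x. \<sigma> (x + v) = A * exp (c * x) * \<sigma> x"
        using sigma_quasi_periodic[OF v] by blast
      fix x assume x: "x \<notin> \<Lambda> \<union> {x. g x = 0}"
      then have xv: "x + v \<notin> \<Lambda>" "x \<notin> \<Lambda>" using lattice_shift_notin[OF v] by auto
      have "f (x + v) = A\<^sup>2 * exp (2 * c * x) * f x"
        unfolding f_def sigma2_p_eq[OF xv(1)] sigma2_p_eq[OF xv(2)] p_periodic[OF v xv(2)] A(2)
        by (simp add: algebra_simps power2_eq_square exp_add mult_exp_exp)
      \<comment> \<open>The exponents \<open>c * (x + y)\<close> and \<open>c * (x - y)\<close> add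
        up to \<open>2 * c * x\<close>, so \<open>g\<close> acquires the same factor as
        \<open>f\<close>, and it cancels in \<open>h\<close>.\<close>
      moreover have "g (x + v) = A\<^sup>2 * exp (2 * c * x) * g x"
      proof -
        have e: "x + v + y = (x + y) + v" "x + v - y = (x - y) + v" by simp_all
        have "exp (c * (x + y)) * exp (c * (x - y)) = exp (2 * c * x)"
          by (simp add: mult_exp_exp algebra_simps)
        then show ?thesis unfolding g_def e A(2) by (simp add: power2_eq_square algebra_simps)
      qed
      ultimately have "A\<^sup>2 * exp (2 * c * x) * g x * h x = A\<^sup>2 * exp (2 * c * x) * g x * h (x + v)"
        using h(2)[of x] h(2)[of "x + v"] by (simp only: mult.assoc)
      then show "h (x + v) = h x" using A(1) x by auto
    qed
    obtain c where c: "\<And>x. h x = c" using periodic_entire_const[OF h(1) per] by blast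
    have "f 0 = (\<sigma> y)\<^sup>2" by (simp add: f_def sigma2_p_def deriv_sigma_0 sigma_0)
    moreover have "g 0 = (\<sigma> y)\<^sup>2" by (simp add: g_def sigma_minus power2_eq_square)
    ultimately have "c = 1" using h(2)[of 0] c[of 0] yL by (simp add: sigma_eq_0_iff)
    then show "f x = g x" for x using h(2)[of x] c[of x] by simp
  qed
  show ?thesis
  proof (rule eq_off_countable[where C = H and x = y])
    show "continuous_on UNIV (\<lambda>y. sigma2_p x * (\<sigma> y)\<^sup>2 - sigma2_p y * (\<sigma> x)\<^sup>2)"
      by (intro continuous_intros holomorphic_on_imp_continuous_on holomorphic_sigma holomorphic_sigma2_p)
    show "continuous_on UNIV (\<lambda>y. - (\<sigma> (x + y) * \<sigma> (x - y)))"
      by (intro continuous_intros continuous_on_compose2[OF holomorphic_on_imp_continuous_on[OF holomorphic_sigma[of UNIV]]]) auto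
    show "countable H" by (rule countable_lattice_span)
    fix y assume "y \<notin> H"
    then have "y \<notin> \<Lambda>" using lattice_subset_half by blast
    with main[OF \<open>y \<notin> H\<close>, of x]
    show "sigma2_p x * (\<sigma> y)\<^sup>2 - sigma2_p y * (\<sigma> x)\<^sup>2 = - (\<sigma> (x + y) * \<sigma> (x - y))"
      by (simp add: sigma2_p_eq algebra_simps)
  qed
qed

section \<open>Addition formulas and the zeros of the derivative of \<wp>\<close>

lemma p_diff:
  assumes "x \<notin> \<Lambda>" "y \<notin> \<Lambda>"
  shows "(\<P> x - \<P> y) * ((\<sigma> x)\<^sup>2 * (\<sigma> y)\<^sup>2) = - (\<sigma> (x + y) * \<sigma> (x - y))"
  using p_sigma_identity[of x y] assms by (simp add: sigma2_p_eq algebra_simps)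

lemma p_eq_iff:
  assumes "x \<notin> \<Lambda>" "y \<notin> \<Lambda>"
  shows "\<P> x = \<P> y \<longleftrightarrow> x + y \<in> \<Lambda> \<or> x - y \<in> \<Lambda>"
proof -
  have "(\<sigma> x)\<^sup>2 * (\<sigma> y)\<^sup>2 \<noteq> 0" using assms by (simp add: sigma_eq_0_iff)
  then have "\<P> x = \<P> y \<longleftrightarrow> (\<P> x - \<P> y) * ((\<sigma> x)\<^sup>2 * (\<sigma> y)\<^sup>2) = 0" by simp
  then show ?thesis unfolding p_diff[OF assms] by (simp add: sigma_eq_0_iff)
qed

lemma zeta_minus: "\<zeta> (- x) = - \<zeta> x"
proof -
  have "((\<lambda>x. \<sigma> (- x)) has_field_derivative deriv \<sigma> (- x) * (- 1)) (at x)"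
    by (rule DERIV_chain2[OF sigma_deriv]) (auto intro!: derivative_eq_intros)
  moreover have "((\<lambda>x. \<sigma> (- x)) has_field_derivative - deriv \<sigma> x) (at x)"
    unfolding sigma_minus by (intro DERIV_minus sigma_deriv)
  ultimately have "deriv \<sigma> (- x) * (- 1) = - deriv \<sigma> x" by (rule DERIV_unique)
  then show ?thesis by (simp add: weierstrass_zeta_def sigma_minus)
qed

text \<open>The logarithmic derivative of \<open>p_diff\<close> in \<open>x\<close>. The second
  formula exchanges the variables and uses that \<zeta> is odd.\<close>

lemma zeta_addition:
  assumes "x \<notin> \<Lambda>" "y \<notin> \<Lambda>" "x + y \<notin> \<Lambda>" "x - y \<notin> \<Lambda>"
  shows "deriv \<P> x / (\<P> x - \<P> y) = \<zeta> (x + y) + \<zeta> (x - y) - 2 * \<zeta> x"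
    and "- deriv \<P> y / (\<P> x - \<P> y) = \<zeta> (x + y) - \<zeta> (x - y) - 2 * \<zeta> y"
proof -
  have main: "deriv \<P> x / (\<P> x - \<P> y) = \<zeta> (x + y) + \<zeta> (x - y) - 2 * \<zeta> x"
    if "x \<notin> \<Lambda>" "y \<notin> \<Lambda>" "x + y \<notin> \<Lambda>" "x - y \<notin> \<Lambda>" for x y
  proof -
    define W where "W = (\<P> x - \<P> y) * ((\<sigma> x)\<^sup>2 * (\<sigma> y)\<^sup>2)"
    have Wne: "W \<noteq> 0" unfolding W_def p_diff[OF that(1,2)] using that by (simp add: sigma_eq_0_iff)
    have "((\<lambda>x. (\<P> x - \<P> y) * ((\<sigma> x)\<^sup>2 * (\<sigma> y)\<^sup>2)) has_field_derivative
        deriv \<P> x * ((\<sigma> x)\<^sup>2 * (\<sigma> y)\<^sup>2) + 2 * \<zeta> x * W) (at x)"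
      unfolding W_def
      by (auto intro!: derivative_eq_intros p_deriv sigma_deriv' that) (simp add: algebra_simps power2_eq_square)
    moreover have "((\<lambda>x. (\<P> x - \<P> y) * ((\<sigma> x)\<^sup>2 * (\<sigma> y)\<^sup>2)) has_field_derivative
        (\<zeta> (x + y) + \<zeta> (x - y)) * W) (at x)"
    proof (rule has_field_derivative_transform_within_open[OF _ open_Compl_lattice])
      have "((\<lambda>x. \<sigma> (x - y)) has_field_derivative \<zeta> (x - y) * \<sigma> (x - y)) (at x)"
        using DERIV_shift_at[OF sigma_deriv'[of "x + - y"]] that by simp
      from DERIV_minus[OF DERIV_mult[OF DERIV_shift_at[OF sigma_deriv'[OF that(3)]] this]]
      show "((\<lambda>x. - (\<sigma> (x + y) * \<sigma> (x - y))) has_field_derivative (\<zeta> (x + y) + \<zeta> (x - y)) * W) (at x)"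
        unfolding W_def p_diff[OF that(1,2)] by (simp add: algebra_simps)
    qed (use that p_diff in auto)
    ultimately have "deriv \<P> x * ((\<sigma> x)\<^sup>2 * (\<sigma> y)\<^sup>2) + 2 * \<zeta> x * W = (\<zeta> (x + y) + \<zeta> (x - y)) * W"
      by (rule DERIV_unique)
    then have "deriv \<P> x * ((\<sigma> x)\<^sup>2 * (\<sigma> y)\<^sup>2) = ((\<zeta> (x + y) + \<zeta> (x - y) - 2 * \<zeta> x) * (\<P> x - \<P> y)) * ((\<sigma> x)\<^sup>2 * (\<sigma> y)\<^sup>2)"
      unfolding W_def by (simp add: algebra_simps)
    then have "deriv \<P> x = (\<zeta> (x + y) + \<zeta> (x - y) - 2 * \<zeta> x) * (\<P> x - \<P> y)"
      using Wne unfolding W_def by simp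
    then show ?thesis using Wne unfolding W_def by simp
  qed
  show "deriv \<P> x / (\<P> x - \<P> y) = \<zeta> (x + y) + \<zeta> (x - y) - 2 * \<zeta> x" by (rule main[OF assms])
  have yx: "y - x \<notin> \<Lambda>" using assms(4) lattice_span_minus_iff[of "x - y"] by simp
  have "deriv \<P> y / (\<P> y - \<P> x) = \<zeta> (y + x) + \<zeta> (y - x) - 2 * \<zeta> y"
    using assms yx by (intro main) (auto simp: add.commute)
  moreover have "\<zeta> (y - x) = - \<zeta> (x - y)" using zeta_minus[of "x - y"] by simp
  moreover have "deriv \<P> y / (\<P> y - \<P> x) = - deriv \<P> y / (\<P> x - \<P> y)"
    by (metis minus_diff_eq minus_divide_divide minus_minus)
  ultimately show "- deriv \<P> y / (\<P> x - \<P> y) = \<zeta> (x + y) - \<zeta> (x - y) - 2 * \<zeta> y"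
    by (simp add: add.commute)
qed

text \<open>The infinitesimal form of \<open>p_diff\<close> on the diagonal, where
  \<open>\<sigma> (y - x)\<close> has a zero with derivative 1. It locates the zeros of the
  derivative of \<wp> at the half periods.\<close>

lemma deriv_p_eq:
  assumes x: "x \<notin> \<Lambda>"
  shows "deriv \<P> x * (\<sigma> x) ^ 4 = - \<sigma> (2 * x)"
proof -
  have "((\<lambda>y. (\<P> y - \<P> x) * ((\<sigma> y)\<^sup>2 * (\<sigma> x)\<^sup>2)) has_field_derivative deriv \<P> x * ((\<sigma> x)\<^sup>2 * (\<sigma> x)\<^sup>2)) (at x)"
    by (auto intro!: derivative_eq_intros p_deriv sigma_deriv' x)
  moreover have "((\<lambda>y. (\<P> y - \<P> x) * ((\<sigma> y)\<^sup>2 * (\<sigma> x)\<^sup>2)) has_field_derivative - \<sigma> (2 * x)) (at x)"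
  proof (rule has_field_derivative_transform_within_open[OF _ open_Compl_lattice])
    have "((\<lambda>y. \<sigma> (y - x)) has_field_derivative 1) (at x)"
      using DERIV_shift_at[of \<sigma> 1 x "- x"] sigma_deriv[of 0] by (simp add: deriv_sigma_0)
    from DERIV_minus[OF DERIV_mult[OF DERIV_shift_at[OF sigma_deriv[of "x + x"]] this]]
    have "((\<lambda>y. - (\<sigma> (y + x) * \<sigma> (y - x))) has_field_derivative
        - (deriv \<sigma> (x + x) * \<sigma> (x - x) + 1 * \<sigma> (x + x))) (at x)" .
    moreover have "- (deriv \<sigma> (x + x) * \<sigma> (x - x) + 1 * \<sigma> (x + x)) = - \<sigma> (2 * x)"
      by (simp only: diff_self sigma_0 mult_zero_right add_0_left mult_1_left mult_2)
    ultimately show "((\<lambda>y. - (\<sigma> (y + x) * \<sigma> (y - x))) has_field_derivative - \<sigma> (2 * x)) (at x)"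
      by metis
  qed (use x p_diff in auto)
  ultimately have "deriv \<P> x * ((\<sigma> x)\<^sup>2 * (\<sigma> x)\<^sup>2) = - \<sigma> (2 * x)" by (rule DERIV_unique)
  then show ?thesis by (simp flip: power_add)
qed

lemma deriv_p_eq_0_iff: "x \<notin> \<Lambda> \<Longrightarrow> deriv \<P> x = 0 \<longleftrightarrow> x \<in> H"
  using deriv_p_eq[of x] by (metis double_mem_lattice_iff mult_eq_0_iff neg_equal_0_iff_equal power_not_zero sigma_eq_0_iff)

end

subsection \<open>Half periods and the differential equation\<close>

context period_pair
begin

lemma open_shift_lattice: "open {x. x + y \<notin> \<Lambda>}"
proof -
  have "open ((\<lambda>x. x + y) -` (- \<Lambda>))"
    by (rule open_vimage) (auto intro!: continuous_intros)
  then show ?thesis by (simp add: vimage_def)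
qed

lemma p_deriv2: "x \<notin> \<Lambda> \<Longrightarrow> (deriv \<P> has_field_derivative deriv (deriv \<P>) x) (at x)"
  by (rule holomorphic_derivI[OF holomorphic_deriv[OF holomorphic_p]]) auto

lemma p_second_addition:
  assumes "x \<notin> \<Lambda>" "y \<notin> \<Lambda>" "x + y \<notin> \<Lambda>" "x - y \<notin> \<Lambda>"
  shows "deriv (deriv \<P>) x / (\<P> x - \<P> y) - (deriv \<P> x)\<^sup>2 / (\<P> x - \<P> y)\<^sup>2 = 2 * \<P> x - \<P> (x + y) - \<P> (x - y)"
proof -
  have nz: "\<P> x - \<P> y \<noteq> 0" using p_eq_iff assms by auto
  have "((\<lambda>x. deriv \<P> x / (\<P> x - \<P> y)) has_field_derivative
      (deriv (deriv \<P>) x * (\<P> x - \<P> y) - deriv \<P> x * (deriv \<P> x)) / ((\<P> x - \<P> y) * (\<P> x - \<P> y))) (at x)"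
    by (auto intro!: derivative_eq_intros p_deriv p_deriv2 assms nz)
  moreover have "((\<lambda>x. deriv \<P> x / (\<P> x - \<P> y)) has_field_derivative (- \<P> (x + y) - \<P> (x - y) + 2 * \<P> x)) (at x)"
  proof (rule has_field_derivative_transform_within_open)
    show "open (- \<Lambda> \<inter> {x. x + y \<notin> \<Lambda>} \<inter> {x. x + - y \<notin> \<Lambda>})"
      by (intro open_Int open_shift_lattice open_Compl_lattice)
    have "((\<lambda>x. \<zeta> (x - y)) has_field_derivative - \<P> (x - y)) (at x)"
      using DERIV_shift_at[OF zeta_deriv[of "x + - y"]] assms by simp
    from DERIV_diff[OF DERIV_add[OF DERIV_shift_at[OF zeta_deriv[OF assms(3)]] this] DERIV_cmult[OF zeta_deriv[OF assms(1)], of 2]]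
    show "((\<lambda>x. \<zeta> (x + y) + \<zeta> (x - y) - 2 * \<zeta> x) has_field_derivative (- \<P> (x + y) - \<P> (x - y) + 2 * \<P> x)) (at x)"
      by simp
    show "\<zeta> (z + y) + \<zeta> (z - y) - 2 * \<zeta> z = deriv \<P> z / (\<P> z - \<P> y)"
      if "z \<in> - \<Lambda> \<inter> {x. x + y \<notin> \<Lambda>} \<inter> {x. x + - y \<notin> \<Lambda>}" for z
      using zeta_addition(1)[of z y] that assms by auto
  qed (use assms in auto)
  ultimately have "(deriv (deriv \<P>) x * (\<P> x - \<P> y) - deriv \<P> x * (deriv \<P> x)) / ((\<P> x - \<P> y) * (\<P> x - \<P> y))
      = - \<P> (x + y) - \<P> (x - y) + 2 * \<P> x"
    by (rule DERIV_unique)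
  then show ?thesis using nz by (simp add: diff_divide_distrib power2_eq_square)
qed

text \<open>
  Differentiating the first addition formula in \<open>x\<close> and the second in \<open>y\<close> gives two expressions for
  \<open>\<wp>(x + y) + \<wp>(x - y)\<close>.  At \<open>y = \<omega>\<^sub>i\<close> their equality is linear in \<open>\<wp>'(x)\<^sup>2\<close> and \<open>\<wp>''(x)\<close>.
\<close>

lemma p_differential_relation:
  assumes "x \<notin> \<Lambda>" "y \<notin> \<Lambda>" "x + y \<notin> \<Lambda>" "x - y \<notin> \<Lambda>"
  shows "2 * (\<P> x - \<P> y) ^ 3 = (deriv (deriv \<P>) x + deriv (deriv \<P>) y) * (\<P> x - \<P> y) - (deriv \<P> x)\<^sup>2 + (deriv \<P> y)\<^sup>2"
proof -
  have nz: "\<P> x - \<P> y \<noteq> 0" "\<P> y - \<P> x \<noteq> 0" using p_eq_iff[OF assms(1,2)] assms(3,4) by auto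
  have yx: "y - x \<notin> \<Lambda>" "y + x \<notin> \<Lambda>" using assms lattice_span_minus_iff[of "x - y"] by (auto simp: add.commute)
  have e: "\<P> (y + x) = \<P> (x + y)" "\<P> (y - x) = \<P> (x - y)"
    using p_minus[of "x - y"] by (auto simp: add.commute)
  define d where "d = \<P> x - \<P> y"
  have d: "d \<noteq> 0" "\<P> y - \<P> x = - d" using nz by (auto simp: d_def)
  have 1: "deriv (deriv \<P>) x / d - (deriv \<P> x)\<^sup>2 / d\<^sup>2 = 2 * \<P> x - \<P> (x + y) - \<P> (x - y)"
    using p_second_addition[OF assms] by (simp add: d_def)
  have 2: "deriv (deriv \<P>) y / (- d) - (deriv \<P> y)\<^sup>2 / d\<^sup>2 = 2 * \<P> y - \<P> (x + y) - \<P> (x - y)"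
    using p_second_addition[OF assms(2,1) yx(2,1)] unfolding d(2) e by simp
  have "2 * d = deriv (deriv \<P>) x / d - (deriv \<P> x)\<^sup>2 / d\<^sup>2 - (deriv (deriv \<P>) y / (- d) - (deriv \<P> y)\<^sup>2 / d\<^sup>2)"
    unfolding 1 2 by (simp add: d_def algebra_simps)
  then have "2 * d * d\<^sup>2 = (deriv (deriv \<P>) x / d - (deriv \<P> x)\<^sup>2 / d\<^sup>2 - (deriv (deriv \<P>) y / (- d) - (deriv \<P> y)\<^sup>2 / d\<^sup>2)) * d\<^sup>2"
    by simp
  also have "\<dots> = (deriv (deriv \<P>) x + deriv (deriv \<P>) y) * d - (deriv \<P> x)\<^sup>2 + (deriv \<P> y)\<^sup>2"
    using d(1) by (simp add: field_simps power2_eq_square)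
  finally have "2 * d ^ 3 = (deriv (deriv \<P>) x + deriv (deriv \<P>) y) * d - (deriv \<P> x)\<^sup>2 + (deriv \<P> y)\<^sup>2"
    by (simp add: power2_eq_square power3_eq_cube mult.assoc)
  then show ?thesis unfolding d_def .
qed

text \<open>Coordinates are unique by the norm bound, so membership in \<Lambda> becomes parity
  arithmetic in \<open>H\<close> modulo \<Lambda>, a group of four elements.\<close>

lemma int_combination_mem_lattice_iff:
  "of_int m * \<omega>\<^sub>1 + of_int n * \<omega>\<^sub>3 \<in> \<Lambda> \<longleftrightarrow> even m \<and> even n"
proof
  assume "of_int m * \<omega>\<^sub>1 + of_int n * \<omega>\<^sub>3 \<in> \<Lambda>"
  then obtain p q :: int where "of_int m * \<omega>\<^sub>1 + of_int n * \<omega>\<^sub>3 = of_int p * (2 * \<omega>\<^sub>1) + of_int q * (2 * \<omega>\<^sub>3)"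
    unfolding lattice_span_def by blast
  then have "of_int (m - 2 * p) * \<omega>\<^sub>1 + of_int (n - 2 * q) * \<omega>\<^sub>3 = 0" by (simp add: algebra_simps)
  moreover have "m' = 0 \<and> n' = 0" if "of_int m' * \<omega>\<^sub>1 + of_int n' * \<omega>\<^sub>3 = 0" for m' n' :: int
  proof -
    obtain c :: real where c: "c > 0" and *: "\<And>m n :: int. c * max \<bar>of_int m\<bar> \<bar>of_int n\<bar> \<le> norm (of_int m * \<omega>\<^sub>1 + of_int n * \<omega>\<^sub>3)"
      using lattice_span_norm_bound[OF indep] by metis
    have "c * max \<bar>of_int m'\<bar> \<bar>of_int n'\<bar> \<le> 0" using *[of m' n'] unfolding that by simp
    with c have "max \<bar>real_of_int m'\<bar> \<bar>of_int n'\<bar> \<le> 0" by (simp add: mult_le_0_iff)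
    then show ?thesis by simp
  qed
  ultimately have "m - 2 * p = 0 \<and> n - 2 * q = 0" by blast
  then show "even m \<and> even n" by presburger
next
  assume "even m \<and> even n"
  then obtain p q where "m = 2 * p" "n = 2 * q" by (auto elim!: evenE)
  then have "of_int m * \<omega>\<^sub>1 + of_int n * \<omega>\<^sub>3 = of_int p * (2 * \<omega>\<^sub>1) + of_int q * (2 * \<omega>\<^sub>3)" by simp
  then show "of_int m * \<omega>\<^sub>1 + of_int n * \<omega>\<^sub>3 \<in> \<Lambda>" unfolding lattice_span_def by blast
qed

lemma half_period_simps: "\<omega> 0 = 0" "\<omega> 1 = \<omega>\<^sub>1" "\<omega> 2 = - \<omega>\<^sub>1 - \<omega>\<^sub>3" "\<omega> 3 = \<omega>\<^sub>3"
  by (simp_all add: half_period_def)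

text \<open>The coordinates exist for every index, since the definition assigns
  \<open>\<omega>\<^sub>3\<close> to all indices from 3 on; only the parity clauses single out 0 to
  3.\<close>

lemma half_period_int_combination:
  "\<exists>m n :: int. \<omega> i = of_int m * \<omega>\<^sub>1 + of_int n * \<omega>\<^sub>3 \<and>
    (i = 0 \<longrightarrow> m = 0 \<and> n = 0) \<and> (i = 1 \<longrightarrow> m = 1 \<and> n = 0) \<and> (i = 2 \<longrightarrow> m = -1 \<and> n = -1) \<and> (i = 3 \<longrightarrow> m = 0 \<and> n = 1)"
proof (cases "i \<in> {0, 1, 2}")
  case True
  then consider "i = 0" | "i = 1" | "i = 2" by auto
  then show ?thesis
  proof cases
    case 1 then show ?thesis by (intro exI[of _ 0]) (simp add: half_period_def)
  next
    case 2 then show ?thesis by (intro exI[of _ 1] exI[of _ 0]) (simp add: half_period_def)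
  next
    case 3 then show ?thesis by (intro exI[of _ "-1"] exI[of _ "-1"]) (simp add: half_period_def)
  qed
next
  case False
  then show ?thesis by (intro exI[of _ 0] exI[of _ 1]) (auto simp: half_period_def)
qed

lemma half_period_mem_half_lattice: "\<omega> i \<in> H"
proof -
  obtain m n :: int where "\<omega> i = of_int m * \<omega>\<^sub>1 + of_int n * \<omega>\<^sub>3" using half_period_int_combination by blast
  then show ?thesis unfolding lattice_span_def by blast
qed

lemma half_period_notin_lattice:
  assumes "i \<in> {1, 2, 3}"
  shows "\<omega> i \<notin> \<Lambda>"
proof -
  obtain m n :: int where *: "\<omega> i = of_int m * \<omega>\<^sub>1 + of_int n * \<omega>\<^sub>3"
    and i: "(i = 1 \<longrightarrow> m = 1 \<and> n = 0) \<and> (i = 2 \<longrightarrow> m = -1 \<and> n = -1) \<and> (i = 3 \<longrightarrow> m = 0 \<and> n = 1)"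
    using half_period_int_combination[of i] by blast
  have "odd m \<or> odd n" using assms i by (elim insertE emptyE; simp)
  then show ?thesis unfolding * int_combination_mem_lattice_iff by blast
qed

lemma half_period_add_diff_notin_lattice:
  assumes "i \<in> {1, 2, 3}" "j \<in> {1, 2, 3}" "i \<noteq> j"
  shows "\<omega> i + \<omega> j \<notin> \<Lambda>" "\<omega> i - \<omega> j \<notin> \<Lambda>"
proof -
  obtain m n :: int where mn: "\<omega> i = of_int m * \<omega>\<^sub>1 + of_int n * \<omega>\<^sub>3"
    and i: "(i = 1 \<longrightarrow> m = 1 \<and> n = 0) \<and> (i = 2 \<longrightarrow> m = -1 \<and> n = -1) \<and> (i = 3 \<longrightarrow> m = 0 \<and> n = 1)"
    using half_period_int_combination[of i] by blast
  obtain m' n' :: int where mn': "\<omega> j = of_int m' * \<omega>\<^sub>1 + of_int n' * \<omega>\<^sub>3"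
    and j: "(j = 1 \<longrightarrow> m' = 1 \<and> n' = 0) \<and> (j = 2 \<longrightarrow> m' = -1 \<and> n' = -1) \<and> (j = 3 \<longrightarrow> m' = 0 \<and> n' = 1)"
    using half_period_int_combination[of j] by blast
  have odd: "odd (m + m') \<or> odd (n + n')" "odd (m - m') \<or> odd (n - n')" using assms i j by (elim insertE emptyE; simp)+
  have eq: "\<omega> i + \<omega> j = of_int (m + m') * \<omega>\<^sub>1 + of_int (n + n') * \<omega>\<^sub>3"
    "\<omega> i - \<omega> j = of_int (m - m') * \<omega>\<^sub>1 + of_int (n - n') * \<omega>\<^sub>3"
    by (simp_all add: mn mn' algebra_simps)
  show "\<omega> i + \<omega> j \<notin> \<Lambda>" "\<omega> i - \<omega> j \<notin> \<Lambda>"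
    using odd unfolding eq int_combination_mem_lattice_iff by blast+
qed

lemma half_lattice_shift: "h \<in> H \<Longrightarrow> x + h \<in> H \<longleftrightarrow> x \<in> H" "h \<in> H \<Longrightarrow> x - h \<in> H \<longleftrightarrow> x \<in> H"
  using lattice_span_add_iff[of h _ _ x] lattice_span_add_iff[of "- h" _ _ x] by simp_all

lemma notin_half_lattice:
  assumes "x \<notin> H"
  shows "x \<notin> \<Lambda>" "x + \<omega> i \<notin> \<Lambda>" "x - \<omega> i \<notin> \<Lambda>" "x + \<omega> i \<notin> H"
  using assms lattice_subset_half half_lattice_shift[OF half_period_mem_half_lattice[of i], of x] by blast+

abbreviation "e \<equiv> weierstrass_e \<omega>\<^sub>1 \<omega>\<^sub>3"

lemma e_distinct: "i \<in> {1, 2, 3} \<Longrightarrow> j \<in> {1, 2, 3} \<Longrightarrow> i \<noteq> j \<Longrightarrow> e i \<noteq> e j"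
  unfolding weierstrass_e_def
  using p_eq_iff[OF half_period_notin_lattice half_period_notin_lattice, of i j]
    half_period_add_diff_notin_lattice[of i j] by blast

lemma p_ne_e:
  assumes "x \<notin> H" "i \<in> {1, 2, 3}"
  shows "\<P> x \<noteq> e i"
  using p_eq_iff[of x "\<omega> i"] notin_half_lattice[OF assms(1)] half_period_notin_lattice[OF assms(2)]
  unfolding weierstrass_e_def by blast

lemma deriv_p_half_period: "i \<in> {1, 2, 3} \<Longrightarrow> deriv \<P> (\<omega> i) = 0"
  using deriv_p_eq_0_iff half_period_notin_lattice half_period_mem_half_lattice by blast

text \<open>Applied to two half periods, where both first derivatives vanish, the relation gives the
  sums \<open>c i + c j\<close>, and hence each second derivative \<open>c i\<close>. The two linear
  equations at \<open>\<omega> 1\<close> and \<open>\<omega> 2\<close> then determine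
  \<open>B\<close>, by subtraction, and \<open>A\<close>.\<close>

lemma p_differential_equations:
  assumes x: "x \<notin> H"
  shows "(deriv \<P> x)\<^sup>2 = 4 * (\<P> x - e 1) * (\<P> x - e 2) * (\<P> x - e 3)"
    and "deriv (deriv \<P>) x = 2 * ((\<P> x - e 1) * (\<P> x - e 2) + (\<P> x - e 1) * (\<P> x - e 3) + (\<P> x - e 2) * (\<P> x - e 3))"
proof -
  define c where "c i = deriv (deriv \<P>) (\<omega> i)" for i
  define A where "A = (deriv \<P> x)\<^sup>2"
  define B where "B = deriv (deriv \<P>) x"
  define X where "X = \<P> x"
  have rel: "2 * (X - e i) ^ 3 = (B + c i) * (X - e i) - A" if "i \<in> {1, 2, 3}" for i
    using p_differential_relation[of x "\<omega> i"] notin_half_lattice[OF x] half_period_notin_lattice[OF that]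
    by (simp add: deriv_p_half_period[OF that] weierstrass_e_def X_def A_def B_def c_def)
  have c: "c i + c j = 2 * (e i - e j)\<^sup>2" if "i \<in> {1, 2, 3}" "j \<in> {1, 2, 3}" "i \<noteq> j" for i j
  proof -
    have "2 * (e i - e j) ^ 3 = (c i + c j) * (e i - e j)"
      using p_differential_relation[of "\<omega> i" "\<omega> j"] half_period_notin_lattice half_period_add_diff_notin_lattice that
      by (simp add: deriv_p_half_period weierstrass_e_def c_def)
    then show ?thesis using e_distinct[OF that] by (simp add: power3_eq_cube power2_eq_square)
  qed
  have c12: "c 1 + c 2 = 2 * (e 1 - e 2)\<^sup>2" and c13: "c 1 + c 3 = 2 * (e 1 - e 3)\<^sup>2" and c23: "c 2 + c 3 = 2 * (e 2 - e 3)\<^sup>2"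
    using c by auto
  have ne: "e 1 - e 2 \<noteq> 0" using e_distinct[of 1 2] by simp
  have r1: "2 * (X - e 1) ^ 3 = (B + c 1) * (X - e 1) - A" and r2: "2 * (X - e 2) ^ 3 = (B + c 2) * (X - e 2) - A"
    using rel by auto
  have c1: "c 1 = (e 1 - e 2)\<^sup>2 + (e 1 - e 3)\<^sup>2 - (e 2 - e 3)\<^sup>2"
    and c2: "c 2 = (e 1 - e 2)\<^sup>2 + (e 2 - e 3)\<^sup>2 - (e 1 - e 3)\<^sup>2"
    using c12 c13 c23 by algebra+
  have "(e 1 - e 2) * B = (e 1 - e 2) * (2 * ((X - e 1) * (X - e 2) + (X - e 1) * (X - e 3) + (X - e 2) * (X - e 3)))"
  proof -
    have "(e 1 - e 2) * B = 2 * (X - e 2) ^ 3 - 2 * (X - e 1) ^ 3 + c 1 * (X - e 1) - c 2 * (X - e 2)"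
    proof -
      have "(B + c 1) * (X - e 1) - 2 * (X - e 1) ^ 3 = (B + c 2) * (X - e 2) - 2 * (X - e 2) ^ 3"
        unfolding r1 r2 by simp
      moreover have "(B + c) * (X - p) - S = (B + d) * (X - q) - T \<Longrightarrow> (p - q) * B = T - S + c * (X - p) - d * (X - q)"
        for c p S d q T :: complex
        by algebra
      ultimately show ?thesis by blast
    qed
    also have "\<dots> = (e 1 - e 2) * (2 * ((X - e 1) * (X - e 2) + (X - e 1) * (X - e 3) + (X - e 2) * (X - e 3)))"
      unfolding c1 c2 by (simp add: power2_eq_square power3_eq_cube algebra_simps)
    finally show ?thesis .
  qed
  then have B: "B = 2 * ((X - e 1) * (X - e 2) + (X - e 1) * (X - e 3) + (X - e 2) * (X - e 3))"
    using ne by simp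
  then show "deriv (deriv \<P>) x = 2 * ((\<P> x - e 1) * (\<P> x - e 2) + (\<P> x - e 1) * (\<P> x - e 3) + (\<P> x - e 2) * (\<P> x - e 3))"
    by (simp add: B_def X_def)
  have "A = 4 * (X - e 1) * (X - e 2) * (X - e 3)" 
  proof -
    have "A = (B + c 1) * (X - e 1) - 2 * (X - e 1) ^ 3" unfolding r1 by simp
    also have "\<dots> = 4 * (X - e 1) * (X - e 2) * (X - e 3)"
      unfolding B c1 by (simp add: power2_eq_square power3_eq_cube algebra_simps)
    finally show ?thesis .
  qed
  then show "(deriv \<P> x)\<^sup>2 = 4 * (\<P> x - e 1) * (\<P> x - e 2) * (\<P> x - e 3)" by (simp add: A_def X_def)
qed

lemma two_half_period: "\<omega> i + \<omega> i \<in> \<Lambda>"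
  using double_mem_lattice_iff[of "\<omega> i"] half_period_mem_half_lattice[of i]
  by (simp only: mult_2[of "\<omega> i"] simp_thms)

lemma p_minus_half_period: "x \<notin> H \<Longrightarrow> \<P> (x - \<omega> i) = \<P> (x + \<omega> i)"
proof -
  assume x: "x \<notin> H"
  have "x - \<omega> i + (\<omega> i + \<omega> i) = x + \<omega> i" by simp
  then show ?thesis using p_periodic[OF two_half_period notin_half_lattice(3)[OF x], of i i] by (simp only:)
qed

lemma p_half_period_shift_raw:
  assumes x: "x \<notin> H" and i: "i \<in> {1, 2, 3}"
  shows "deriv (deriv \<P>) x / (\<P> x - e i) - (deriv \<P> x)\<^sup>2 / (\<P> x - e i)\<^sup>2 = 2 * (\<P> x - \<P> (x + \<omega> i))"
  using p_second_addition[of x "\<omega> i"] notin_half_lattice[OF x] half_period_notin_lattice[OF i] p_minus_half_period[OF x]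
  by (simp add: weierstrass_e_def algebra_simps)

text \<open>At a half period \<open>\<P> (x + \<omega> i)\<close> and
  \<open>\<P> (x - \<omega> i)\<close> coincide, so the second addition formula determines their
  value; the differential equations turn it into a Moebius function of
  \<open>\<P> x\<close>.\<close>

lemma p_half_period_shift:
  assumes x: "x \<notin> H"
  shows "\<P> (x + \<omega> 1) = e 1 + (e 1 - e 2) * (e 1 - e 3) / (\<P> x - e 1)"
    "\<P> (x + \<omega> 2) = e 2 + (e 2 - e 1) * (e 2 - e 3) / (\<P> x - e 2)"
    "\<P> (x + \<omega> 3) = e 3 + (e 3 - e 1) * (e 3 - e 2) / (\<P> x - e 3)"
proof -
  \<comment> \<open>The root \<open>a\<close> is distinguished and \<open>b\<close>,
    \<open>c\<close> are interchangeable, so the three permutations of the roots are instances of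
    one computation.\<close>
  have *: "p = a + (a - b) * (a - c) / (X - a)"
    if "S / (X - a) - T / (X - a)\<^sup>2 = 2 * (X - p)" "X \<noteq> a"
      "S = 2 * ((X - a) * (X - b) + (X - a) * (X - c) + (X - b) * (X - c))" "T = 4 * (X - a) * (X - b) * (X - c)"
    for S T X p a b c :: complex
  proof -
    define d where "d = X - a"
    have d: "d \<noteq> 0" "X = d + a" using that by (auto simp: d_def)
    have "(2 * (d * (X - b) + d * (X - c) + (X - b) * (X - c)) / d - 4 * d * (X - b) * (X - c) / d\<^sup>2) * d = 2 * (X - p) * d"
      using that(1) unfolding that(3,4) d_def by simp
    then have "2 * (d * (X - b) + d * (X - c) + (X - b) * (X - c)) - 4 * (X - b) * (X - c) = 2 * (X - p) * d"
    proof -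
      have "4 * d * (X - b) * (X - c) / d\<^sup>2 = 4 * (X - b) * (X - c) / d" using d(1) by (simp add: power2_eq_square)
      moreover have "(u / d - w / d) * d = u - w" for u w using d(1) by (simp add: left_diff_distrib)
      ultimately show ?thesis using \<open>_ = 2 * (X - p) * d\<close> by (simp only:)
    qed
    then have "(p - a) * d = (a - b) * (a - c)" unfolding d(2) by algebra
    then have "p - a = (a - b) * (a - c) / d" using d(1) by (simp add: eq_divide_eq)
    then show ?thesis unfolding d_def by (simp add: algebra_simps)
  qed
  show "\<P> (x + \<omega> 1) = e 1 + (e 1 - e 2) * (e 1 - e 3) / (\<P> x - e 1)"
    by (rule *[OF p_half_period_shift_raw[OF x] p_ne_e[OF x]])
      (simp_all add: p_differential_equations[OF x] algebra_simps)
  show "\<P> (x + \<omega> 2) = e 2 + (e 2 - e 1) * (e 2 - e 3) / (\<P> x - e 2)"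
    by (rule *[OF p_half_period_shift_raw[OF x] p_ne_e[OF x]])
      (simp_all add: p_differential_equations[OF x] algebra_simps)
  show "\<P> (x + \<omega> 3) = e 3 + (e 3 - e 1) * (e 3 - e 2) / (\<P> x - e 3)"
    by (rule *[OF p_half_period_shift_raw[OF x] p_ne_e[OF x]])
      (simp_all add: p_differential_equations[OF x] algebra_simps)
qed

text \<open>The junk value \<open>\<zeta> 0 = 1 / 0 = 0\<close> makes this the logarithmic derivative of \<open>\<sigma>\<close> for \<open>i = 0\<close> as well.\<close>

definition cozeta :: "nat \<Rightarrow> complex \<Rightarrow> complex" where
  "cozeta i x = \<zeta> (x + \<omega> i) - \<zeta> (\<omega> i)"

lemma cozeta_0: "cozeta 0 x = \<zeta> x"
  by (simp add: cozeta_def half_period_simps weierstrass_zeta_def sigma_0)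

text \<open>The addition formula at a half period splits each logarithmic derivative into \<zeta>
  and an elliptic function, so that the \<zeta> terms of the kernel can be collected in one
  coefficient.\<close>

lemma cozeta_eq:
  assumes x: "x \<notin> H" and i: "i \<in> {1, 2, 3}"
  shows "cozeta i x = \<zeta> x + deriv \<P> x / (2 * (\<P> x - e i))"
proof -
  obtain c where c: "\<And>x. x \<notin> \<Lambda> \<Longrightarrow> \<zeta> (x + (\<omega> i + \<omega> i)) = \<zeta> x + c"
    using zeta_quasi_periodic[OF two_half_period] by metis
  \<comment> \<open>Evaluation at \<open>- \<omega> i\<close>, which the period carries to
    \<open>\<omega> i\<close>, together with oddness of \<zeta>.\<close>
  have "c = 2 * \<zeta> (\<omega> i)"
    using c[of "- \<omega> i"] half_period_notin_lattice[OF i] zeta_minus[of "\<omega> i"] by simp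
  moreover have "x - \<omega> i + (\<omega> i + \<omega> i) = x + \<omega> i" by simp
  ultimately have "\<zeta> (x - \<omega> i) = \<zeta> (x + \<omega> i) - 2 * \<zeta> (\<omega> i)"
    using c[OF notin_half_lattice(3)[OF x, of i]] by (simp only: add_diff_cancel)
  moreover have "deriv \<P> x / (\<P> x - e i) = \<zeta> (x + \<omega> i) + \<zeta> (x - \<omega> i) - 2 * \<zeta> x"
    unfolding weierstrass_e_def
    by (rule zeta_addition(1)) (use notin_half_lattice[OF x] half_period_notin_lattice[OF i] in auto)
  moreover have "deriv \<P> x / (2 * (\<P> x - e i)) = deriv \<P> x / (\<P> x - e i) / 2" by simp
  ultimately show ?thesis unfolding cozeta_def by (simp only:) (simp add: diff_divide_distrib)
qed

lemma cozeta_deriv: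
  assumes x: "x \<notin> H"
  shows "(cozeta i has_field_derivative - \<P> (x + \<omega> i)) (at x)"
proof -
  have "((\<lambda>x. \<zeta> (x + \<omega> i)) has_field_derivative - \<P> (x + \<omega> i)) (at x)"
    by (rule DERIV_shift_at[OF zeta_deriv]) (use notin_half_lattice[OF x] in auto)
  from DERIV_diff[OF this DERIV_const[of "\<zeta> (\<omega> i)"]] show ?thesis
    unfolding cozeta_def[abs_def] by simp
qed

section \<open>The co-sigma functions\<close>

abbreviation "co \<equiv> cosigma \<omega>\<^sub>1 \<omega>\<^sub>3"

lemma cosigma_0: "co 0 = \<sigma>"
  by (simp add: cosigma_def fun_eq_iff)

lemma cosigma_ne_0:
  assumes "i \<le> 3" "x \<notin> H"
  shows "co i x \<noteq> 0"
proof (cases "i = 0")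
  case True
  then show ?thesis using notin_half_lattice(1)[OF assms(2)] sigma_eq_0_iff by (simp add: cosigma_0)
next
  case False
  then have "i \<in> {1, 2, 3}" using assms by auto
  then show ?thesis
    using notin_half_lattice(2)[OF assms(2)] half_period_notin_lattice sigma_eq_0_iff False
    by (simp add: cosigma_def Let_def)
qed

lemma cosigma_deriv:
  assumes "x \<notin> H"
  shows "(co i has_field_derivative cozeta i x * co i x) (at x)"
proof (cases "i = 0")
  case True
  then show ?thesis using sigma_deriv'[OF notin_half_lattice(1)[OF assms]] by (simp add: cosigma_0 cozeta_0)
next
  case False
  have "((\<lambda>x. exp (- \<zeta> (\<omega> i) * x) * \<sigma> (x + \<omega> i) / \<sigma> (\<omega> i)) has_field_derivative
      cozeta i x * (exp (- \<zeta> (\<omega> i) * x) * \<sigma> (x + \<omega> i) / \<sigma> (\<omega> i))) (at x)"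
  proof -
    have "((\<lambda>x. \<sigma> (x + \<omega> i)) has_field_derivative \<zeta> (x + \<omega> i) * \<sigma> (x + \<omega> i)) (at x)"
      by (rule DERIV_shift_at[OF sigma_deriv']) (use notin_half_lattice[OF assms] in auto)
    then have "((\<lambda>x. exp (- \<zeta> (\<omega> i) * x) * \<sigma> (x + \<omega> i)) has_field_derivative
        cozeta i x * (exp (- \<zeta> (\<omega> i) * x) * \<sigma> (x + \<omega> i))) (at x)"
      by (auto intro!: derivative_eq_intros simp: cozeta_def algebra_simps)
    from DERIV_cdivide[OF this, of "\<sigma> (\<omega> i)"] show ?thesis by simp
  qed
  moreover have "co i = (\<lambda>x. exp (- \<zeta> (\<omega> i) * x) * \<sigma> (x + \<omega> i) / \<sigma> (\<omega> i))"
    using False by (simp add: cosigma_def Let_def fun_eq_iff)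
  ultimately show ?thesis by simp
qed

text \<open>
  If \<open>\<wp>\<close> omitted \<open>c\<close>, then \<open>1 / (\<wp> - c)\<close> would extend to a periodic entire function vanishing on the lattice.
\<close>

lemma p_surj: "\<exists>x. x \<notin> \<Lambda> \<and> \<P> x = c"
proof (rule ccontr)
  assume no: "\<nexists>x. x \<notin> \<Lambda> \<and> \<P> x = c"
  define g where "g x = sigma2_p x - c * (\<sigma> x)\<^sup>2" for x
  have g_eq: "g x = (\<P> x - c) * (\<sigma> x)\<^sup>2" if "x \<notin> \<Lambda>" for x
    using sigma2_p_eq[OF that] by (simp add: g_def algebra_simps)
  have nz: "g x \<noteq> 0" for x
  proof (cases "x \<in> \<Lambda>")
    case True
    then have "\<sigma> x = 0" by (simp add: sigma_eq_0_iff)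
    then show ?thesis using deriv_sigma_lattice_ne_0[OF True] by (simp add: g_def sigma2_p_def)
  next
    case False
    then show ?thesis using no g_eq[OF False] by (auto simp: sigma_eq_0_iff)
  qed
  define h where "h x = (\<sigma> x)\<^sup>2 / g x" for x
  have "h holomorphic_on UNIV"
    unfolding h_def g_def
    by (intro holomorphic_intros holomorphic_sigma holomorphic_sigma2_p) (use nz in \<open>auto simp: g_def\<close>)
  moreover have "h (x + v) = h x" if v: "v \<in> \<Lambda>" for x v
  proof (cases "x \<in> \<Lambda>")
    case True
    then have "\<sigma> x = 0" "\<sigma> (x + v) = 0" using lattice_shift_notin[OF v, of x] by (auto simp: sigma_eq_0_iff)
    then show ?thesis by (simp add: h_def)
  next
    case False
    then have "h x = 1 / (\<P> x - c)" "h (x + v) = 1 / (\<P> (x + v) - c)"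
      using lattice_shift_notin[OF v, of x] g_eq by (auto simp: h_def sigma_eq_0_iff)
    then show ?thesis using p_periodic[OF v False] by simp
  qed
  ultimately obtain k where k: "\<And>x. h x = k" using periodic_entire_const by blast
  have "k = 0" using k[of 0] by (simp add: h_def sigma_0)
  then have "\<sigma> (\<omega> 1) = 0" using k[of "\<omega> 1"] nz[of "\<omega> 1"] by (simp add: h_def)
  then show False using half_period_notin_lattice[of 1] by (simp add: sigma_eq_0_iff)
qed

end

subsection \<open>The covering of the punctured \<open>w\<close>-plane\<close>

text \<open>A freely null-homotopic loop is null-homotopic with fixed base point, so
  \<open>\<gamma>\<close> and its reverse can be erased from the commutator, which leaves
  \<open>\<delta> +++ reversepath \<delta>\<close>.\<close>

lemma homotopic_loops_pochhammer_contour_null: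
  assumes null: "homotopic_loops B \<gamma> (linepath a a)"
    and \<delta>: "path \<delta>" "path_image \<delta> \<subseteq> B" "pathfinish \<delta> = pathstart \<delta>" "pathstart \<delta> = pathstart \<gamma>"
  shows "\<exists>b. homotopic_loops B (pochhammer_contour \<gamma> \<delta>) (linepath b b)"
proof -
  define b where "b = pathstart \<gamma>"
  have \<gamma>b: "homotopic_paths B \<gamma> (linepath b b)"
    using homotopic_loops_imp_homotopic_paths_null[OF null] by (simp add: b_def)
  have \<gamma>: "pathfinish \<gamma> = b" "pathstart \<gamma> = b" "path \<gamma>" "path_image \<gamma> \<subseteq> B"
    using homotopic_loops_imp_loop[OF null] homotopic_loops_imp_path[OF null] homotopic_loops_imp_subset[OF null]
    by (auto simp: b_def)
  have \<delta>': "pathstart \<delta> = b" "pathfinish \<delta> = b" using \<delta> by (auto simp: b_def)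
  have r: "homotopic_paths B (reversepath \<gamma>) (linepath b b)"
    using homotopic_paths_reversepath_D[OF \<gamma>b] by simp
  have refl: "homotopic_paths B \<delta> \<delta>" "homotopic_paths B (reversepath \<delta>) (reversepath \<delta>)"
    using \<delta> by (auto simp: homotopic_paths_refl)
  have 1: "homotopic_paths B (reversepath \<gamma> +++ reversepath \<delta>) (reversepath \<delta>)"
  proof (rule homotopic_paths_trans)
    show "homotopic_paths B (reversepath \<gamma> +++ reversepath \<delta>) (linepath b b +++ reversepath \<delta>)"
      by (rule homotopic_paths_join[OF r refl(2)]) (simp add: \<gamma> \<delta>')
    show "homotopic_paths B (linepath b b +++ reversepath \<delta>) (reversepath \<delta>)"
      using homotopic_paths_lid[of "reversepath \<delta>" B] \<delta> \<delta>' by simp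
  qed
  have 2: "homotopic_paths B (\<delta> +++ reversepath \<gamma> +++ reversepath \<delta>) (linepath b b)"
  proof (rule homotopic_paths_trans)
    show "homotopic_paths B (\<delta> +++ reversepath \<gamma> +++ reversepath \<delta>) (\<delta> +++ reversepath \<delta>)"
      by (rule homotopic_paths_join[OF refl(1) 1]) (simp add: \<gamma> \<delta>')
    show "homotopic_paths B (\<delta> +++ reversepath \<delta>) (linepath b b)"
      using homotopic_paths_rinv[OF \<delta>(1,2)] \<delta>' by simp
  qed
  have "homotopic_paths B (pochhammer_contour \<gamma> \<delta>) (linepath b b +++ linepath b b)"
    unfolding pochhammer_contour_def
    by (rule homotopic_paths_join[OF \<gamma>b 2]) (simp add: \<gamma> \<delta>')
  then have "homotopic_loops B (pochhammer_contour \<gamma> \<delta>) (linepath b b +++ linepath b b)"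
    by (rule homotopic_paths_imp_homotopic_loops) (simp_all add: pochhammer_contour_def \<gamma> \<delta>')
  moreover have "linepath b b +++ linepath b b = linepath b b"
    by (auto simp: joinpaths_def linepath_def fun_eq_iff algebra_simps simp flip: scaleR_add_left)
  ultimately show ?thesis by auto
qed

text \<open>Winding numbers are additive under joining and change sign under reversal, so they
  vanish on commutators.\<close>

lemma winding_number_pochhammer_contour:
  assumes "path \<gamma>" "z \<notin> path_image \<gamma>" "pathfinish \<gamma> = pathstart \<gamma>"
    and "path \<delta>" "z \<notin> path_image \<delta>" "pathfinish \<delta> = pathstart \<delta>" "pathstart \<delta> = pathstart \<gamma>"
  shows "winding_number (pochhammer_contour \<gamma> \<delta>) z = 0"
proof -
  have 1: "winding_number (reversepath \<gamma> +++ reversepath \<delta>) z = - winding_number \<gamma> z - winding_number \<delta> z"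
    using assms by (subst winding_number_join) (simp_all add: winding_number_reversepath)
  have 2: "winding_number (\<delta> +++ reversepath \<gamma> +++ reversepath \<delta>) z = - winding_number \<gamma> z"
    using assms by (subst winding_number_join) (simp_all add: 1 path_image_join)
  show ?thesis
    unfolding pochhammer_contour_def using assms by (subst winding_number_join) (simp_all add: 2 path_image_join)
qed

context period_pair
begin

section \<open>Fibres and sheets of \<open>w\<close>\<close>

abbreviation "w \<equiv> w_coord \<omega>\<^sub>1 \<omega>\<^sub>3"

lemma e2_ne_e1: "e 2 - e 1 \<noteq> 0"
  using e_distinct[of 2 1] by simp

lemma w_eq_iff:
  assumes "x \<notin> \<Lambda>" "y \<notin> \<Lambda>"
  shows "w x = w y \<longleftrightarrow> x + y \<in> \<Lambda> \<or> x - y \<in> \<Lambda>"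
proof -
  have "w x = w y \<longleftrightarrow> \<P> x = \<P> y" using e2_ne_e1 by (auto simp: w_coord_def)
  then show ?thesis using p_eq_iff[OF assms] by simp
qed

lemma holomorphic_w: "w holomorphic_on (- \<Lambda>)"
  unfolding w_coord_def[abs_def] using e2_ne_e1 by (intro holomorphic_intros holomorphic_p)

lemma half_lattice_cases:
  assumes "x \<in> H" "x \<notin> \<Lambda>"
  shows "\<exists>i\<in>{1, 2, 3}. x - \<omega> i \<in> \<Lambda>"
proof -
  obtain m n :: int where x: "x = of_int m * \<omega>\<^sub>1 + of_int n * \<omega>\<^sub>3" using assms(1) unfolding lattice_span_def by blast
  have e: "x - \<omega> 1 = of_int (m - 1) * \<omega>\<^sub>1 + of_int n * \<omega>\<^sub>3"
    "x - \<omega> 2 = of_int (m + 1) * \<omega>\<^sub>1 + of_int (n + 1) * \<omega>\<^sub>3"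
    "x - \<omega> 3 = of_int m * \<omega>\<^sub>1 + of_int (n - 1) * \<omega>\<^sub>3"
    unfolding x half_period_simps by (simp_all add: algebra_simps)
  have "\<not> (even m \<and> even n)" using assms(2) unfolding x int_combination_mem_lattice_iff .
  then have "(even (m - 1) \<and> even n) \<or> (even (m + 1) \<and> even (n + 1)) \<or> (even m \<and> even (n - 1))"
    by presburger
  then show ?thesis by (simp only: bex_simps e int_combination_mem_lattice_iff) simp
qed

lemma w_image: "w ` (- H) = - {w (\<omega> 1), w (\<omega> 2), w (\<omega> 3)}"
proof (intro equalityI subsetI)
  fix y assume "y \<in> w ` (- H)"
  then obtain x where x: "x \<notin> H" "y = w x" by auto
  have "w x \<noteq> w (\<omega> i)" if "i \<in> {1, 2, 3}" for i
    using w_eq_iff[OF notin_half_lattice(1)[OF x(1)] half_period_notin_lattice[OF that]] notin_half_lattice(2,3)[OF x(1), of i] by blast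
  then show "y \<in> - {w (\<omega> 1), w (\<omega> 2), w (\<omega> 3)}" using x(2) by auto
next
  fix y assume y: "y \<in> - {w (\<omega> 1), w (\<omega> 2), w (\<omega> 3)}"
  obtain x where x: "x \<notin> \<Lambda>" "\<P> x = e 1 + (e 2 - e 1) * y" using p_surj by blast
  then have wx: "w x = y" using e2_ne_e1 by (simp add: w_coord_def)
  have "x \<notin> H"
  proof
    assume "x \<in> H"
    from half_lattice_cases[OF this x(1)] obtain i where i: "i \<in> {1, 2, 3}" "x - \<omega> i \<in> \<Lambda>" by blast
    then have "w x = w (\<omega> i)" using w_eq_iff[OF x(1) half_period_notin_lattice[OF i(1)]] by blast
    then show False using y wx i(1) by auto
  qed
  then show "y \<in> w ` (- H)" using wx by blast
qed

text \<open>Points in a common fibre have sum or difference in \<Lambda>. Near \<open>c\<close> the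
  sum stays close to \<open>2 * c\<close>, which is no period, and the difference is too small to be
  a nonzero period.\<close>

lemma w_inj_on_small_balls:
  assumes c: "c \<notin> H"
  obtains r where "r > 0" "ball c r \<subseteq> - H"
    "\<And>x y. x \<in> ball c r \<Longrightarrow> y \<in> ball c r \<Longrightarrow> w x = w y \<Longrightarrow> x = y"
proof -
  obtain r1 where r1: "r1 > 0" "ball c r1 \<subseteq> - H"
    using c openE[OF open_Compl_half_lattice, of c] by blast
  have "2 * c \<notin> \<Lambda>" using c double_mem_lattice_iff by blast
  then obtain r2 where r2: "r2 > 0" "ball (2 * c) r2 \<subseteq> - \<Lambda>"
    using openE[OF open_Compl_lattice, of "2 * c"] by blast
  have "closed (\<Lambda> - {0})" by (rule closed_lattice_span[OF indep2]) auto
  then obtain r3 where r3: "r3 > 0" "ball 0 r3 \<subseteq> - (\<Lambda> - {0})"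
    using openE[OF open_Compl, of "\<Lambda> - {0}" 0] by blast
  define r where "r = min r1 (min (r2 / 2) (r3 / 2))"
  show ?thesis
  proof
    show "r > 0" using r1 r2 r3 by (simp add: r_def)
    show sub: "ball c r \<subseteq> - H" using r1 subset_ball[of r r1 c] by (auto simp: r_def)
    fix x y assume xy: "x \<in> ball c r" "y \<in> ball c r" "w x = w y"
    then have "x \<notin> \<Lambda>" "y \<notin> \<Lambda>" using sub lattice_subset_half by auto
    then have "x + y \<in> \<Lambda> \<or> x - y \<in> \<Lambda>" using w_eq_iff xy(3) by blast
    moreover have "x + y \<notin> \<Lambda>"
    proof -
      have "norm (2 * c - (x + y)) \<le> norm (c - x) + norm (c - y)"
        using norm_triangle_ineq[of "c - x" "c - y"] by (simp add: algebra_simps)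
      also have "\<dots> < r2" using xy by (auto simp: r_def dist_norm)
      finally have "x + y \<in> ball (2 * c) r2" by (simp add: dist_norm)
      then show ?thesis using r2 by blast
    qed
    moreover have "x - y \<in> ball 0 r3"
    proof -
      have "norm (x - y) \<le> norm (c - y) + norm (c - x)"
        using norm_triangle_ineq4[of "c - y" "c - x"] by (simp add: algebra_simps)
      also have "\<dots> < r3" using xy by (auto simp: r_def dist_norm)
      finally show ?thesis by simp
    qed
    ultimately show "x = y" using r3(2) by auto
  qed
qed

text \<open>The fibres are the orbits of the maps \<open>x \<mapsto> \<plusminus>x + u\<close> with
  \<open>u\<close> in \<Lambda>. A point fixed by a reflection satisfies
  \<open>2 * x \<in> \<Lambda>\<close>, so the group acts freely off \<open>H\<close>, and the
  images of a small ball are disjoint sheets.\<close>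

lemma covering_space_w: "covering_space (- H) w (- {w (\<omega> 1), w (\<omega> 2), w (\<omega> 3)})"
  unfolding covering_space_def
proof (intro conjI ballI)
  have cont: "continuous_on (- H) w"
    by (rule holomorphic_on_imp_continuous_on[OF holomorphic_on_subset[OF holomorphic_w]]) (use lattice_subset_half in auto)
  then show "continuous_on (- H) w" .
  show "w ` (- H) = - {w (\<omega> 1), w (\<omega> 2), w (\<omega> 3)}" by (rule w_image)
  fix y assume "y \<in> - {w (\<omega> 1), w (\<omega> 2), w (\<omega> 3)}"
  then obtain c where c: "c \<notin> H" "w c = y" unfolding w_image[symmetric] by blast
  obtain r where r: "r > 0" "ball c r \<subseteq> - H"
    and inj: "\<And>x y. x \<in> ball c r \<Longrightarrow> y \<in> ball c r \<Longrightarrow> w x = w y \<Longrightarrow> x = y"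
    using w_inj_on_small_balls[OF c(1)] by metis
  define T where "T = w ` ball c r"
  \<comment> \<open>The images of \<open>ball c r\<close> under
    \<open>y \<mapsto> s * y + u\<close>, where the sign reflects evenness and \<open>u\<close>
    periodicity of \<wp>.\<close>
  define V where "V = (\<lambda>(s, u). ball (s * c + u) r) ` ({1, -1} \<times> \<Lambda>)"
  have transf: "x \<in> ball (s * c + u) r \<longleftrightarrow> s * (x - u) \<in> ball c r" if "s \<in> {1, -1}" for s x u
  proof -
    have "s * c + u - x = s * (c - s * (x - u))" using that by (auto simp: algebra_simps)
    moreover have "norm s = 1" using that by auto
    ultimately have "norm (s * c + u - x) = norm (c - s * (x - u))" by (simp add: norm_mult)
    then show ?thesis by (simp add: dist_norm)
  qed
  have in_H: "x \<in> H \<longleftrightarrow> s * (x - u) \<in> H" if "s \<in> {1, -1}" "u \<in> \<Lambda>" for s x u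
  proof -
    have "x - u \<in> H \<longleftrightarrow> x \<in> H" by (rule half_lattice_shift(2)[OF lattice_subset_half[OF that(2)]])
    then show ?thesis using that(1) lattice_span_minus_iff[of "x - u"] by auto
  qed
  have w_transf: "w (s * (x - u)) = w x" if "s \<in> {1, -1}" "u \<in> \<Lambda>" "x \<notin> H" for s x u
  proof (subst w_eq_iff)
    show "x \<notin> \<Lambda>" "s * (x - u) \<notin> \<Lambda>" using lattice_subset_half that in_H[OF that(1,2)] by blast+
    show "s * (x - u) + x \<in> \<Lambda> \<or> s * (x - u) - x \<in> \<Lambda>" using that(1,2) by auto
  qed
  \<comment> \<open>Continuity and injectivity suffice here and for the inverses below, by
    invariance of domain.\<close>
  have open_T: "open T" unfolding T_def
    by (rule invariance_of_domain[OF continuous_on_subset[OF cont r(2)]]) (auto intro: inj_onI inj)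
  show "\<exists>T. y \<in> T \<and> openin (top_of_set (- {w (\<omega> 1), w (\<omega> 2), w (\<omega> 3)})) T \<and>
      (\<exists>v. \<Union> v = - H \<inter> w -` T \<and> (\<forall>u\<in>v. openin (top_of_set (- H)) u) \<and> pairwise disjnt v \<and>
        (\<forall>u\<in>v. \<exists>q. homeomorphism u T w q))"
  proof (intro exI[of _ T] conjI exI[of _ V])
    show "y \<in> T" using c r(1) by (auto simp: T_def)
    have "T \<subseteq> - {w (\<omega> 1), w (\<omega> 2), w (\<omega> 3)}" unfolding T_def w_image[symmetric] using r(2) by blast
    then show "openin (top_of_set (- {w (\<omega> 1), w (\<omega> 2), w (\<omega> 3)})) T"
      using open_T by (metis openin_subset_trans openin_open_eq open_openin_trans open_Compl finite_imp_closed finite.emptyI finite_insert)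
    have sub: "ball (s * c + u) r \<subseteq> - H" if "s \<in> {1, -1}" "u \<in> \<Lambda>" for s u
      using transf[OF that(1), of _ u] in_H[OF that] r(2) by blast
    show "\<Union> V = - H \<inter> w -` T"
    proof (intro equalityI subsetI)
      fix x assume "x \<in> \<Union> V"
      then obtain s u where su: "s \<in> {1, -1}" "u \<in> \<Lambda>" "x \<in> ball (s * c + u) r" unfolding V_def by blast
      then have "x \<notin> H" using sub by blast
      moreover have "w x \<in> T" using w_transf[OF su(1,2) \<open>x \<notin> H\<close>] transf[OF su(1)] su(3) unfolding T_def by (metis image_eqI)
      ultimately show "x \<in> - H \<inter> w -` T" by simp
    next
      fix x assume "x \<in> - H \<inter> w -` T"
      then obtain \<xi> where \<xi>: "x \<notin> H" "\<xi> \<in> ball c r" "w x = w \<xi>" unfolding T_def by auto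
      have "x \<notin> \<Lambda>" "\<xi> \<notin> \<Lambda>" using \<xi> r(2) lattice_subset_half by auto
      then consider "x + \<xi> \<in> \<Lambda>" | "x - \<xi> \<in> \<Lambda>" using w_eq_iff \<xi>(3) by blast
      then show "x \<in> \<Union> V"
      proof cases
        case 1
        have "x \<in> ball ((-1) * c + (x + \<xi>)) r" using \<xi>(2) by (subst transf) auto
        then show ?thesis using 1 unfolding V_def by (intro UnionI[OF image_eqI[OF refl, of "(-1, x + \<xi>)"]]) auto
      next
        case 2
        have "x \<in> ball (1 * c + (x - \<xi>)) r" using \<xi>(2) by (subst transf) auto
        then show ?thesis using 2 unfolding V_def by (intro UnionI[OF image_eqI[OF refl, of "(1, x - \<xi>)"]]) auto
      qed
    qed
    show "\<forall>u\<in>V. openin (top_of_set (- H)) u"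
    proof
      fix A assume "A \<in> V"
      then obtain s u where su: "s \<in> {1, -1}" "u \<in> \<Lambda>" "A = ball (s * c + u) r" unfolding V_def by auto
      then show "openin (top_of_set (- H)) A" using sub[OF su(1,2)] by (simp add: openin_open_eq)
    qed
    show "pairwise disjnt V"
    proof (rule pairwiseI)
      fix A B assume AB: "A \<in> V" "B \<in> V" "A \<noteq> B"
      obtain s u where su: "s \<in> {1, -1}" "u \<in> \<Lambda>" "A = ball (s * c + u) r" using AB(1) unfolding V_def by auto
      obtain s' u' where su': "s' \<in> {1, -1}" "u' \<in> \<Lambda>" "B = ball (s' * c + u') r" using AB(2) unfolding V_def by auto
      show "disjnt A B"
        unfolding disjnt_iff
      proof (intro allI notI)
        fix x assume x: "x \<in> A \<and> x \<in> B"
        then have xH: "x \<notin> H" using sub[OF su(1,2)] su(3) by blast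
        have b: "s * (x - u) \<in> ball c r" "s' * (x - u') \<in> ball c r"
          using x transf[OF su(1)] transf[OF su'(1)] unfolding su(3) su'(3) by blast+
        have "w (s * (x - u)) = w (s' * (x - u'))"
          using w_transf[OF su(1,2) xH] w_transf[OF su'(1,2) xH] by simp
        from inj[OF b this] have eq: "s * (x - u) = s' * (x - u')" .
        show False
        proof (cases "s = s'")
          case True
          then have "u = u'" using eq su(1) by auto
          then show False using True AB(3) su(3) su'(3) by simp
        next
          case False
          then have "x - u = - (x - u')" using eq su(1) su'(1) by auto
          then have "2 * x = u + u'" by (simp add: algebra_simps)
          then have "2 * x \<in> \<Lambda>" using lattice_span_add[OF su(2) su'(2)] by simp
          then show False using xH double_mem_lattice_iff by blast
        qed
      qed
    qed
    show "\<forall>u\<in>V. \<exists>q. homeomorphism u T w q"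
    proof
      fix A assume "A \<in> V"
      then obtain s u where su: "s \<in> {1, -1}" "u \<in> \<Lambda>" "A = ball (s * c + u) r" unfolding V_def by auto
      note subA = sub[OF su(1,2), folded su(3)]
      have tr: "x \<in> A \<longleftrightarrow> s * (x - u) \<in> ball c r" for x unfolding su(3) by (rule transf[OF su(1)])
      have "inj_on w A"
      proof (rule inj_onI)
        fix x x' assume xx: "x \<in> A" "x' \<in> A" "w x = w x'"
        have "s * (x - u) = s * (x' - u)"
        proof (rule inj)
          have "x \<notin> H" "x' \<notin> H" using subA xx by blast+
          then show "w (s * (x - u)) = w (s * (x' - u))"
            unfolding w_transf[OF su(1,2) \<open>x \<notin> H\<close>] w_transf[OF su(1,2) \<open>x' \<notin> H\<close>] by (intro xx)
        qed (use xx tr in auto)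
        then show "x = x'" using su(1) by auto
      qed
      then obtain q where q: "homeomorphism A (w ` A) w q"
        using invariance_of_domain_homeomorphism[of A w] continuous_on_subset[OF cont subA] su(3) by auto
      have "w ` A = T"
      proof (intro equalityI subsetI)
        fix z assume "z \<in> w ` A"
        then obtain x where x: "x \<in> A" "z = w x" by auto
        then show "z \<in> T" unfolding T_def using w_transf[OF su(1,2), of x] tr[of x] subA by (metis ComplD image_eqI subsetD)
      next
        fix z assume "z \<in> T"
        then obtain \<xi> where \<xi>: "\<xi> \<in> ball c r" "z = w \<xi>" unfolding T_def by auto
        have s: "s * (s * \<xi> + u - u) = \<xi>" using su(1) by auto
        then have "s * \<xi> + u \<in> A" using tr[of "s * \<xi> + u"] \<xi>(1) by (simp only:)
        moreover have "w (s * \<xi> + u) = z"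
        proof -
          have "s * \<xi> + u \<notin> H" using subA \<open>s * \<xi> + u \<in> A\<close> by blast
          from w_transf[OF su(1,2) this] show ?thesis unfolding s \<xi>(2) by (rule sym)
        qed
        ultimately show "z \<in> w ` A" by blast
      qed
      then show "\<exists>q. homeomorphism A T w q" using q by blast
    qed
  qed
qed

section \<open>The cycles as loops below and above the covering\<close>

lemma w_half_lattice:
  assumes "x \<notin> H" shows "w x \<notin> {w (\<omega> 1), w (\<omega> 2), w (\<omega> 3)}"
  using assms w_image by blast

text \<open>In \<open>B\<close>, where \<open>w x\<close> is filled in, the loop about
  \<open>w x\<close> contracts within a disc, and with it the whole commutator. In \<open>W\<close>,
  where \<open>w x\<close> is still a puncture, the commutator has winding number 0 about it;
  homotopy in \<open>W\<close> carries this to \<open>w \<circ> \<Gamma>\<close>.\<close>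

lemma cycle_I_D:
  assumes cyc: "cycle_I \<omega>\<^sub>1 \<omega>\<^sub>3 i x \<Gamma>" and x: "x \<notin> H"
  shows "\<exists>b. homotopic_loops (- {w (\<omega> 1), w (\<omega> 2), w (\<omega> 3)}) (w \<circ> \<Gamma>) (linepath b b)"
    and "w x \<notin> path_image (w \<circ> \<Gamma>)" and "winding_number (w \<circ> \<Gamma>) (w x) = 0"
proof -
  define B where "B = - {w (\<omega> 1), w (\<omega> 2), w (\<omega> 3)}"
  define W where "W = - {w (\<omega> 1), w (\<omega> 2), w (\<omega> 3), w x}"
  obtain \<gamma>z \<gamma>p where z: "loop_once_around W (w x) \<gamma>z"
    and p: "if i = 0 then loop_once_around_infinity W \<gamma>p else loop_once_around W (w (\<omega> i)) \<gamma>p"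
    and start: "pathstart \<gamma>z = pathstart \<gamma>p"
    and hom: "homotopic_loops W (w \<circ> \<Gamma>) (pochhammer_contour \<gamma>z \<gamma>p)"
    using cyc unfolding cycle_I_def Let_def W_def by blast
  have WB: "W \<subseteq> B" "W \<subseteq> - {w x}" by (auto simp: W_def B_def)
  \<comment> \<open>A homotopy to any loop in \<open>W\<close> certifies that
    \<open>\<gamma>p\<close> is a closed path in \<open>W\<close>, which treats finite punctures and
    infinity alike.\<close>
  obtain q where q: "homotopic_loops W \<gamma>p q"
  proof (cases "i = 0")
    case True
    then have "\<forall>\<^sub>F R in at_top. homotopic_loops W \<gamma>p (reversepath (circlepath 0 R))"
      using p by (simp add: loop_once_around_infinity_def)
    then show ?thesis using that eventually_happens[of _ "at_top :: real filter"] by auto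
  next
    case False
    then have "\<forall>\<^sub>F r in at_right 0. homotopic_loops W \<gamma>p (circlepath (w (\<omega> i)) r)"
      using p by (simp add: loop_once_around_def)
    then show ?thesis using that eventually_happens[of _ "at_right (0 :: real)"] by auto
  qed
  note \<gamma>p = homotopic_loops_imp_path[OF q] homotopic_loops_imp_subset[OF q] homotopic_loops_imp_loop[OF q]
  have "open B" unfolding B_def by (intro open_Compl finite_imp_closed) simp
  moreover have "w x \<in> B" using w_half_lattice[OF x] by (simp add: B_def)
  ultimately obtain r0 where r0: "r0 > 0" "cball (w x) r0 \<subseteq> B" by (metis open_contains_cball)
  \<comment> \<open>The radius must be positive, realise the homotopy, and be small enough for the
    disc to avoid the other punctures.\<close>
  have "\<forall>\<^sub>F r in at_right 0. r < r0" using r0(1) by (rule eventually_at_right_real[THEN eventually_mono]) auto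
  moreover have "\<forall>\<^sub>F r in at_right 0. homotopic_loops W \<gamma>z (circlepath (w x) r)"
    using z by (simp add: loop_once_around_def)
  moreover have "\<forall>\<^sub>F r in at_right 0. (0 :: real) < r" by (rule eventually_at_right_less)
  ultimately have "\<forall>\<^sub>F r in at_right 0. 0 < r \<and> r < r0 \<and> homotopic_loops W \<gamma>z (circlepath (w x) r)"
    by eventually_elim simp
  then obtain r where r: "0 < r" "r < r0" "homotopic_loops W \<gamma>z (circlepath (w x) r)"
    using eventually_happens[of _ "at_right (0 :: real)"] by auto
  note \<gamma>z = homotopic_loops_imp_path[OF r(3)] homotopic_loops_imp_subset[OF r(3)] homotopic_loops_imp_loop[OF r(3)]
  have "simply_connected (cball (w x) r0)" by (intro convex_imp_simply_connected convex_cball)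
  then have "homotopic_loops (cball (w x) r0) (circlepath (w x) r) (linepath (w x) (w x))"
    using r r0 unfolding simply_connected_eq_contractible_loop_any
    by (elim allE[of _ "circlepath (w x) r"] allE[of _ "w x"]) (auto simp: sphere_def)
  then have "homotopic_loops B (circlepath (w x) r) (linepath (w x) (w x))"
    using r0(2) by (rule homotopic_loops_subset)
  then have null: "homotopic_loops B \<gamma>z (linepath (w x) (w x))"
    using homotopic_loops_subset[OF r(3) WB(1)] homotopic_loops_trans by blast
  obtain b where "homotopic_loops B (pochhammer_contour \<gamma>z \<gamma>p) (linepath b b)"
    using homotopic_loops_pochhammer_contour_null[OF null] \<gamma>p start WB(1) by fastforce
  then show "\<exists>b. homotopic_loops (- {w (\<omega> 1), w (\<omega> 2), w (\<omega> 3)}) (w \<circ> \<Gamma>) (linepath b b)"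
    using homotopic_loops_subset[OF hom WB(1)] homotopic_loops_trans unfolding B_def by blast
  have "w x \<notin> path_image \<gamma>z" "w x \<notin> path_image \<gamma>p" using \<gamma>z \<gamma>p WB(2) by auto
  then have "winding_number (pochhammer_contour \<gamma>z \<gamma>p) (w x) = 0"
    using \<gamma>z \<gamma>p start by (intro winding_number_pochhammer_contour) auto
  moreover have "homotopic_loops (- {w x}) (w \<circ> \<Gamma>) (pochhammer_contour \<gamma>z \<gamma>p)"
    using hom WB(2) by (rule homotopic_loops_subset)
  ultimately show "winding_number (w \<circ> \<Gamma>) (w x) = 0" by (simp add: winding_number_homotopic_loops)
  show "w x \<notin> path_image (w \<circ> \<Gamma>)" using homotopic_loops_imp_subset[OF hom] WB(2) by auto
qed

text \<open>The lifted homotopy remains one of closed loops: its two sides \<open>k (s, 0)\<close>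
  and \<open>k (s, 1)\<close> lift the same path and start at the same point, because
  \<open>\<Gamma>\<close> is closed. Its last edge lifts a constant path and is constant. Both
  follow from uniqueness of lifts.\<close>

lemma lift_null_homotopy:
  assumes \<Gamma>: "path \<Gamma>" "path_image \<Gamma> \<subseteq> - H" "pathfinish \<Gamma> = pathstart \<Gamma>"
    and null: "homotopic_loops (- {w (\<omega> 1), w (\<omega> 2), w (\<omega> 3)}) (w \<circ> \<Gamma>) (linepath b b)"
  shows "\<exists>a. homotopic_loops (- H) \<Gamma> (linepath a a)"
proof -
  obtain h where h: "continuous_on ({0..1::real} \<times> {0..1}) h"
      "h \<in> ({0..1} \<times> {0..1}) \<rightarrow> - {w (\<omega> 1), w (\<omega> 2), w (\<omega> 3)}"
      "\<And>t. t \<in> {0..1} \<Longrightarrow> h (0, t) = w (\<Gamma> t)" "\<And>t. t \<in> {0..1} \<Longrightarrow> h (1, t) = b"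
      "\<And>s. s \<in> {0..1} \<Longrightarrow> h (s, 1) = h (s, 0)"
  proof -
    obtain h where h: "continuous_on ({0..1::real} \<times> {0..1}) h"
      "h \<in> ({0..1} \<times> {0..1}) \<rightarrow> - {w (\<omega> 1), w (\<omega> 2), w (\<omega> 3)}"
      "\<forall>t\<in>{0..1}. h (0, t) = (w \<circ> \<Gamma>) t" "\<forall>t\<in>{0..1}. h (1, t) = linepath b b t"
      "\<forall>s\<in>{0..1}. pathfinish (h \<circ> Pair s) = pathstart (h \<circ> Pair s)"
      using null unfolding homotopic_loops by blast
    show ?thesis
      by (rule that[OF h(1,2)]) (use h(3-5) in \<open>simp_all add: pathfinish_def pathstart_def linepath_refl\<close>)
  qed
  have \<Gamma>': "continuous_on {0..1} \<Gamma>" "\<Gamma> \<in> {0..1} \<rightarrow> - H" "\<Gamma> 0 = \<Gamma> 1"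
    using \<Gamma> by (auto simp: path_def path_image_def pathfinish_def pathstart_def)
  obtain k where k: "continuous_on ({0..1} \<times> {0..1}) k" "k \<in> ({0..1} \<times> {0..1}) \<rightarrow> - H"
      "\<And>t. t \<in> {0..1} \<Longrightarrow> k (0, t) = \<Gamma> t" "\<And>z. z \<in> {0..1} \<times> {0..1} \<Longrightarrow> h z = w (k z)"
    using covering_space_lift_homotopy[OF covering_space_w h(1,2) h(3) \<Gamma>'(1,2)] by metis
  have kc: "continuous_on {0..1} (\<lambda>s. k (s, t))" "continuous_on {0..1} (\<lambda>s. k (t, s))" if "t \<in> {0..1}" for t
    by (rule continuous_on_compose2[OF k(1)]; use that in \<open>force intro!: continuous_intros\<close>)+
  have loop: "k (s, 1) = k (s, 0)" if "s \<in> {0..1}" for s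
  proof (rule covering_space_lift_unique[OF covering_space_w, where a = 0 and T = "{0..1}" and f = "\<lambda>s. h (s, 0)"
      and ?g1.0 = "\<lambda>s. k (s, 1)" and ?g2.0 = "\<lambda>s. k (s, 0)"])
    show "k (0, 1) = k (0, 0)" using k(3) \<Gamma>'(3) by simp
    show "continuous_on {0..1} (\<lambda>s. h (s, 0))"
      by (rule continuous_on_compose2[OF h(1)]) (auto intro!: continuous_intros)
    show "h (x, 0) = w (k (x, 1))" if "x \<in> {0..1}" for x using h(5)[OF that] k(4)[of "(x, 1)"] that by simp
    show "h (x, 0) = w (k (x, 0))" if "x \<in> {0..1}" for x using k(4)[of "(x, 0)"] that by simp
  qed (use kc[of 0] kc[of 1] k(2) h(2) that in \<open>auto simp: Pi_iff\<close>)
  have const: "k (1, t) = k (1, 0)" if "t \<in> {0..1}" for t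
  proof (rule covering_space_lift_unique[OF covering_space_w, where a = 0 and T = "{0..1}" and f = "\<lambda>t. b"
      and ?g1.0 = "\<lambda>t. k (1, t)" and ?g2.0 = "\<lambda>t. k (1, 0)"])
    show "b = w (k (1, x))" if "x \<in> {0..1}" for x using h(4)[OF that] k(4)[of "(1, x)"] that by simp
    show "b = w (k (1, 0))" using h(4)[of 0] k(4)[of "(1, 0)"] by simp
    show "(\<lambda>t. b) \<in> {0..1} \<rightarrow> - {w (\<omega> 1), w (\<omega> 2), w (\<omega> 3)}" using h(2) h(4)[of 0] by (force simp: Pi_iff)
  qed (use kc[of 1] k(2) that in \<open>auto simp: Pi_iff\<close>)
  have "homotopic_loops (- H) \<Gamma> (linepath (k (1, 0)) (k (1, 0)))"
    unfolding homotopic_loops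
  proof (intro exI[of _ k] conjI ballI k(1,2))
    show "k (0, t) = \<Gamma> t" if "t \<in> {0..1}" for t using k(3)[OF that] .
    show "k (1, t) = linepath (k (1, 0)) (k (1, 0)) t" if "t \<in> {0..1}" for t
      using const[OF that] by (simp add: linepath_refl)
    show "pathfinish (k \<circ> Pair s) = pathstart (k \<circ> Pair s)" if "s \<in> {0..1}" for s
      using loop[OF that] by (simp add: pathfinish_def pathstart_def)
  qed
  then show ?thesis by blast
qed

end

subsection \<open>Linear differential equations and monodromy\<close>

definition ode_solution :: "(complex \<Rightarrow> complex) \<Rightarrow> complex set \<Rightarrow> (complex \<Rightarrow> complex) \<Rightarrow> bool" where
  "ode_solution q S f \<longleftrightarrow> f holomorphic_on S \<and> (\<forall>x\<in>S. (deriv ^^ 2) f x = q x * f x)"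

lemma ode_solution_subset: "ode_solution q S f \<Longrightarrow> T \<subseteq> S \<Longrightarrow> ode_solution q T f"
  unfolding ode_solution_def by (meson holomorphic_on_subset subsetD)

text \<open>A primitive chosen once for each centre, radius and integrand. As a genuine function of
  these data it can be iterated in the Picard series and used to write down local
  logarithms.\<close>

definition ball_primitive :: "complex \<Rightarrow> real \<Rightarrow> (complex \<Rightarrow> complex) \<Rightarrow> complex \<Rightarrow> complex" where
  "ball_primitive c r g = (SOME G. (\<forall>x\<in>ball c r. (G has_field_derivative g x) (at x)) \<and> G c = 0)"

lemma ball_primitive:
  assumes g: "g holomorphic_on ball c r"
  shows "x \<in> ball c r \<Longrightarrow> (ball_primitive c r g has_field_derivative g x) (at x)"
    and "ball_primitive c r g c = 0"
proof -
  have "\<exists>G. (\<forall>x\<in>ball c r. (G has_field_derivative g x) (at x)) \<and> G c = 0"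
  proof -
    obtain G where "\<And>x. x \<in> ball c r \<Longrightarrow> (G has_field_derivative g x) (at x within ball c r)"
    proof (rule holomorphic_convex_primitive[of "ball c r" "{}" g])
      show "continuous_on (ball c r) g" by (rule holomorphic_on_imp_continuous_on[OF g])
      show "g field_differentiable at x" if "x \<in> interior (ball c r) - {}" for x
        using that by (intro holomorphic_on_imp_differentiable_at[OF g]) auto
    qed auto
    then have "(G has_field_derivative g x) (at x)" if "x \<in> ball c r" for x
      using that at_within_open[OF that open_ball] by metis
    then show ?thesis
      by (intro exI[of _ "\<lambda>x. G x - G c"]) (auto intro!: derivative_eq_intros)
  qed
  from someI_ex[OF this] show "x \<in> ball c r \<Longrightarrow> (ball_primitive c r g has_field_derivative g x) (at x)"
    and "ball_primitive c r g c = 0"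
    unfolding ball_primitive_def by blast+
qed

lemma ball_primitive_holomorphic:
  assumes "g holomorphic_on ball c r"
  shows "ball_primitive c r g holomorphic_on ball c r"
  using ball_primitive(1)[OF assms] by (metis holomorphic_on_open open_ball)

lemma norm_ball_primitive_le:
  assumes g: "g holomorphic_on ball c r" and M: "\<And>x. x \<in> ball c r \<Longrightarrow> norm (g x) \<le> M" and x: "x \<in> ball c r"
  shows "norm (ball_primitive c r g x) \<le> M * r"
proof -
  have r: "r > 0" using x by (metis dist_self less_le_trans mem_ball norm_ge_zero not_le zero_le_dist)
  have M0: "M \<ge> 0" using M[OF x] norm_ge_zero order_trans by blast
  have "norm (ball_primitive c r g x - ball_primitive c r g c) \<le> M * norm (x - c)"
    by (rule field_differentiable_bound[OF convex_ball has_field_derivative_at_within[OF ball_primitive(1)[OF g]] M])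
      (use x r in auto)
  also have "\<dots> \<le> M * r" using x M0 by (intro mult_left_mono) (auto simp: dist_norm norm_minus_commute)
  finally show ?thesis by (simp add: ball_primitive(2)[OF g])
qed

text \<open>These are the terms of the Picard series, not its partial sums: the second derivative of
  each term is \<open>q\<close> times the previous one.\<close>

fun picard_term :: "(complex \<Rightarrow> complex) \<Rightarrow> complex \<Rightarrow> real \<Rightarrow> complex \<Rightarrow> complex \<Rightarrow> nat \<Rightarrow> complex \<Rightarrow> complex" where
  "picard_term q c r a b 0 = (\<lambda>x. a + b * (x - c))"
| "picard_term q c r a b (Suc n) = ball_primitive c r (ball_primitive c r (\<lambda>x. q x * picard_term q c r a b n x))"

text \<open>Each of the two integrations costs a factor \<open>r\<close>, so the terms decay like
  \<open>(K * r\<^sup>2) ^ n\<close> and the series is dominated by a geometric one. Termwise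
  differentiation shifts the index and yields the equation; all terms after the first vanish to
  second order at \<open>c\<close>.\<close>

lemma ode_solution_exists:
  assumes q: "q holomorphic_on ball c r" and r: "r > 0"
    and K: "\<And>x. x \<in> ball c r \<Longrightarrow> norm (q x) \<le> K" "K * r\<^sup>2 < 1"
  shows "\<exists>f. ode_solution q (ball c r) f \<and> f c = a \<and> deriv f c = b"
proof -
  define u where "u = picard_term q c r a b"
  define M where "M = norm a + norm b * r"
  have K0: "K \<ge> 0" using K(1)[of c] r norm_ge_zero order_trans by (metis centre_in_ball)
  have hol: "u n holomorphic_on ball c r" for n
  proof (induction n)
    case 0
    show ?case unfolding u_def by (auto intro!: holomorphic_intros)
  next
    case (Suc n)
    then show ?case
      unfolding u_def by (auto intro!: ball_primitive_holomorphic holomorphic_on_mult q)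
  qed
  define v where "v n = ball_primitive c r (\<lambda>x. q x * u n x)" for n
  have qu: "(\<lambda>x. q x * u n x) holomorphic_on ball c r" for n by (intro holomorphic_intros q hol)
  have vhol: "v n holomorphic_on ball c r" for n unfolding v_def by (rule ball_primitive_holomorphic[OF qu])
  have u_Suc: "u (Suc n) = ball_primitive c r (v n)" for n by (simp add: u_def v_def)
  have bound: "norm (u n x) \<le> M * (K * r\<^sup>2) ^ n" if "x \<in> ball c r" for n x
    using that
  proof (induction n arbitrary: x)
    case 0
    have "norm (a + b * (x - c)) \<le> norm a + norm b * norm (x - c)"
      by (metis norm_mult norm_triangle_ineq)
    also have "\<dots> \<le> M" using 0 unfolding M_def by (auto intro!: mult_left_mono simp: dist_norm norm_minus_commute)
    finally show ?case by (simp add: u_def)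
  next
    case (Suc n)
    have "norm (q x * u n x) \<le> K * (M * (K * r\<^sup>2) ^ n)" if "x \<in> ball c r" for x
      unfolding norm_mult using that K Suc.IH K0 by (intro mult_mono) auto
    then have "norm (v n x) \<le> K * (M * (K * r\<^sup>2) ^ n) * r" if "x \<in> ball c r" for x
      unfolding v_def by (rule norm_ball_primitive_le[OF qu _ that])
    then have "norm (u (Suc n) x) \<le> K * (M * (K * r\<^sup>2) ^ n) * r * r"
      unfolding u_Suc by (rule norm_ball_primitive_le[OF vhol _ Suc.prems])
    then show ?case by (simp add: power2_eq_square mult_ac)
  qed
  have Kr: "0 \<le> K * r\<^sup>2" using K0 by simp
  have summ: "(\<lambda>n. M * (K * r\<^sup>2) ^ n) summable_on UNIV"
    by (rule summable_nonneg_imp_summable_on)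
      (use K(2) Kr r in \<open>auto simp: M_def intro!: summable_mult summable_geometric mult_nonneg_nonneg add_nonneg_nonneg\<close>)
  define f where "f x = (\<Sum>\<^sub>\<infinity>n\<in>UNIV. u n x)" for x
  have f: "f holomorphic_on ball c r"
    unfolding f_def[abs_def] by (rule holomorphic_infsum(1)[OF open_ball hol bound summ])
  have sums: "(\<lambda>n. (deriv ^^ k) (u n) x) sums (deriv ^^ k) f x" if "x \<in> ball c r" for k x
    unfolding f_def[abs_def] by (rule has_sum_imp_sums[OF holomorphic_infsum(2)[OF open_ball hol bound summ that]])
  have du: "deriv (u (Suc n)) x = v n x" if "x \<in> ball c r" for n x
    unfolding u_Suc by (rule DERIV_imp_deriv[OF ball_primitive(1)[OF vhol that]])
  have ddu: "(deriv ^^ 2) (u (Suc n)) x = q x * u n x" if "x \<in> ball c r" for n x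
  proof -
    have "(v n has_field_derivative q x * u n x) (at x)"
      unfolding v_def by (rule ball_primitive(1)[OF qu that])
    then have "(deriv (u (Suc n)) has_field_derivative q x * u n x) (at x)"
      by (rule has_field_derivative_transform_within_open[OF _ open_ball that]) (simp add: du)
    then show ?thesis by (simp add: numeral_2_eq_2 DERIV_imp_deriv)
  qed
  have du0: "deriv (u 0) x = b" for x
    by (rule DERIV_imp_deriv) (auto simp: u_def intro!: derivative_eq_intros)
  then have "deriv (u 0) = (\<lambda>_. b)" by (simp add: fun_eq_iff)
  then have ddu0: "(deriv ^^ 2) (u 0) x = 0" for x by (simp add: numeral_2_eq_2)
  have "(deriv ^^ 2) f x = q x * f x" if x: "x \<in> ball c r" for x
  proof -
    have "(\<lambda>n. u n x) sums f x" using sums[OF x, of 0] by simp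
    then have "(\<lambda>n. (deriv ^^ 2) (u (Suc n)) x) sums (q x * f x)" unfolding ddu[OF x] by (rule sums_mult)
    then have "(\<lambda>n. (deriv ^^ 2) (u n) x) sums (q x * f x + (deriv ^^ 2) (u 0) x)" by (rule sums_Suc)
    with sums[OF x, of 2] show ?thesis by (simp add: ddu0 sums_unique2)
  qed
  moreover have "f c = a"
  proof -
    have "u n c = (if n = 0 then a else 0)" for n
      by (cases n) (auto simp: u_Suc ball_primitive(2)[OF vhol], simp add: u_def)
    then have "(\<lambda>n. u n c) sums a" using sums_single[of 0 "\<lambda>_. a"] by simp
    with sums[of c 0] r show ?thesis by (simp add: sums_unique2)
  qed
  moreover have "deriv f c = b"
  proof -
    have "deriv (u n) c = (if n = 0 then b else 0)" for n
      using r by (cases n) (auto simp: du du0 v_def ball_primitive(2)[OF qu])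
    then have "(\<lambda>n. deriv (u n) c) sums b" using sums_single[of 0 "\<lambda>_. b"] by simp
    with sums[of c 1] r show ?thesis by (simp add: sums_unique2)
  qed
  ultimately show ?thesis using f unfolding ode_solution_def by blast
qed

lemma ode_solution_diff:
  assumes "open S" "ode_solution q S f" "ode_solution q S g"
  shows "ode_solution q S (\<lambda>x. f x - g x)"
  using assms higher_deriv_diff[of f S g _ 2]
  by (auto simp: ode_solution_def right_diff_distrib intro!: holomorphic_intros)

text \<open>Let \<open>D\<close> be the maximum of \<open>norm (d x)\<close> on the half ball.
  Integrating the equation twice from zero initial values gives
  \<open>D \<le> (K * s\<^sup>2) * D\<close>, hence \<open>D = 0\<close>. Halving the radius makes
  the domain compact, so that the maximum is attained.\<close>

lemma ode_solution_zero:
  assumes d: "ode_solution q (ball z s) d" and s: "s > 0"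
    and K: "\<And>x. x \<in> ball z s \<Longrightarrow> norm (q x) \<le> K" "K * s\<^sup>2 < 1"
    and init: "d z = 0" "deriv d z = 0"
    and x: "x \<in> cball z (s / 2)"
  shows "d x = 0"
proof -
  define B where "B = cball z (s / 2)"
  have B: "B \<subseteq> ball z s" "compact B" "convex B" "z \<in> B" using s by (auto simp: B_def)
  have K0: "K \<ge> 0" using K(1)[of z] s norm_ge_zero order_trans by (metis centre_in_ball)
  have hol: "d holomorphic_on ball z s" using d by (simp add: ode_solution_def)
  have "continuous_on B (\<lambda>x. norm (d x))"
    by (intro continuous_on_norm holomorphic_on_imp_continuous_on holomorphic_on_subset[OF hol B(1)])
  then obtain y where y: "y \<in> B" "\<And>x. x \<in> B \<Longrightarrow> norm (d x) \<le> norm (d y)"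
    using continuous_attains_sup[OF B(2)] B(4) by (metis empty_iff)
  define D where "D = norm (d y)"
  have nrm: "norm (x - z) \<le> s" if "x \<in> B" for x using that s by (simp add: B_def dist_norm norm_minus_commute)
  have d1: "(d has_field_derivative deriv d x) (at x)" "(deriv d has_field_derivative q x * d x) (at x)" if "x \<in> B" for x
  proof -
    have xs: "x \<in> ball z s" using that B(1) by blast
    show "(d has_field_derivative deriv d x) (at x)" by (rule holomorphic_derivI[OF hol open_ball xs])
    have "(deriv d has_field_derivative deriv (deriv d) x) (at x)"
      by (rule holomorphic_derivI[OF holomorphic_deriv[OF hol open_ball] open_ball xs])
    moreover have "deriv (deriv d) x = q x * d x" using d xs by (simp add: ode_solution_def numeral_2_eq_2)
    ultimately show "(deriv d has_field_derivative q x * d x) (at x)" by simp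
  qed
  have dd: "norm (deriv d x) \<le> K * D * s" if "x \<in> B" for x
  proof -
    have "norm (deriv d x - deriv d z) \<le> (K * D) * norm (x - z)"
    proof (rule field_differentiable_bound[OF B(3)])
      show "(deriv d has_field_derivative q x * d x) (at x within B)" if "x \<in> B" for x
        using d1(2)[OF that] by (rule has_field_derivative_at_within)
      show "norm (q x * d x) \<le> K * D" if "x \<in> B" for x
        unfolding norm_mult D_def using that y K B(1) K0 by (intro mult_mono) auto
    qed (use that B in auto)
    also have "\<dots> \<le> (K * D) * s" using nrm[OF that] K0 by (intro mult_left_mono) (auto simp: D_def)
    finally show ?thesis using init by simp
  qed
  have "norm (d y - d z) \<le> (K * D * s) * norm (y - z)"
  proof (rule field_differentiable_bound[OF B(3)])
    show "(d has_field_derivative deriv d x) (at x within B)" if "x \<in> B" for x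
      using d1(1)[OF that] by (rule has_field_derivative_at_within)
  qed (use dd y B in auto)
  also have "\<dots> \<le> (K * D * s) * s" using nrm[OF y(1)] K0 s by (intro mult_left_mono) (auto simp: D_def)
  finally have "D \<le> (K * s\<^sup>2) * D" using init by (simp add: D_def power2_eq_square mult_ac)
  then have "D = 0" using K(2) mult_right_mono[of "K * s\<^sup>2" 1 D] unfolding D_def
    by (smt (verit) mult_less_cancel_right2 norm_ge_zero)
  then show ?thesis using y(2)[of x] x by (simp add: D_def B_def)
qed

text \<open>A radius of existence common to all centres in \<open>A\<close>. The bound
  \<open>K\<close> is shared as well, and \<open>K * \<rho>\<^sup>2 < 1\<close> is the smallness
  condition of the existence and uniqueness lemmas.\<close>

definition ode_radius :: "(complex \<Rightarrow> complex) \<Rightarrow> complex set \<Rightarrow> real \<Rightarrow> bool" where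
  "ode_radius q A \<rho> \<longleftrightarrow> \<rho> > 0 \<and> (\<exists>K. K * \<rho>\<^sup>2 < 1 \<and>
     (\<forall>z\<in>A. q holomorphic_on ball z \<rho> \<and> (\<forall>x\<in>ball z \<rho>. norm (q x) \<le> K)))"

lemma ode_radius_exists:
  assumes A: "compact A" "A \<subseteq> S" "open S" and q: "q holomorphic_on S" and e: "e > 0"
  obtains \<rho> where "ode_radius q A \<rho>" "\<rho> < e" "\<And>z. z \<in> A \<Longrightarrow> ball z \<rho> \<subseteq> S"
proof -
  obtain r where r: "r > 0" "(\<Union>z\<in>A. cball z r) \<subseteq> S"
    using compact_subset_open_imp_cball_epsilon_subset[OF A(1,3,2)] by blast
  have "compact (\<Union>z\<in>A. cball z r)"
    using compact_sums[OF A(1) compact_cball[of 0 r]]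
    by (rule back_subst[of compact]) (force simp: dist_norm norm_minus_commute intro: exI[of _ "_ - _"])
  then have "compact (q ` (\<Union>z\<in>A. cball z r))"
    by (intro compact_continuous_image holomorphic_on_imp_continuous_on holomorphic_on_subset[OF q r(2)])
  then obtain K where K: "K > 0" "\<And>x. x \<in> (\<Union>z\<in>A. cball z r) \<Longrightarrow> norm (q x) \<le> K"
    using compact_imp_bounded bounded_pos by (metis imageI)
  \<comment> \<open>With \<open>\<rho> \<le> 1 / (K + 1)\<close> one has
    \<open>\<rho> \<le> 1\<close> and so \<open>K * \<rho>\<^sup>2 \<le> K * \<rho> < 1\<close>;
    halving \<open>e\<close> makes the inequality strict.\<close>
  define \<rho> where "\<rho> = min r (min (e / 2) (1 / (K + 1)))"
  have \<rho>: "0 < \<rho>" "\<rho> \<le> r" "\<rho> < e" "\<rho> \<le> 1 / (K + 1)" using r(1) e K(1) by (auto simp: \<rho>_def)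
  have "K * \<rho>\<^sup>2 < 1"
  proof -
    have "1 / (K + 1) \<le> 1" using K(1) by simp
    then have "\<rho> \<le> 1" using \<rho>(4) by linarith
    then have "\<rho>\<^sup>2 \<le> \<rho>" using \<rho>(1) by (simp add: power2_eq_square)
    then have "K * \<rho>\<^sup>2 \<le> K * (1 / (K + 1))" using \<rho>(4) K(1) by (intro mult_left_mono) auto
    also have "\<dots> < 1" using K(1) by simp
    finally show ?thesis .
  qed
  moreover have sub: "ball z \<rho> \<subseteq> S" if "z \<in> A" for z using that r(2) \<rho>(2) by (force simp: mem_ball)
  moreover have "norm (q x) \<le> K" if "z \<in> A" "x \<in> ball z \<rho>" for x z using that \<rho>(2) by (intro K(2)) force
  ultimately have "ode_radius q A \<rho>"
    unfolding ode_radius_def using \<rho>(1) holomorphic_on_subset[OF q] by blast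
  then show ?thesis using that \<rho>(3) sub by blast
qed

text \<open>Solve on the large ball with the initial values of the germ; uniqueness on a ball where
  both functions are defined shows that the solution extends the germ.\<close>

lemma ode_extend_germ:
  assumes rad: "ode_radius q A \<rho>" and z: "z \<in> A" and e: "e > 0" and f: "ode_solution q (ball z e) f"
  shows "\<exists>g. ode_solution q (ball z \<rho>) g \<and> (\<exists>d>0. \<forall>x\<in>ball z d. g x = f x)"
proof -
  obtain K where K: "\<rho> > 0" "K * \<rho>\<^sup>2 < 1" "q holomorphic_on ball z \<rho>" "\<And>x. x \<in> ball z \<rho> \<Longrightarrow> norm (q x) \<le> K"
    using rad z unfolding ode_radius_def by blast
  obtain g where g: "ode_solution q (ball z \<rho>) g" "g z = f z" "deriv g z = deriv f z"
    using ode_solution_exists[OF K(3,1,4,2)] by metis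
  define s where "s = min e \<rho>"
  have s: "s > 0" "ball z s \<subseteq> ball z \<rho>" "ball z s \<subseteq> ball z e" using e K(1) by (auto simp: s_def)
  have K0: "K \<ge> 0" using K(4)[of z] K(1) norm_ge_zero order_trans by (metis centre_in_ball)
  have "K * s\<^sup>2 \<le> K * \<rho>\<^sup>2" using s(1) K0 by (intro mult_left_mono power_mono) (auto simp: s_def)
  then have Ks: "K * s\<^sup>2 < 1" using K(2) by linarith
  have d: "ode_solution q (ball z s) (\<lambda>x. g x - f x)"
    by (rule ode_solution_diff[OF open_ball ode_solution_subset[OF g(1) s(2)] ode_solution_subset[OF f s(3)]])
  have dg: "deriv (\<lambda>x. g x - f x) z = 0"
  proof -
    have "g field_differentiable at z" "f field_differentiable at z"
      using g(1) f e K(1) by (auto simp: ode_solution_def intro: holomorphic_on_imp_differentiable_at[OF _ open_ball])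
    then show ?thesis using g(3) by simp
  qed
  have "g x = f x" if "x \<in> ball z (s / 2)" for x
  proof -
    have "g x - f x = 0"
      by (rule ode_solution_zero[OF d s(1) _ Ks _ dg]) (use that s(2) g(2) K(4) in auto)
    then show ?thesis by simp
  qed
  then show ?thesis using g(1) s(1) by (intro exI[of _ g] conjI exI[of _ "s / 2"]) auto
qed

section \<open>Analytic continuation of solutions along families of germs\<close>

definition germ_branch ::
  "(complex \<Rightarrow> complex) \<Rightarrow> 'a::topological_space set \<Rightarrow> ('a \<Rightarrow> complex) \<Rightarrow> ('a \<Rightarrow> complex \<Rightarrow> complex) \<Rightarrow> bool" where
  "germ_branch q P g F \<longleftrightarrow> (\<forall>p\<in>P. \<exists>r>0. ode_solution q (ball (g p) r) (F p) \<and>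
     (\<forall>\<^sub>F p' in at p within P. \<forall>\<xi>\<in>ball (g p) r. F p' \<xi> = F p \<xi>))"

text \<open>Agreement on overlaps of balls of one fixed radius, whereas in
  \<open>germ_branch\<close> the radius depends on the parameter. The uniform radius is what allows
  the centres to be moved.\<close>

definition coherent_on ::
  "'a::topological_space set \<Rightarrow> ('a \<Rightarrow> complex) \<Rightarrow> real \<Rightarrow> ('a \<Rightarrow> complex \<Rightarrow> complex) \<Rightarrow> bool" where
  "coherent_on P g \<rho> G \<longleftrightarrow> (\<forall>p\<in>P. \<forall>\<^sub>F p' in at p within P. \<forall>\<xi>\<in>ball (g p) \<rho> \<inter> ball (g p') \<rho>. G p' \<xi> = G p \<xi>)"

text \<open>The identity theorem; the intersection of two balls is convex, hence connected.\<close>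

lemma holomorphic_eq_on_balls:
  assumes "f holomorphic_on ball a r \<inter> ball b s" "g holomorphic_on ball a r \<inter> ball b s"
    and "c \<in> ball a r \<inter> ball b s" "e > 0" "\<And>x. x \<in> ball c e \<Longrightarrow> f x = g x" "x \<in> ball a r \<inter> ball b s"
  shows "f x = g x"
proof (rule analytic_continuation_open[of "ball c e \<inter> (ball a r \<inter> ball b s)" "ball a r \<inter> ball b s" f g])
  show "connected (ball a r \<inter> ball b s)" by (intro convex_connected convex_Int convex_ball)
  show "ball c e \<inter> (ball a r \<inter> ball b s) \<noteq> {}" using assms(3,4) centre_in_ball by blast
qed (use assms in auto)

lemma holomorphic_eq_on_ball:
  assumes "f holomorphic_on ball a r" "g holomorphic_on ball a r"
    and "c \<in> ball a r" "e > 0" "\<And>x. x \<in> ball c e \<Longrightarrow> f x = g x" "x \<in> ball a r"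
  shows "f x = g x"
  using holomorphic_eq_on_balls[of f a r a r g c e x] assms by simp

lemma eventually_dist_less:
  assumes "continuous_on P g" "p \<in> P" "e > 0"
  shows "\<forall>\<^sub>F p' in at p within P. dist (g p') (g p) < e"
  using assms by (auto simp: continuous_on_def intro: tendstoD)

text \<open>For \<open>p'\<close> near \<open>p\<close> the point \<open>g p'\<close> lies where
  \<open>F p'\<close> and \<open>F p\<close> agree, so the two extensions agree around
  \<open>g p'\<close>, and by the identity theorem on the whole overlap.\<close>

lemma extend_germ_branch:
  assumes F: "germ_branch q P g F" and g: "continuous_on P g"
    and rad: "ode_radius q (g ` P) \<rho>"
  obtains G where "\<And>p. p \<in> P \<Longrightarrow> ode_solution q (ball (g p) \<rho>) (G p)"
    "\<And>p. p \<in> P \<Longrightarrow> \<exists>d>0. \<forall>\<xi>\<in>ball (g p) d. G p \<xi> = F p \<xi>" "coherent_on P g \<rho> G"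
proof -
  have "\<exists>G. ode_solution q (ball (g p) \<rho>) G \<and> (\<exists>d>0. \<forall>\<xi>\<in>ball (g p) d. G \<xi> = F p \<xi>)" if "p \<in> P" for p
  proof -
    from F[unfolded germ_branch_def, rule_format, OF that]
    obtain r where "r > 0" "ode_solution q (ball (g p) r) (F p)" by blast
    from ode_extend_germ[OF rad imageI[OF that] this] show ?thesis .
  qed
  then obtain G where G: "\<And>p. p \<in> P \<Longrightarrow> ode_solution q (ball (g p) \<rho>) (G p)"
    "\<And>p. p \<in> P \<Longrightarrow> \<exists>d>0. \<forall>\<xi>\<in>ball (g p) d. G p \<xi> = F p \<xi>" by metis
  have \<rho>: "\<rho> > 0" using rad by (simp add: ode_radius_def)
  have "coherent_on P g \<rho> G"
    unfolding coherent_on_def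
  proof
    fix p assume p: "p \<in> P"
    obtain r where r: "r > 0" "\<forall>\<^sub>F p' in at p within P. \<forall>\<xi>\<in>ball (g p) r. F p' \<xi> = F p \<xi>"
      using F[unfolded germ_branch_def, rule_format, OF p] by blast
    obtain d where d: "d > 0" "\<And>\<xi>. \<xi> \<in> ball (g p) d \<Longrightarrow> G p \<xi> = F p \<xi>" using G(2)[OF p] by blast
    define e where "e = min r (min d \<rho>)"
    have e: "e > 0" using r d \<rho> by (simp add: e_def)
    have "\<forall>\<^sub>F p' in at p within P. p' \<in> P" by (simp add: eventually_at_filter)
    then show "\<forall>\<^sub>F p' in at p within P. \<forall>\<xi>\<in>ball (g p) \<rho> \<inter> ball (g p') \<rho>. G p' \<xi> = G p \<xi>"
      using r(2) eventually_dist_less[OF g p e]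
    proof eventually_elim
      case (elim p')
      obtain d' where d': "d' > 0" "\<And>\<xi>. \<xi> \<in> ball (g p') d' \<Longrightarrow> G p' \<xi> = F p' \<xi>" using G(2)[OF elim(1)] by blast
      show ?case
      proof
        fix \<xi> assume \<xi>: "\<xi> \<in> ball (g p) \<rho> \<inter> ball (g p') \<rho>"
        show "G p' \<xi> = G p \<xi>"
        proof (rule holomorphic_eq_on_balls[OF _ _ _ _ _ \<xi>])
          show "G p' holomorphic_on ball (g p) \<rho> \<inter> ball (g p') \<rho>" "G p holomorphic_on ball (g p) \<rho> \<inter> ball (g p') \<rho>"
            using G(1)[OF p] G(1)[OF elim(1)] by (auto simp: ode_solution_def intro: holomorphic_on_subset)
          show "g p' \<in> ball (g p) \<rho> \<inter> ball (g p') \<rho>" using elim(3) \<rho> by (auto simp: e_def dist_commute)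
          define d'' where "d'' = min d' (e - dist (g p') (g p))"
          show "d'' > 0" using d' elim(3) by (simp add: d''_def)
          fix x assume x: "x \<in> ball (g p') d''"
          have "dist (g p) x \<le> dist (g p) (g p') + dist (g p') x" by (rule dist_triangle)
          also have "\<dots> < e" using x by (auto simp: d''_def dist_commute)
          finally have "x \<in> ball (g p) r" "x \<in> ball (g p) d" by (auto simp: e_def)
          moreover have "x \<in> ball (g p') d'" using x by (simp add: d''_def)
          ultimately show "G p' x = G p x" using d'(2) d(2) elim(2) by simp
        qed
      qed
    qed
  qed
  then show ?thesis using that G by blast
qed

lemma germ_branch_nearby:
  assumes sol: "\<And>p. p \<in> P \<Longrightarrow> ode_solution q (ball (g p) \<rho>) (G p)" and coh: "coherent_on P g \<rho> G"
    and g: "continuous_on P g" and near: "\<And>p. p \<in> P \<Longrightarrow> g' p \<in> ball (g p) \<rho>"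
  shows "germ_branch q P g' G"
  unfolding germ_branch_def
proof
  fix p assume p: "p \<in> P"
  \<comment> \<open>Half of the remaining margin: one half is the radius of the new ball, the other
    absorbs the motion of the centre from \<open>g p\<close> to \<open>g p'\<close>.\<close>
  define r where "r = (\<rho> - dist (g p) (g' p)) / 2"
  have r: "r > 0" using near[OF p] by (simp add: r_def)
  have sub: "ball (g' p) r \<subseteq> ball (g p) \<rho>"
  proof
    fix x assume "x \<in> ball (g' p) r"
    then show "x \<in> ball (g p) \<rho>" using dist_triangle[of "g p" x "g' p"] r by (simp add: r_def)
  qed
  show "\<exists>r>0. ode_solution q (ball (g' p) r) (G p) \<and> (\<forall>\<^sub>F p' in at p within P. \<forall>\<xi>\<in>ball (g' p) r. G p' \<xi> = G p \<xi>)"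
  proof (intro exI[of _ r] conjI r ode_solution_subset[OF sol[OF p] sub])
    have "\<forall>\<^sub>F p' in at p within P. \<forall>\<xi>\<in>ball (g p) \<rho> \<inter> ball (g p') \<rho>. G p' \<xi> = G p \<xi>"
      using coh p by (simp add: coherent_on_def)
    then show "\<forall>\<^sub>F p' in at p within P. \<forall>\<xi>\<in>ball (g' p) r. G p' \<xi> = G p \<xi>"
      using eventually_dist_less[OF g p r]
    proof eventually_elim
      case (elim p')
      show ?case
      proof
        fix \<xi> assume \<xi>: "\<xi> \<in> ball (g' p) r"
        have "dist (g p') \<xi> \<le> dist (g p') (g p) + (dist (g p) (g' p) + dist (g' p) \<xi>)"
          using dist_triangle[of "g p'" \<xi> "g p"] dist_triangle[of "g p" \<xi> "g' p"] by linarith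
        also have "\<dots> < r + (dist (g p) (g' p) + r)" using elim(2) \<xi> by simp
        also have "\<dots> = \<rho>" by (simp add: r_def)
        finally show "G p' \<xi> = G p \<xi>" using elim(1) sub \<xi> by auto
      qed
    qed
  qed
qed

text \<open>
  A homotopy is traversed in steps shorter than a common radius of existence \<open>\<rho>\<close>: then the germs along
  \<open>g\<close>, extended to radius \<open>\<rho>\<close>, are also germs along the next curve \<open>g'\<close>.
\<close>

lemma monodromy_step:
  assumes F: "germ_branch q {0..1} g F" and g: "continuous_on {0..1} g" "g 1 = g 0"
    and rad: "ode_radius q (g ` {0..1}) \<rho>"
    and near: "\<And>t. t \<in> {0..1 :: real} \<Longrightarrow> g' t \<in> ball (g t) \<rho>"
    and closed: "\<And>G. germ_branch q {0..1} g' G \<Longrightarrow> \<exists>d>0. \<forall>\<xi>\<in>ball (g' 0) d. G 1 \<xi> = G 0 \<xi>"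
  shows "\<exists>d>0. \<forall>\<xi>\<in>ball (g 0) d. F 1 \<xi> = F 0 \<xi>"
proof -
  obtain G where G: "\<And>t. t \<in> {0..1} \<Longrightarrow> ode_solution q (ball (g t) \<rho>) (G t)"
    "\<And>t. t \<in> {0..1} \<Longrightarrow> \<exists>d>0. \<forall>\<xi>\<in>ball (g t) d. G t \<xi> = F t \<xi>" "coherent_on {0..1} g \<rho> G"
    using extend_germ_branch[OF F g(1) rad] by metis
  have "germ_branch q {0..1} g' G" by (rule germ_branch_nearby[OF G(1) G(3) g(1) near])
  from closed[OF this] obtain d where d: "d > 0" "\<And>\<xi>. \<xi> \<in> ball (g' 0) d \<Longrightarrow> G 1 \<xi> = G 0 \<xi>" by blast
  have eq: "G 1 \<xi> = G 0 \<xi>" if "\<xi> \<in> ball (g 0) \<rho>" for \<xi>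
    by (rule holomorphic_eq_on_ball[OF _ _ _ d that])
      (use G(1)[of 0] G(1)[of 1] near[of 0] g(2) in \<open>auto simp: ode_solution_def\<close>)
  obtain d0 where d0: "d0 > 0" "\<And>\<xi>. \<xi> \<in> ball (g 0) d0 \<Longrightarrow> G 0 \<xi> = F 0 \<xi>" using G(2)[of 0] by auto
  obtain d1 where d1: "d1 > 0" "\<And>\<xi>. \<xi> \<in> ball (g 0) d1 \<Longrightarrow> G 1 \<xi> = F 1 \<xi>" using G(2)[of 1] g(2) by auto
  have "\<rho> > 0" using rad by (simp add: ode_radius_def)
  then show ?thesis
    by (intro exI[of _ "min \<rho> (min d0 d1)"]) (use d0(1) d1(1) d0(2)[symmetric] d1(2)[symmetric] eq in auto)
qed

text \<open>With a fixed centre, agreement with \<open>F 0\<close> near \<open>b\<close> is a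
  locally constant property of the parameter, and the interval is connected.\<close>

lemma germ_branch_const:
  assumes F: "germ_branch q {0..1} (\<lambda>_. b) F"
  shows "\<exists>d>0. \<forall>\<xi>\<in>ball b d. F (1::real) \<xi> = F 0 \<xi>"
proof -
  define f where "f t = (\<exists>d>0. \<forall>\<xi>\<in>ball b d. F t \<xi> = F 0 \<xi>)" for t
  have "f 0 = f 1"
  proof (rule connected_local_const[of "{0..1}"])
    show "\<forall>t\<in>{0..1}. \<forall>\<^sub>F t' in at t within {0..1}. f t = f t'"
    proof
      fix t :: real assume "t \<in> {0..1}"
      from F[unfolded germ_branch_def, rule_format, OF this]
      obtain r where r: "r > 0" "\<forall>\<^sub>F t' in at t within {0..1}. \<forall>\<xi>\<in>ball b r. F t' \<xi> = F t \<xi>"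
        by blast
      show "\<forall>\<^sub>F t' in at t within {0..1}. f t = f t'"
        using r(2)
      proof eventually_elim
        case (elim t')
        have f_iff: "f s \<longleftrightarrow> (\<exists>d>0. d < r \<and> (\<forall>\<xi>\<in>ball b d. F s \<xi> = F 0 \<xi>))" for s
          unfolding f_def
        proof
          assume "\<exists>d>0. \<forall>\<xi>\<in>ball b d. F s \<xi> = F 0 \<xi>"
          then obtain d where "d > 0" "\<forall>\<xi>\<in>ball b d. F s \<xi> = F 0 \<xi>" by blast
          then show "\<exists>d>0. d < r \<and> (\<forall>\<xi>\<in>ball b d. F s \<xi> = F 0 \<xi>)" 
            using r(1) by (intro exI[of _ "min d (r / 2)"]) auto
        qed blast
        have "(\<forall>\<xi>\<in>ball b d. F t \<xi> = F 0 \<xi>) \<longleftrightarrow> (\<forall>\<xi>\<in>ball b d. F t' \<xi> = F 0 \<xi>)" if "d < r" for d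
          using elim that by (auto simp: mem_ball)
        then show ?case unfolding f_iff by (intro ex_cong1) auto
      qed
    qed
  qed auto
  moreover have "f 0" unfolding f_def by (intro exI[of _ 1]) auto
  ultimately show ?thesis unfolding f_def by simp
qed

lemma germ_branch_cong:
  assumes "\<And>p. p \<in> P \<Longrightarrow> g p = g' p"
  shows "germ_branch q P g F \<longleftrightarrow> germ_branch q P g' F"
  unfolding germ_branch_def using assms by (intro ball_cong) auto

lemma ode_radius_subset: "ode_radius q A \<rho> \<Longrightarrow> B \<subseteq> A \<Longrightarrow> ode_radius q B \<rho>"
  unfolding ode_radius_def by (meson subsetD)

text \<open>The property \<open>C s\<close>, that every branch along the loop at stage
  \<open>s\<close> closes up, holds for the constant loop. By uniform continuity, loops whose stages
  differ by less than \<open>\<delta>\<close> stay within \<open>\<rho>\<close> of each other, so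
  \<open>monodromy_step\<close> transfers it.\<close>

lemma monodromy:
  assumes hom: "homotopic_loops S \<gamma> (linepath b b)" and S: "open S" and q: "q holomorphic_on S"
    and F: "germ_branch q {0..1} \<gamma> F"
  shows "\<exists>d>0. \<forall>\<xi>\<in>ball (\<gamma> 0) d. F 1 \<xi> = F 0 \<xi>"
proof -
  obtain h where h: "continuous_on ({0..1::real} \<times> {0..1::real}) h" "h \<in> ({0..1} \<times> {0..1}) \<rightarrow> S"
      "\<forall>t\<in>{0..1}. h (0, t) = \<gamma> t" "\<forall>t\<in>{0..1}. h (1, t) = linepath b b t"
      "\<forall>s\<in>{0..1}. pathfinish (h \<circ> Pair s) = pathstart (h \<circ> Pair s)"
    using hom unfolding homotopic_loops by blast
  define A where "A = h ` ({0..1} \<times> {0..1})"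
  have A: "compact A" "A \<subseteq> S"
    unfolding A_def using h(1,2) by (auto intro!: compact_continuous_image compact_Times)
  obtain \<rho> where \<rho>: "ode_radius q A \<rho>" using ode_radius_exists[OF A S q, of 1] by (metis zero_less_one)
  have "uniformly_continuous_on ({0..1} \<times> {0..1}) h"
    by (intro compact_uniformly_continuous h(1) compact_Times) auto
  moreover have "\<rho> > 0" using \<rho> by (simp add: ode_radius_def)
  ultimately obtain \<delta> where \<delta>: "\<delta> > 0"
    "\<And>x x'. x \<in> {0..1} \<times> {0..1} \<Longrightarrow> x' \<in> {0..1} \<times> {0..1} \<Longrightarrow> dist x' x < \<delta> \<Longrightarrow> dist (h x') (h x) < \<rho>"
    unfolding uniformly_continuous_on_def by metis
  define C where "C s \<longleftrightarrow> (\<forall>F. germ_branch q {0..1} (\<lambda>t. h (s, t)) F \<longrightarrow> (\<exists>d>0. \<forall>\<xi>\<in>ball (h (s, 0)) d. F 1 \<xi> = F 0 \<xi>))" for s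
  have step: "C s" if "C s'" "s \<in> {0..1}" "s' \<in> {0..1}" "\<bar>s - s'\<bar> < \<delta>" for s s'
    unfolding C_def
  proof (intro allI impI)
    fix F assume F: "germ_branch q {0..1} (\<lambda>t. h (s, t)) F"
    show "\<exists>d>0. \<forall>\<xi>\<in>ball (h (s, 0)) d. F 1 \<xi> = F 0 \<xi>"
    proof (rule monodromy_step[OF F, where g' = "\<lambda>t. h (s', t)" and \<rho> = \<rho>])
      show "continuous_on {0..1} (\<lambda>t. h (s, t))"
        by (rule continuous_on_compose2[OF h(1)]) (use that in \<open>auto intro!: continuous_intros\<close>)
      show "h (s, 1) = h (s, 0)" using h(5) that(2) by (simp add: pathfinish_def pathstart_def)
      show "ode_radius q ((\<lambda>t. h (s, t)) ` {0..1}) \<rho>"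
        by (rule ode_radius_subset[OF \<rho>]) (use that in \<open>auto simp: A_def\<close>)
      show "h (s', t) \<in> ball (h (s, t)) \<rho>" if "t \<in> {0..1}" for t
        using \<delta>(2)[of "(s', t)" "(s, t)"] that \<open>s \<in> _\<close> \<open>s' \<in> _\<close> \<open>\<bar>s - s'\<bar> < \<delta>\<close>
        by (simp add: dist_Pair_Pair dist_real_def)
    qed (use that(1) in \<open>auto simp: C_def\<close>)
  qed
  have "C 1"
    unfolding C_def using germ_branch_const[of q b] h(4) germ_branch_cong[of "{0..1}" "\<lambda>t. h (1, t)" "\<lambda>_. b" q]
    by (auto simp: linepath_refl)
  obtain n where n: "1 / real (Suc n) < \<delta>" using \<delta>(1) reals_Archimedean[of \<delta>] by (auto simp: field_simps)
  \<comment> \<open>The induction runs backwards through the homotopy, from the constant loop at 1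
    to the given loop at 0.\<close>
  have "C (1 - real j / real (Suc n))" if "j \<le> Suc n" for j
    using that
  proof (induction j)
    case 0
    then show ?case using \<open>C 1\<close> by simp
  next
    case (Suc j)
    show ?case
    proof (rule step[OF Suc.IH])
      have "(1 - real (Suc j) / real (Suc n)) - (1 - real j / real (Suc n)) = - (1 / real (Suc n))"
        by (simp add: diff_divide_distrib[symmetric])
      then show "\<bar>(1 - real (Suc j) / real (Suc n)) - (1 - real j / real (Suc n))\<bar> < \<delta>" using n by simp
    qed (use Suc.prems in \<open>auto simp: divide_le_eq\<close>)
  qed
  from this[of "Suc n"] have "C 0" by simp
  moreover have "germ_branch q {0..1} (\<lambda>t. h (0, t)) F"
    using F h(3) germ_branch_cong[of "{0..1}" "\<lambda>t. h (0, t)" \<gamma> q F] by auto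
  ultimately show ?thesis using h(3) unfolding C_def by auto
qed

subsection \<open>Deformation of contours, logarithms and the kernel identity\<close>

text \<open>Near each \<open>t\<close> the primitive \<open>J\<close> is known only through a
  representative \<open>j\<close>, which is how the primitive of a branch appears along a path. The
  finite set \<open>S\<close> accommodates the corners of a piecewise smooth path.\<close>

lemma FTC_local:
  fixes J :: "real \<Rightarrow> complex"
  assumes S: "finite S"
    and loc: "\<And>t. t \<in> {0..1} \<Longrightarrow> \<exists>j. j t = J t \<and> (\<forall>\<^sub>F s in at t within {0..1}. J s = j s) \<and>
      continuous (at t within {0..1}) j \<and> (t \<notin> S \<longrightarrow> (j has_vector_derivative D t) (at t within {0..1}))"
  shows "(D has_integral (J 1 - J 0)) {0..1}"
proof (rule fundamental_theorem_of_calculus_interior_strong[OF S])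
  show "continuous_on {0..1} J"
    unfolding continuous_on_eq_continuous_within
  proof
    fix t :: real assume "t \<in> {0..1}"
    from loc[OF this] obtain j where j: "j t = J t" "\<forall>\<^sub>F s in at t within {0..1}. J s = j s" "continuous (at t within {0..1}) j"
      by blast
    show "continuous (at t within {0..1}) J"
      using j(3) unfolding continuous_within j(1) using tendsto_cong[OF j(2)] by blast
  qed
  fix t :: real assume t: "t \<in> {0<..<1} - S"
  then have t': "t \<in> {0..1}" "t \<notin> S" by auto
  obtain j where j': "j t = J t \<and> (\<forall>\<^sub>F s in at t within {0..1}. J s = j s) \<and>
      continuous (at t within {0..1}) j \<and> (t \<notin> S \<longrightarrow> (j has_vector_derivative D t) (at t within {0..1}))"
    using loc[OF t'(1)] by (rule exE)
  note j = j'[THEN conjunct1] j'[THEN conjunct2, THEN conjunct1]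
  note jd = mp[OF j'[THEN conjunct2, THEN conjunct2, THEN conjunct2] t'(2)]
  have "\<forall>\<^sub>F s in nhds t. s \<in> {0..1} \<longrightarrow> J s = j s"
    using j(2) unfolding eventually_at_filter by eventually_elim (use j(1) in auto)
  then have "(J has_vector_derivative D t) (at t within {0..1})"
    using has_vector_derivative_cong_ev[of "{0..1}" J j t "D t"] j(1) jd by simp
  moreover have "at t within {0..1} = at t" using t by (intro at_within_Icc_at) auto
  ultimately show "(J has_vector_derivative D t) (at t)" by (simp only:)
qed auto

lemma valid_path_derivatives:
  assumes "valid_path g"
  obtains S where "finite S"
    "\<And>t. t \<in> {0..1} - S \<Longrightarrow> (g has_vector_derivative vector_derivative g (at t within {0..1})) (at t within {0..1})"
proof -
  obtain S where S: "finite S" "g C1_differentiable_on ({0..1} - S)"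
    using assms by (auto simp: valid_path_def piecewise_C1_differentiable_on_def)
  show ?thesis
  proof (rule that[OF S(1)])
    fix t assume "t \<in> {0..1} - S"
    then have "g differentiable (at t within {0..1})"
      using S(2) by (auto simp: C1_differentiable_on_eq intro: differentiable_at_withinI)
    then show "(g has_vector_derivative vector_derivative g (at t within {0..1})) (at t within {0..1})"
      by (simp add: vector_derivative_works)
  qed
qed

lemma continuous_on_locally_eq:
  fixes f :: "'a::t2_space \<Rightarrow> 'b::topological_space"
  assumes "\<And>p. p \<in> S \<Longrightarrow> \<exists>h. h p = f p \<and> continuous (at p within S) h \<and> (\<forall>\<^sub>F q in at p within S. f q = h q)"
  shows "continuous_on S f"
  unfolding continuous_on_eq_continuous_within
proof
  fix p assume "p \<in> S"
  from assms[OF this] obtain h where h: "h p = f p" "continuous (at p within S) h" "\<forall>\<^sub>F q in at p within S. f q = h q"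
    by blast
  show "continuous (at p within S) f"
    using h(2) unfolding continuous_within h(1) using tendsto_cong[OF h(3)] by blast
qed

lemma eventually_mem_ball:
  assumes "continuous_on P g" "p \<in> P" "g p \<in> ball c r"
  shows "\<forall>\<^sub>F s in at p within P. g s \<in> ball c r"
proof -
  have "(g \<longlongrightarrow> g p) (at p within P)" using assms by (auto simp: continuous_on_def)
  then show ?thesis using topological_tendstoD[OF _ open_ball assms(3)] by blast
qed

lemma eventually_mem_at_within: "\<forall>\<^sub>F s in at p within P. s \<in> P"
  by (simp add: eventually_at_filter)

lemma has_vector_derivative_field_compose:
  assumes "(Q has_field_derivative Q') (at (g t))" "(g has_vector_derivative g') (at t within T)"
  shows "((\<lambda>s. Q (g s)) has_vector_derivative Q' * g') (at t within T)"
  using field_vector_diff_chain_within[OF assms(2) has_field_derivative_at_within[OF assms(1)]]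
  by (simp add: o_def mult.commute)

lemma continuous_within_compose_field:
  assumes "(Q has_field_derivative Q') (at (g t))" "continuous (at t within T) g"
  shows "continuous (at t within T) (\<lambda>s. Q (g s))"
  using continuous_within_compose2[OF assms(2), of Q] DERIV_isCont[OF assms(1)]
  by (simp add: continuous_at_imp_continuous_at_within)

text \<open>By coherence \<open>R s (g s)\<close> equals \<open>R t (g s)\<close> for
  \<open>s\<close> near \<open>t\<close>, so the values of the branches along \<open>g\<close> are a
  primitive of the integrand.\<close>

lemma coherent_total_derivative_integral:
  assumes hol: "\<And>t. t \<in> {0..1} \<Longrightarrow> R t holomorphic_on ball (c t) \<rho>"
    and coh: "coherent_on {0..1} c \<rho> R"
    and closed: "R 1 (g 1) = R 0 (g 0)"
    and g: "valid_path g" "\<And>t. t \<in> {0..1} \<Longrightarrow> g t \<in> ball (c t) \<rho>"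
  shows "((\<lambda>t. deriv (R t) (g t) * vector_derivative g (at t within {0..1})) has_integral 0) {0..1}"
proof -
  obtain S where S: "finite S"
    "\<And>t. t \<in> {0..1} - S \<Longrightarrow> (g has_vector_derivative vector_derivative g (at t within {0..1})) (at t within {0..1})"
    using valid_path_derivatives[OF g(1)] by metis
  have cont: "continuous_on {0..1} g" using valid_path_imp_path[OF g(1)] by (simp add: path_def)
  have "((\<lambda>t. deriv (R t) (g t) * vector_derivative g (at t within {0..1})) has_integral (R 1 (g 1) - R 0 (g 0))) {0..1}"
  proof (rule FTC_local[OF S(1), where J = "\<lambda>t. R t (g t)"])
    fix t :: real assume t: "t \<in> {0..1}"
    have R': "(R t has_field_derivative deriv (R t) (g t)) (at (g t))"
      by (rule holomorphic_derivI[OF hol[OF t] open_ball g(2)[OF t]])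
    have "\<forall>\<^sub>F s in at t within {0..1}. \<forall>\<xi>\<in>ball (c t) \<rho> \<inter> ball (c s) \<rho>. R s \<xi> = R t \<xi>"
      using coh t by (simp add: coherent_on_def)
    then have 1: "\<forall>\<^sub>F s in at t within {0..1}. R s (g s) = R t (g s)"
      using eventually_mem_ball[OF cont t g(2)[OF t]] eventually_mem_at_within[of "{0..1}" t]
      by eventually_elim (use g(2) in auto)
    have 2: "continuous (at t within {0..1}) (\<lambda>s. R t (g s))"
      using cont t by (intro continuous_within_compose_field[where g = g and t = t, OF R']) (auto simp: continuous_on_eq_continuous_within)
    have 3: "((\<lambda>s. R t (g s)) has_vector_derivative deriv (R t) (g t) * vector_derivative g (at t within {0..1})) (at t within {0..1})"
      if "t \<notin> S"
      by (rule has_vector_derivative_field_compose[where g = g and t = t, OF R' S(2)]) (use t that in auto)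
    show "\<exists>j. j t = R t (g t) \<and> (\<forall>\<^sub>F s in at t within {0..1}. R s (g s) = j s) \<and> continuous (at t within {0..1}) j \<and>
        (t \<notin> S \<longrightarrow> (j has_vector_derivative deriv (R t) (g t) * vector_derivative g (at t within {0..1})) (at t within {0..1}))"
      by (rule exI[of _ "\<lambda>s. R t (g s)"]) (intro conjI impI refl 1 2 3)
  qed
  then show ?thesis using closed by simp
qed

text \<open>On the convex overlap the two primitives differ by a constant, which drops out of
  differences of values. The normalisations at the two centres thus do not matter.\<close>

lemma ball_primitive_diff_eq:
  assumes g: "g holomorphic_on ball c r" and g': "g' holomorphic_on ball c' r'"
    and eq: "\<And>x. x \<in> ball c r \<inter> ball c' r' \<Longrightarrow> g x = g' x"
    and x: "x \<in> ball c r \<inter> ball c' r'" "y \<in> ball c r \<inter> ball c' r'"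
  shows "ball_primitive c' r' g' x - ball_primitive c' r' g' y = ball_primitive c r g x - ball_primitive c r g y"
proof -
  have "\<exists>k. \<forall>x\<in>ball c r \<inter> ball c' r'. ball_primitive c' r' g' x - ball_primitive c r g x = k"
  proof (rule has_field_derivative_zero_constant)
    show "convex (ball c r \<inter> ball c' r')" by (intro convex_Int convex_ball)
    fix z assume z: "z \<in> ball c r \<inter> ball c' r'"
    then have "((\<lambda>x. ball_primitive c' r' g' x - ball_primitive c r g x) has_field_derivative g' z - g z) (at z)"
      by (intro DERIV_diff ball_primitive(1)[OF g] ball_primitive(1)[OF g']) auto
    then show "((\<lambda>x. ball_primitive c' r' g' x - ball_primitive c r g x) has_field_derivative 0) (at z within ball c r \<inter> ball c' r')"
      using eq[OF z] by (auto intro: has_field_derivative_at_within)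
  qed
  then obtain k where "\<And>x. x \<in> ball c r \<inter> ball c' r' \<Longrightarrow> ball_primitive c' r' g' x - ball_primitive c r g x = k"
    by blast
  from this[OF x(1)] this[OF x(2)] show ?thesis by (simp add: algebra_simps)
qed

text \<open>With \<open>Q t\<close> a local primitive of \<open>R t\<close>, the difference
  \<open>Q t (g t) - Q t (h t)\<close> is independent of the normalisation of \<open>Q t\<close>,
  hence well defined along the path. It is a primitive of the integrand and returns to its initial
  value, since both paths and the branch are closed.\<close>

lemma coherent_deformation_integral:
  assumes hol: "\<And>t. t \<in> {0..1} \<Longrightarrow> R t holomorphic_on ball (c t) \<rho>"
    and coh: "coherent_on {0..1} c \<rho> R"
    and closed: "c 1 = c 0" "\<And>\<xi>. \<xi> \<in> ball (c 0) \<rho> \<Longrightarrow> R 1 \<xi> = R 0 \<xi>"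
    and g: "valid_path g" "\<And>t. t \<in> {0..1} \<Longrightarrow> g t \<in> ball (c t) \<rho>" "g 1 = g 0"
    and h: "valid_path h" "\<And>t. t \<in> {0..1} \<Longrightarrow> h t \<in> ball (c t) \<rho>" "h 1 = h 0"
  shows "((\<lambda>t. R t (g t) * vector_derivative g (at t within {0..1}) -
    R t (h t) * vector_derivative h (at t within {0..1})) has_integral 0) {0..1}"
proof -
  obtain S where S: "finite S"
    "\<And>t. t \<in> {0..1} - S \<Longrightarrow> (g has_vector_derivative vector_derivative g (at t within {0..1})) (at t within {0..1})"
    using valid_path_derivatives[OF g(1)] by metis
  obtain S' where S': "finite S'"
    "\<And>t. t \<in> {0..1} - S' \<Longrightarrow> (h has_vector_derivative vector_derivative h (at t within {0..1})) (at t within {0..1})"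
    using valid_path_derivatives[OF h(1)] by metis
  have cg: "continuous_on {0..1} g" and ch: "continuous_on {0..1} h"
    using valid_path_imp_path[OF g(1)] valid_path_imp_path[OF h(1)] by (simp_all add: path_def)
  define Q where "Q t = ball_primitive (c t) \<rho> (R t)" for t
  have Q: "(Q t has_field_derivative R t x) (at x)" if "t \<in> {0..1}" "x \<in> ball (c t) \<rho>" for t x
    unfolding Q_def by (rule ball_primitive(1)[OF hol[OF that(1)] that(2)])
  have "((\<lambda>t. R t (g t) * vector_derivative g (at t within {0..1}) -
    R t (h t) * vector_derivative h (at t within {0..1})) has_integral
      ((Q 1 (g 1) - Q 1 (h 1)) - (Q 0 (g 0) - Q 0 (h 0)))) {0..1}"
  proof (rule FTC_local[OF finite_UnI[OF S(1) S'(1)], where J = "\<lambda>t. Q t (g t) - Q t (h t)"])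
    fix t :: real assume t: "t \<in> {0..1}"
    have "\<forall>\<^sub>F s in at t within {0..1}. \<forall>\<xi>\<in>ball (c t) \<rho> \<inter> ball (c s) \<rho>. R s \<xi> = R t \<xi>"
      using coh t by (simp add: coherent_on_def)
    then have 1: "\<forall>\<^sub>F s in at t within {0..1}. Q s (g s) - Q s (h s) = Q t (g s) - Q t (h s)"
      using eventually_mem_ball[OF cg t g(2)[OF t]] eventually_mem_ball[OF ch t h(2)[OF t]] eventually_mem_at_within[of "{0..1}" t]
    proof eventually_elim
      case (elim s)
      show ?case unfolding Q_def
        by (rule ball_primitive_diff_eq[OF hol[OF t] hol[OF elim(4)]]) (use elim g(2) h(2) in auto)
    qed
    note Qg = Q[OF t g(2)[OF t]] and Qh = Q[OF t h(2)[OF t]]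
    have 2: "continuous (at t within {0..1}) (\<lambda>s. Q t (g s) - Q t (h s))"
      using cg ch t by (intro continuous_diff continuous_within_compose_field[where g = g and t = t, OF Qg]
          continuous_within_compose_field[where g = h and t = t, OF Qh])
        (auto simp: continuous_on_eq_continuous_within)
    have 3: "((\<lambda>s. Q t (g s) - Q t (h s)) has_vector_derivative R t (g t) * vector_derivative g (at t within {0..1}) -
        R t (h t) * vector_derivative h (at t within {0..1})) (at t within {0..1})"
      if "t \<notin> S \<union> S'"
      by (intro has_vector_derivative_diff has_vector_derivative_field_compose[where g = g and t = t, OF Qg S(2)]
          has_vector_derivative_field_compose[where g = h and t = t, OF Qh S'(2)]) (use t that in auto)
    show "\<exists>j. j t = Q t (g t) - Q t (h t) \<and> (\<forall>\<^sub>F s in at t within {0..1}. Q s (g s) - Q s (h s) = j s) \<and>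
        continuous (at t within {0..1}) j \<and>
        (t \<notin> S \<union> S' \<longrightarrow> (j has_vector_derivative R t (g t) * vector_derivative g (at t within {0..1}) -
          R t (h t) * vector_derivative h (at t within {0..1})) (at t within {0..1}))"
      by (rule exI[of _ "\<lambda>s. Q t (g s) - Q t (h s)"]) (intro conjI impI refl 1 2 3)
  qed
  moreover have "Q 1 (g 1) - Q 1 (h 1) = Q 0 (g 0) - Q 0 (h 0)"
    unfolding Q_def g(3) h(3)
    by (rule ball_primitive_diff_eq[OF hol hol]) (use closed g(2)[of 0] h(2)[of 0] in auto)
  ultimately show ?thesis by simp
qed

section \<open>Continuous logarithms\<close>

lemma exp_eq_near_imp_eq:
  assumes "exp a = exp b" "dist a b < 1"
  shows "a = (b :: complex)"
proof (rule exp_complex_eqI[OF _ assms(1)])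
  have "\<bar>Im (a - b)\<bar> \<le> norm (a - b)" by (rule abs_Im_le_cmod)
  then show "\<bar>Im a - Im b\<bar> < 2 * pi" using assms(2) pi_gt3 by (simp add: dist_norm)
qed

text \<open>The difference of two logarithms of the same function takes values in a discrete set, so
  it is locally constant.\<close>

lemma exp_eq_connected_imp_eq:
  fixes f g :: "'a::topological_space \<Rightarrow> complex"
  assumes S: "connected S" and f: "continuous_on S f" and g: "continuous_on S g"
    and eq: "\<And>x. x \<in> S \<Longrightarrow> exp (f x) = exp (g x)" and a: "a \<in> S" "f a = g a" and x: "x \<in> S"
  shows "f x = g x"
proof -
  have c: "continuous_on S (\<lambda>x. f x - g x)" using f g by (rule continuous_on_diff)
  have "f x - g x = f a - g a"
  proof (rule connected_local_const[OF S x a(1)], intro ballI)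
    fix y assume y: "y \<in> S"
    have "\<forall>\<^sub>F z in at y within S. dist (f z - g z) (f y - g y) < 1"
      by (rule eventually_dist_less[OF c y]) simp
    then show "\<forall>\<^sub>F z in at y within S. f y - g y = f z - g z"
      using eventually_mem_at_within[of S y]
    proof eventually_elim
      case (elim z)
      have "exp (f z - g z) = exp (f y - g y)" using eq[OF y] eq[OF elim(2)] by (simp add: exp_diff)
      from exp_eq_near_imp_eq[OF this elim(1)] show ?case by simp
    qed
  qed
  then show ?thesis using a by simp
qed

text \<open>The logarithm \<open>q\<close> that realises the winding number is closed, and
  \<open>L\<close> differs from it by a constant.\<close>

lemma log_loop_closed:
  assumes p: "path p" "z \<notin> path_image p" "winding_number p z = 0"
    and L: "continuous_on {0..1} L" "\<And>t. t \<in> {0..1} \<Longrightarrow> exp (L t) = p t - z"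
  shows "L 1 = L 0"
proof -
  obtain q where q: "path q" "pathfinish q - pathstart q = 2 * of_real pi * \<i> * winding_number p z"
    "\<And>t. t \<in> {0..1} \<Longrightarrow> p t = z + exp (q t)"
    using winding_number_as_continuous_log[OF p(1,2)] by metis
  have q01: "q 1 = q 0" using q(2) p(3) by (simp add: pathfinish_def pathstart_def)
  have e: "exp (L t) = exp (q t)" if "t \<in> {0..1}" for t using q(3)[OF that] L(2)[OF that] by simp
  have "L 1 = q 1 + (L 0 - q 0)"
  proof (rule exp_eq_connected_imp_eq[of "{0..1}" L "\<lambda>t. q t + (L 0 - q 0)" 0 1])
    show "continuous_on {0..1} (\<lambda>t. q t + (L 0 - q 0))"
      using q(1) by (auto intro!: continuous_intros simp: path_def)
    show "exp (L t) = exp (q t + (L 0 - q 0))" if "t \<in> {0..1}" for t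
      using e[OF that] e[of 0] by (simp add: exp_add exp_diff)
  qed (use L(1) in auto)
  then show ?thesis using q01 by simp
qed

text \<open>\<open>h\<close> and the exponential of a primitive of its logarithmic derivative have a
  constant quotient, found at the centre.\<close>

lemma exp_ball_primitive_eq:
  assumes z: "z holomorphic_on ball c r" and r: "r > 0"
    and h: "\<And>y. y \<in> ball c r \<Longrightarrow> (h has_field_derivative z y * h y) (at y)"
    and y: "y \<in> ball c r"
  shows "h c * exp (ball_primitive c r z y) = h y"
proof -
  have "\<exists>k. \<forall>x\<in>ball c r. h x * exp (- ball_primitive c r z x) = k"
  proof (rule has_field_derivative_zero_constant[OF convex_ball has_field_derivative_at_within])
    fix x assume x: "x \<in> ball c r"
    show "((\<lambda>x. h x * exp (- ball_primitive c r z x)) has_field_derivative 0) (at x)"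
      by (auto intro!: derivative_eq_intros ball_primitive(1)[OF z x] h[OF x])
  qed
  then obtain k where k: "\<And>x. x \<in> ball c r \<Longrightarrow> h x * exp (- ball_primitive c r z x) = k" by blast
  have "k = h c" using k[of c] r ball_primitive(2)[OF z] by simp
  then have "h c * exp (ball_primitive c r z y) = h y * (exp (- ball_primitive c r z y) * exp (ball_primitive c r z y))"
    using k[OF y] by (simp add: mult_ac)
  then show ?thesis by (simp flip: exp_add)
qed

section \<open>The rational identity behind the kernel\<close>

text \<open>The kernel identity after multiplication by \<open>d\<^sup>2\<close>. Here
  \<open>X\<close> and \<open>Y\<close> are the values of \<wp> at \<open>x\<close> and \<xi>, and
  \<open>m1\<close>, \<open>m2\<close>, \<open>m3\<close> stand for \<open>l' j + 1\<close>. Once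
  \<open>X = Y + d\<close> is inserted both sides are polynomials in free variables.\<close>

lemma kernel_polynomial_identity:
  fixes X Y d \<eta> s l1 l2 l3 m1 m2 m3 e1 e2 e3 :: complex
  assumes "X = Y + d" "m1 = \<eta> + l1" "m2 = \<eta> + l2" "m3 = \<eta> + l3" "s = l1 + l2 + l3"
  shows "d\<^sup>2 * (l1\<^sup>2 * (X - e2 - e3) + l2\<^sup>2 * (X - e1 - e3) + l3\<^sup>2 * (X - e1 - e2)
      + 2 * (l1 * l2 * (X - e3) + l1 * l3 * (X - e2) + l2 * l3 * (X - e1)))
    + 4 * \<eta> * d * (l1 * (X - e2) * (X - e3) + l2 * (X - e1) * (X - e3) + l3 * (X - e1) * (X - e2))
    + 4 * \<eta>\<^sup>2 * ((X - e1) * (X - e2) * (X - e3)) - d\<^sup>2 * ((2 * \<eta> + s)\<^sup>2 * X)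
    = d\<^sup>2 * (m1\<^sup>2 * (Y - e2 - e3) + m2\<^sup>2 * (Y - e1 - e3) + m3\<^sup>2 * (Y - e1 - e2)
      + 2 * (m1 * m2 * (Y - e3) + m1 * m3 * (Y - e2) + m2 * m3 * (Y - e1)))
    + 4 * \<eta> * d * (m1 * (Y - e2) * (Y - e3) + m2 * (Y - e1) * (Y - e3) + m3 * (Y - e1) * (Y - e2))
    + 4 * \<eta>\<^sup>2 * ((Y - e1) * (Y - e2) * (Y - e3)) - d\<^sup>2 * ((\<eta> + s)\<^sup>2 * Y)"
  unfolding assms by (simp add: power2_eq_square algebra_simps)

text \<open>The squares of the partial fractions have poles at the three roots, and these are the
  poles of \<wp> at the shifted arguments with weights \<open>l1\<^sup>2\<close>,
  \<open>l2\<^sup>2\<close>, \<open>l3\<^sup>2\<close>. Subtracting them leaves a polynomial; the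
  lemma serves both variables.\<close>

lemma square_sum_expand:
  fixes X l1 l2 l3 e1 e2 e3 \<eta> d :: complex
  assumes "X \<noteq> e1" "X \<noteq> e2" "X \<noteq> e3" "d \<noteq> 0"
  shows "((X - e1) * (X - e2) * (X - e3)) * (l1 / (X - e1) + l2 / (X - e2) + l3 / (X - e3) + 2 * \<eta> / d)\<^sup>2 * d\<^sup>2
      - d\<^sup>2 * (l1\<^sup>2 * (e1 + (e1 - e2) * (e1 - e3) / (X - e1)) + l2\<^sup>2 * (e2 + (e2 - e1) * (e2 - e3) / (X - e2))
        + l3\<^sup>2 * (e3 + (e3 - e1) * (e3 - e2) / (X - e3)))
    = d\<^sup>2 * (l1\<^sup>2 * (X - e2 - e3) + l2\<^sup>2 * (X - e1 - e3) + l3\<^sup>2 * (X - e1 - e2)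
      + 2 * (l1 * l2 * (X - e3) + l1 * l3 * (X - e2) + l2 * l3 * (X - e1)))
    + 4 * \<eta> * d * (l1 * (X - e2) * (X - e3) + l2 * (X - e1) * (X - e3) + l3 * (X - e1) * (X - e2))
    + 4 * \<eta>\<^sup>2 * ((X - e1) * (X - e2) * (X - e3))"
proof -
  define a b c where "a = X - e1" and "b = X - e2" and "c = X - e3"
  have nz: "a \<noteq> 0" "b \<noteq> 0" "c \<noteq> 0" using assms by (auto simp: a_def b_def c_def)
  have e: "e1 = X - a" "e2 = X - b" "e3 = X - c" by (auto simp: a_def b_def c_def)
  have r: "(b - a) * (c - a) / a = b * c / a - b - c + a" "(a - b) * (c - b) / b = a * c / b - a - c + b"
    "(a - c) * (b - c) / c = a * b / c - a - b + c"
    using nz by (simp_all add: field_simps)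
  have q: "(a * b * c) * (l1 / a + l2 / b + l3 / c + 2 * \<eta> / d)\<^sup>2 * d\<^sup>2
    = d\<^sup>2 * (l1\<^sup>2 * (b * c / a) + l2\<^sup>2 * (a * c / b) + l3\<^sup>2 * (a * b / c) + 2 * (l1 * l2 * c + l1 * l3 * b + l2 * l3 * a))
      + 4 * \<eta> * d * (l1 * b * c + l2 * a * c + l3 * a * b) + 4 * \<eta>\<^sup>2 * (a * b * c)"
    using nz assms(4) by (simp add: field_simps power2_eq_square)
  show ?thesis
    unfolding a_def[symmetric] b_def[symmetric] c_def[symmetric] q unfolding e
    by (simp add: r) (simp add: algebra_simps)
qed

context period_pair
begin

definition potential :: "(nat \<Rightarrow> complex) \<Rightarrow> complex \<Rightarrow> complex" where
  "potential m x = (\<Sum>i\<le>3. m i * (m i + 1) * \<P> (x + \<omega> i))"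

lemma atMost_3: "{..3 :: nat} = {0, 1, 2, 3}" by auto

lemma sum_atMost_3: "(\<Sum>i\<le>3. f i) = f 0 + f 1 + f 2 + (f 3 :: complex)" for f :: "nat \<Rightarrow> complex"
  unfolding atMost_3 by simp

text \<open>For the kernel \<open>K\<close>, each side is its second derivative divided by
  \<open>K\<close>, minus the potential, in the respective variable. The term
  \<open>\<eta> * (\<P> (x + \<xi>) + \<P> (x - \<xi>))\<close> of the second logarithmic
  derivatives is common to both sides and left out.\<close>

lemma kernel_identity:
  fixes l l' :: "nat \<Rightarrow> complex"
  assumes alpha: "\<alpha>\<^sub>0 \<in> {- l 0, l 0 + 1}"
    and l': "l' 0 = (- \<alpha>\<^sub>0 - l 1 - l 2 - l 3) / 2 - 1" "l' 1 = (\<alpha>\<^sub>0 + l 1 - l 2 - l 3) / 2 - 1"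
      "l' 2 = (\<alpha>\<^sub>0 - l 1 + l 2 - l 3) / 2 - 1" "l' 3 = (\<alpha>\<^sub>0 - l 1 - l 2 + l 3) / 2 - 1"
    and eta: "\<eta> = (\<alpha>\<^sub>0 - l 1 - l 2 - l 3) / 2"
    and x: "x \<notin> H" and \<xi>: "\<xi> \<notin> H" and pm: "x + \<xi> \<notin> \<Lambda>" "x - \<xi> \<notin> \<Lambda>"
  shows "(\<alpha>\<^sub>0 * cozeta 0 x - l 1 * cozeta 1 x - l 2 * cozeta 2 x - l 3 * cozeta 3 x - \<eta> * (\<zeta> (x + \<xi>) + \<zeta> (x - \<xi>)))\<^sup>2
      + (- \<alpha>\<^sub>0 * \<P> (x + \<omega> 0) + l 1 * \<P> (x + \<omega> 1) + l 2 * \<P> (x + \<omega> 2) + l 3 * \<P> (x + \<omega> 3)) - potential l x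
    = ((l' 0 + 1) * cozeta 0 \<xi> + (l' 1 + 1) * cozeta 1 \<xi> + (l' 2 + 1) * cozeta 2 \<xi> + (l' 3 + 1) * cozeta 3 \<xi>
        - \<eta> * (\<zeta> (x + \<xi>) - \<zeta> (x - \<xi>)))\<^sup>2
      - ((l' 0 + 1) * \<P> (\<xi> + \<omega> 0) + (l' 1 + 1) * \<P> (\<xi> + \<omega> 1) + (l' 2 + 1) * \<P> (\<xi> + \<omega> 2) + (l' 3 + 1) * \<P> (\<xi> + \<omega> 3))
      - potential l' \<xi>"
proof -
  define X Y X' Y' d where "X = \<P> x" and "Y = \<P> \<xi>" and "X' = deriv \<P> x" and "Y' = deriv \<P> \<xi>" and "d = X - Y"
  define s where "s = l 1 + l 2 + l 3"
  define m where "m i = \<eta> + l i" for i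
  \<comment> \<open>This relation cancels \<open>\<zeta> x\<close> in the first bracket. In the
    second, the coefficients below add up to
    \<open>- (\<eta> + s) + 3 * \<eta> + s = 2 * \<eta>\<close> and cancel
    \<open>\<zeta> \<xi>\<close>.\<close>
  have \<alpha>: "\<alpha>\<^sub>0 = 2 * \<eta> + s" unfolding eta s_def by (simp add: field_simps)
  have m: "l' 0 + 1 = - (\<eta> + s)" "l' 1 + 1 = m 1" "l' 2 + 1 = m 2" "l' 3 + 1 = m 3"
    unfolding l' eta m_def s_def by (simp_all add: field_simps)
  have l'm: "l' 0 = - (\<eta> + s) - 1" "l' 1 = m 1 - 1" "l' 2 = m 2 - 1" "l' 3 = m 3 - 1"
    using m by (metis add_diff_cancel_right')+
  note xL = notin_half_lattice(1)[OF x] and \<xi>L = notin_half_lattice(1)[OF \<xi>]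
  have d: "d \<noteq> 0" using p_eq_iff[OF xL \<xi>L] pm by (auto simp: d_def X_def Y_def)
  have Xe: "X \<noteq> e 1" "X \<noteq> e 2" "X \<noteq> e 3" and Ye: "Y \<noteq> e 1" "Y \<noteq> e 2" "Y \<noteq> e 3"
    using p_ne_e[OF x] p_ne_e[OF \<xi>] by (auto simp: X_def Y_def)
  have S: "\<zeta> (x + \<xi>) + \<zeta> (x - \<xi>) = 2 * \<zeta> x + X' / d"
    and D: "\<zeta> (x + \<xi>) - \<zeta> (x - \<xi>) = 2 * \<zeta> \<xi> - Y' / d"
  proof -
    have "q = a - 2 * z \<Longrightarrow> a = 2 * z + q" for q a z :: complex by simp
    from this[OF zeta_addition(1)[OF xL \<xi>L pm]] this[OF zeta_addition(2)[OF xL \<xi>L pm]]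
    show "\<zeta> (x + \<xi>) + \<zeta> (x - \<xi>) = 2 * \<zeta> x + X' / d" "\<zeta> (x + \<xi>) - \<zeta> (x - \<xi>) = 2 * \<zeta> \<xi> - Y' / d"
      by (simp_all add: X_def Y_def X'_def Y'_def d_def)
  qed
  have cx: "cozeta i x = \<zeta> x + X' / 2 * (1 / (X - e i))" "cozeta i \<xi> = \<zeta> \<xi> + Y' / 2 * (1 / (Y - e i))"
    if "i \<in> {1, 2, 3}" for i
    using cozeta_eq[OF x that] cozeta_eq[OF \<xi> that] by (simp_all add: X_def Y_def X'_def Y'_def)
  note cx123 = cx[of 1, OF insertI1] cx[of 2, OF insertI2[OF insertI1]] cx[of 3, OF insertI2[OF insertI2[OF singletonI]]]
  have A: "\<alpha>\<^sub>0 * cozeta 0 x - l 1 * cozeta 1 x - l 2 * cozeta 2 x - l 3 * cozeta 3 x - \<eta> * (\<zeta> (x + \<xi>) + \<zeta> (x - \<xi>))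
      = - (X' / 2) * (l 1 / (X - e 1) + l 2 / (X - e 2) + l 3 / (X - e 3) + 2 * \<eta> / d)"
    unfolding S cozeta_0 cx123 \<alpha> s_def
    by (simp add: algebra_simps)
  have B: "(l' 0 + 1) * cozeta 0 \<xi> + (l' 1 + 1) * cozeta 1 \<xi> + (l' 2 + 1) * cozeta 2 \<xi> + (l' 3 + 1) * cozeta 3 \<xi>
        - \<eta> * (\<zeta> (x + \<xi>) - \<zeta> (x - \<xi>))
      = (Y' / 2) * (m 1 / (Y - e 1) + m 2 / (Y - e 2) + m 3 / (Y - e 3) + 2 * \<eta> / d)"
  proof -
    have "- (\<eta> + s) * z + (\<eta> + l 1) * (z + h * k1) + (\<eta> + l 2) * (z + h * k2) + (\<eta> + l 3) * (z + h * k3)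
        - \<eta> * (2 * z - 2 * h * k) = h * ((\<eta> + l 1) * k1 + (\<eta> + l 2) * k2 + (\<eta> + l 3) * k3 + 2 * \<eta> * k)"
      for z h k1 k2 k3 k by (simp add: s_def algebra_simps)
    from this[of "\<zeta> \<xi>" "Y' / 2" "1 / (Y - e 1)" "1 / (Y - e 2)" "1 / (Y - e 3)" "1 / d"]
    show ?thesis unfolding D cozeta_0 cx123 m m_def by simp
  qed
  have X'2: "(X' / 2)\<^sup>2 = (X - e 1) * (X - e 2) * (X - e 3)" and Y'2: "(Y' / 2)\<^sup>2 = (Y - e 1) * (Y - e 2) * (Y - e 3)"
  proof -
    have "(z / 2)\<^sup>2 = a * b * c" if "z\<^sup>2 = 4 * a * b * c" for z a b c :: complex
      using that by (simp add: power_divide)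
    then show "(X' / 2)\<^sup>2 = (X - e 1) * (X - e 2) * (X - e 3)" "(Y' / 2)\<^sup>2 = (Y - e 1) * (Y - e 2) * (Y - e 3)"
      using p_differential_equations(1)[OF x] p_differential_equations(1)[OF \<xi>]
      unfolding X_def Y_def X'_def Y'_def by blast+
  qed
  \<comment> \<open>Both admissible values of \<open>\<alpha>\<^sub>0\<close> give the same
    coefficient of the potential; this is where \<open>alpha\<close> enters.\<close>
  have l0: "l 0 * (l 0 + 1) = \<alpha>\<^sub>0\<^sup>2 - \<alpha>\<^sub>0" using alpha by (auto simp: power2_eq_square algebra_simps)
  define p where "p i = \<P> (x + \<omega> i)" for i
  define r where "r i = \<P> (\<xi> + \<omega> i)" for i
  have p0: "p 0 = X" "r 0 = Y" by (simp_all add: p_def r_def half_period_simps X_def Y_def)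
  \<comment> \<open>The linear coefficients from the derivative and those from the potential cancel,
    which leaves squares, as \<open>square_sum_expand\<close> requires. The same happens for
    \<open>l'\<close>.\<close>
  have Vl: "- \<alpha>\<^sub>0 * p 0 + l 1 * p 1 + l 2 * p 2 + l 3 * p 3 - potential l x
      = - \<alpha>\<^sub>0\<^sup>2 * X - ((l 1)\<^sup>2 * p 1 + (l 2)\<^sup>2 * p 2 + (l 3)\<^sup>2 * p 3)"
    unfolding potential_def sum_atMost_3 p_def[symmetric] p0 l0 by (simp add: algebra_simps power2_eq_square)
  have Vl': "- ((l' 0 + 1) * r 0 + (l' 1 + 1) * r 1 + (l' 2 + 1) * r 2 + (l' 3 + 1) * r 3) - potential l' \<xi>
      = - (\<eta> + s)\<^sup>2 * Y - ((m 1)\<^sup>2 * r 1 + (m 2)\<^sup>2 * r 2 + (m 3)\<^sup>2 * r 3)"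
    unfolding potential_def sum_atMost_3 r_def[symmetric] p0 l'm by (simp add: algebra_simps power2_eq_square)
  define LHS where "LHS = ((X - e 1) * (X - e 2) * (X - e 3)) * (l 1 / (X - e 1) + l 2 / (X - e 2) + l 3 / (X - e 3) + 2 * \<eta> / d)\<^sup>2
      + (- \<alpha>\<^sub>0\<^sup>2 * X - ((l 1)\<^sup>2 * p 1 + (l 2)\<^sup>2 * p 2 + (l 3)\<^sup>2 * p 3))"
  define RHS where "RHS = ((Y - e 1) * (Y - e 2) * (Y - e 3)) * (m 1 / (Y - e 1) + m 2 / (Y - e 2) + m 3 / (Y - e 3) + 2 * \<eta> / d)\<^sup>2
      + (- (\<eta> + s)\<^sup>2 * Y - ((m 1)\<^sup>2 * r 1 + (m 2)\<^sup>2 * r 2 + (m 3)\<^sup>2 * r 3))"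
  have pe: "p 1 = e 1 + (e 1 - e 2) * (e 1 - e 3) / (X - e 1)" "p 2 = e 2 + (e 2 - e 1) * (e 2 - e 3) / (X - e 2)"
    "p 3 = e 3 + (e 3 - e 1) * (e 3 - e 2) / (X - e 3)"
    unfolding p_def X_def by (rule p_half_period_shift[OF x])+
  have re: "r 1 = e 1 + (e 1 - e 2) * (e 1 - e 3) / (Y - e 1)" "r 2 = e 2 + (e 2 - e 1) * (e 2 - e 3) / (Y - e 2)"
    "r 3 = e 3 + (e 3 - e 1) * (e 3 - e 2) / (Y - e 3)"
    unfolding r_def Y_def by (rule p_half_period_shift[OF \<xi>])+
  have dist: "(u + (- a * b - v)) * k = u * k - k * v - k * (a * b)" for u a b v k :: complex
    by (simp add: algebra_simps)
  have L: "LHS * d\<^sup>2 = d\<^sup>2 * ((l 1)\<^sup>2 * (X - e 2 - e 3) + (l 2)\<^sup>2 * (X - e 1 - e 3) + (l 3)\<^sup>2 * (X - e 1 - e 2)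
      + 2 * (l 1 * l 2 * (X - e 3) + l 1 * l 3 * (X - e 2) + l 2 * l 3 * (X - e 1)))
    + 4 * \<eta> * d * (l 1 * (X - e 2) * (X - e 3) + l 2 * (X - e 1) * (X - e 3) + l 3 * (X - e 1) * (X - e 2))
    + 4 * \<eta>\<^sup>2 * ((X - e 1) * (X - e 2) * (X - e 3)) - d\<^sup>2 * (\<alpha>\<^sub>0\<^sup>2 * X)"
    unfolding LHS_def dist square_sum_expand[OF Xe d, of "l 1" "l 2" "l 3" \<eta>, folded pe] ..
  have R: "RHS * d\<^sup>2 = d\<^sup>2 * ((m 1)\<^sup>2 * (Y - e 2 - e 3) + (m 2)\<^sup>2 * (Y - e 1 - e 3) + (m 3)\<^sup>2 * (Y - e 1 - e 2)
      + 2 * (m 1 * m 2 * (Y - e 3) + m 1 * m 3 * (Y - e 2) + m 2 * m 3 * (Y - e 1)))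
    + 4 * \<eta> * d * (m 1 * (Y - e 2) * (Y - e 3) + m 2 * (Y - e 1) * (Y - e 3) + m 3 * (Y - e 1) * (Y - e 2))
    + 4 * \<eta>\<^sup>2 * ((Y - e 1) * (Y - e 2) * (Y - e 3)) - d\<^sup>2 * ((\<eta> + s)\<^sup>2 * Y)"
    unfolding RHS_def dist square_sum_expand[OF Ye d, of "m 1" "m 2" "m 3" \<eta>, folded re] ..
  have "X = Y + d" by (simp add: d_def)
  have "LHS * d\<^sup>2 = RHS * d\<^sup>2"
    unfolding L R \<alpha>
    by (rule kernel_polynomial_identity[OF \<open>X = Y + d\<close> m_def m_def m_def s_def])
  then have "LHS = RHS" using d by simp
  moreover have "(- (X' / 2) * k)\<^sup>2 = (X - e 1) * (X - e 2) * (X - e 3) * k\<^sup>2"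
      "(Y' / 2 * k)\<^sup>2 = (Y - e 1) * (Y - e 2) * (Y - e 3) * k\<^sup>2" for k
    by (simp_all only: power_mult_distrib power2_minus X'2 Y'2)
  moreover have "u + (a - v) = u' + (- b - v') \<Longrightarrow> u + a - v = u' - b - v'" for u a v u' b v' :: complex
    by (simp only: diff_conv_add_uminus add.assoc)
  ultimately show ?thesis
    unfolding A B p_def[symmetric] r_def[symmetric] LHS_def RHS_def Vl[symmetric] Vl'[symmetric] by metis
qed

text \<open>The co-sigma functions do not vanish off \<open>H\<close>, so they map the null-homotopy
  of the contour into the punctured plane. The argument of \<open>M\<close> may vanish along that
  homotopy and is handled below the covering.\<close>

lemma closed_branches:
  assumes cyc: "cycle_I \<omega>\<^sub>1 \<omega>\<^sub>3 i x \<Gamma>" and x: "x \<notin> H"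
  shows "\<exists>a. homotopic_loops (- H) \<Gamma> (linepath a a)"
    and "j \<le> 3 \<Longrightarrow> continuous_on {0..1} L \<Longrightarrow> (\<And>t. t \<in> {0..1} \<Longrightarrow> exp (L t) = co j (\<Gamma> t)) \<Longrightarrow> L 1 = L 0"
    and "continuous_on {0..1} M \<Longrightarrow> (\<And>t. t \<in> {0..1} \<Longrightarrow> exp (M t) = \<sigma> (x + \<Gamma> t) * \<sigma> (x - \<Gamma> t)) \<Longrightarrow>
      continuous_on {0..1} L \<Longrightarrow> (\<And>t. t \<in> {0..1} \<Longrightarrow> exp (L t) = \<sigma> (\<Gamma> t)) \<Longrightarrow> M 1 = M 0"
proof -
  have \<Gamma>: "path \<Gamma>" "path_image \<Gamma> \<subseteq> - H" "pathfinish \<Gamma> = pathstart \<Gamma>"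
    using cyc by (auto simp: cycle_I_def Let_def valid_path_imp_path)
  note cI = cycle_I_D[OF cyc x]
  show hom: "\<exists>a. homotopic_loops (- H) \<Gamma> (linepath a a)"
    using lift_null_homotopy[OF \<Gamma>] cI(1) by blast
  have \<Gamma>H: "\<Gamma> t \<notin> H" if "t \<in> {0..1}" for t using \<Gamma>(2) that unfolding path_image_def by blast
  have closedL: "L 1 = L 0" if j: "j \<le> 3" and L: "continuous_on {0..1} L" "\<And>t. t \<in> {0..1} \<Longrightarrow> exp (L t) = co j (\<Gamma> t)" for j L
  proof -
    obtain a where "homotopic_loops (- H) \<Gamma> (linepath a a)" using hom by blast
    then have h: "homotopic_loops (- {0}) (co j \<circ> \<Gamma>) (co j \<circ> linepath a a)"
    proof (rule homotopic_loops_continuous_image)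
      show "continuous_on (- H) (co j)"
        using cosigma_deriv by (intro continuous_at_imp_continuous_on) (auto intro: DERIV_isCont)
      show "co j \<in> - H \<rightarrow> - {0}" using cosigma_ne_0[OF j] by auto
    qed
    have "winding_number (co j \<circ> \<Gamma>) 0 = winding_number (co j \<circ> linepath a a) 0"
      by (rule winding_number_homotopic_loops[OF h])
    also have "co j \<circ> linepath a a = linepath (co j a) (co j a)" by (auto simp: linepath_refl)
    also have "winding_number (linepath (co j a) (co j a)) 0 = 0"
      by (rule winding_number_trivial) (use homotopic_loops_imp_subset[OF h] in \<open>auto simp: path_image_def linepath_refl\<close>)
    finally have "winding_number (co j \<circ> \<Gamma>) 0 = 0" .
    then show "L 1 = L 0"
      using homotopic_loops_imp_path[OF h] homotopic_loops_imp_subset[OF h] L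
      by (intro log_loop_closed[of "co j \<circ> \<Gamma>" 0]) auto
  qed
  show "j \<le> 3 \<Longrightarrow> continuous_on {0..1} L \<Longrightarrow> (\<And>t. t \<in> {0..1} \<Longrightarrow> exp (L t) = co j (\<Gamma> t)) \<Longrightarrow> L 1 = L 0"
    by (rule closedL)
  assume M: "continuous_on {0..1} M" "\<And>t. t \<in> {0..1} \<Longrightarrow> exp (M t) = \<sigma> (x + \<Gamma> t) * \<sigma> (x - \<Gamma> t)"
    and L: "continuous_on {0..1} L" "\<And>t. t \<in> {0..1} \<Longrightarrow> exp (L t) = \<sigma> (\<Gamma> t)"
  note xL = notin_half_lattice(1)[OF x]
  \<comment> \<open>By \<open>p_diff\<close>, removing \<open>K\<close> and \<open>2 * L t\<close>
    from \<open>M t\<close> leaves a logarithm of \<open>w (\<Gamma> t) - w x\<close>, and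
    \<open>w \<circ> \<Gamma>\<close> has winding number 0 about \<open>w x\<close>.\<close>
  define K where "K = Ln ((e 2 - e 1) * (\<sigma> x)\<^sup>2)"
  have K: "exp K = (e 2 - e 1) * (\<sigma> x)\<^sup>2"
    unfolding K_def by (rule exp_Ln) (use e2_ne_e1 xL sigma_eq_0_iff in auto)
  have "(M 1 - K - 2 * L 1) = (M 0 - K - 2 * L 0)"
  proof (rule log_loop_closed[where p = "w \<circ> \<Gamma>" and z = "w x" and L = "\<lambda>t. M t - K - 2 * L t"])
    show "path (w \<circ> \<Gamma>)" using cI(1) homotopic_loops_imp_path by blast
    show "continuous_on {0..1} (\<lambda>t. M t - K - 2 * L t)" by (intro continuous_intros M L)
    fix t :: real assume t: "t \<in> {0..1}"
    note \<Gamma>L = notin_half_lattice(1)[OF \<Gamma>H[OF t]]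
    have "exp (M t) = (\<P> (\<Gamma> t) - \<P> x) * ((\<sigma> x)\<^sup>2 * (\<sigma> (\<Gamma> t))\<^sup>2)"
      unfolding M(2)[OF t] using p_diff[OF xL \<Gamma>L] by (simp add: algebra_simps)
    also have "\<P> (\<Gamma> t) - \<P> x = (w (\<Gamma> t) - w x) * (e 2 - e 1)"
      using e2_ne_e1 by (simp add: w_coord_def diff_divide_distrib[symmetric])
    finally have "exp (M t) = (w (\<Gamma> t) - w x) * exp K * (exp (L t))\<^sup>2"
      unfolding K L(2)[OF t] by (simp add: mult_ac)
    then have "exp (M t) = (w (\<Gamma> t) - w x) * exp (K + 2 * L t)"
      by (simp add: exp_add exp_double mult.assoc)
    then show "exp (M t - K - 2 * L t) = (w \<circ> \<Gamma>) t - w x"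
      by (simp add: exp_diff exp_add field_simps)
  qed (use cI in auto)
  moreover have "L 1 = L 0" by (rule closedL[of 0]) (use L in \<open>auto simp: cosigma_0\<close>)
  ultimately show "M 1 = M 0" by simp
qed

end

subsection \<open>Local branches of the integrand\<close>

lemma eventually_log_zero:
  fixes \<kappa> :: "'a::topological_space \<Rightarrow> complex"
  assumes "(\<kappa> \<longlongrightarrow> 0) (at t within T)" "\<forall>\<^sub>F s in at t within T. exp (\<kappa> s) = 1"
  shows "\<forall>\<^sub>F s in at t within T. \<kappa> s = 0"
proof -
  have "\<forall>\<^sub>F s in at t within T. dist (\<kappa> s) 0 < 1" using assms(1) by (rule tendstoD) simp
  with assms(2) show ?thesis by eventually_elim (auto intro: exp_eq_near_imp_eq)
qed

lemma ball_primitive_shift: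
  assumes "z holomorphic_on ball c r" "z holomorphic_on ball c' r" "c' \<in> ball c r" "y \<in> ball c r \<inter> ball c' r" "r > 0"
  shows "ball_primitive c' r z y = ball_primitive c r z y - ball_primitive c r z c'"
  using ball_primitive_diff_eq[OF assms(1,2) _ assms(4), of c'] assms ball_primitive(2)[OF assms(2)] by simp

lemma tendsto_ball_primitive:
  assumes "z holomorphic_on ball (c t) r" "r > 0" "continuous_on T c" "t \<in> T"
  shows "((\<lambda>s. ball_primitive (c t) r z (c s)) \<longlongrightarrow> 0) (at t within T)"
proof -
  have "isCont (ball_primitive (c t) r z) (c t)"
    by (rule DERIV_isCont[OF ball_primitive(1)[OF assms(1)]]) (use assms in simp)
  moreover have "(c \<longlongrightarrow> c t) (at t within T)" using assms(3,4) by (auto simp: continuous_on_def)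
  ultimately have "((\<lambda>s. ball_primitive (c t) r z (c s)) \<longlongrightarrow> ball_primitive (c t) r z (c t)) (at t within T)"
    by (rule isCont_tendsto_compose)
  then show ?thesis by (simp add: ball_primitive(2)[OF assms(1)])
qed

lemma leibniz_ball:
  fixes \<phi> \<phi>' :: "complex \<Rightarrow> real \<Rightarrow> complex"
  assumes der: "\<And>x t. x \<in> ball a \<delta> \<Longrightarrow> t \<in> {0..1} \<Longrightarrow> ((\<lambda>x. \<phi> x t) has_field_derivative \<phi>' x t) (at x)"
    and cont: "continuous_on (ball a \<delta> \<times> {0..1}) (\<lambda>(x, t). \<phi> x t)"
    and cont': "continuous_on (ball a \<delta> \<times> {0..1}) (\<lambda>(x, t). \<phi>' x t)"
    and x: "x \<in> ball a \<delta>"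
  shows "((\<lambda>x. integral {0..1} (\<phi> x)) has_field_derivative integral {0..1} (\<phi>' x)) (at x)"
proof -
  have "((\<lambda>x. integral (cbox 0 1) (\<phi> x)) has_field_derivative integral (cbox 0 1) (\<phi>' x)) (at x within ball a \<delta>)"
  proof (rule leibniz_rule_field_derivative)
    show "\<phi> x integrable_on cbox 0 1" if "x \<in> ball a \<delta>" for x
    proof (rule integrable_continuous)
      show "continuous_on (cbox 0 1) (\<phi> x)"
        using continuous_on_compose2[OF cont, of "cbox 0 1" "\<lambda>t. (x, t)"] that
        by (auto simp: image_subset_iff continuous_on_Pair)
    qed
  qed (use der cont' x in \<open>auto intro: has_field_derivative_at_within\<close>)
  then show ?thesis using x at_within_open[OF x open_ball] by simp
qed

lemma eventually_slice_right:
  fixes x :: "'a::metric_space" and t :: "'b::metric_space"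
  assumes "\<forall>\<^sub>F p in at (x, t) within A \<times> T. P p" "x \<in> A"
  shows "\<forall>\<^sub>F s in at t within T. P (x, s)"
proof -
  obtain d where "d > 0" "\<And>p. p \<in> A \<times> T \<Longrightarrow> p \<noteq> (x, t) \<and> dist p (x, t) < d \<Longrightarrow> P p"
    using assms(1) unfolding eventually_at by blast
  then show ?thesis using assms(2) unfolding eventually_at
    by (intro exI[of _ d]) (auto simp: dist_Pair_Pair)
qed

lemma eventually_slice_left:
  fixes x :: "'a::metric_space" and t :: "'b::metric_space"
  assumes "\<forall>\<^sub>F p in at (x, t) within A \<times> T. P p" "t \<in> T" "B \<subseteq> A"
  shows "\<forall>\<^sub>F y in at x within B. P (y, t)"
proof -
  obtain d where "d > 0" "\<And>p. p \<in> A \<times> T \<Longrightarrow> p \<noteq> (x, t) \<and> dist p (x, t) < d \<Longrightarrow> P p"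
    using assms(1) unfolding eventually_at by blast
  then show ?thesis using assms(2,3) unfolding eventually_at
    by (intro exI[of _ d]) (auto simp: dist_Pair_Pair)
qed

context period_pair
begin

lemma p_shift_deriv:
  "x \<notin> H \<Longrightarrow> ((\<lambda>x. \<P> (x + \<omega> i)) has_field_derivative deriv \<P> (x + \<omega> i)) (at x)"
  using notin_half_lattice by (intro DERIV_shift_at p_deriv) blast

lemma holomorphic_potential: "potential m holomorphic_on - H"
proof -
  have "(\<lambda>x. \<P> (x + \<omega> i)) holomorphic_on - H" for i
    unfolding holomorphic_on_open[OF open_Compl_half_lattice] using p_shift_deriv by blast
  then show ?thesis unfolding potential_def[abs_def] by (intro holomorphic_intros)
qed

lemma heun_solution_iff_ode:
  "heun_solution \<omega>\<^sub>1 \<omega>\<^sub>3 m E S f \<longleftrightarrow> ode_solution (\<lambda>x. potential m x - E) S f"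
proof -
  have "- d + V * y = E * y \<longleftrightarrow> d = (V - E) * y" for d V y :: complex
    by (auto simp: algebra_simps)
  then show ?thesis
    unfolding heun_solution_def ode_solution_def heun_operator_def potential_def by presburger
qed

end

section \<open>The integral transform and its given branches\<close>

locale heun_integral = period_pair +
  fixes E \<alpha>\<^sub>0 \<eta> :: complex
    and l l' :: "nat \<Rightarrow> complex"
    and i :: nat
    and U :: "complex set"
    and \<Gamma> :: "complex \<Rightarrow> real \<Rightarrow> complex"
    and F :: "complex \<times> real \<Rightarrow> complex \<Rightarrow> complex"
    and L :: "nat \<Rightarrow> complex \<times> real \<Rightarrow> complex"
    and M :: "complex \<times> real \<Rightarrow> complex"
    and N :: "nat \<Rightarrow> complex \<Rightarrow> complex"
    and f :: "complex \<Rightarrow> complex"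
  assumes alpha: "\<alpha>\<^sub>0 \<in> {- l 0, l 0 + 1}"
    and l': "l' 0 = (- \<alpha>\<^sub>0 - l 1 - l 2 - l 3) / 2 - 1" "l' 1 = (\<alpha>\<^sub>0 + l 1 - l 2 - l 3) / 2 - 1"
      "l' 2 = (\<alpha>\<^sub>0 - l 1 + l 2 - l 3) / 2 - 1" "l' 3 = (\<alpha>\<^sub>0 - l 1 - l 2 + l 3) / 2 - 1"
    and eta: "\<eta> = (\<alpha>\<^sub>0 - l 1 - l 2 - l 3) / 2"
    and U: "open U" "U \<inter> H = {}"
    and contour_cont: "continuous_on (U \<times> {0..1}) (\<lambda>(x, t). \<Gamma> x t)"
    and contour: "\<And>x. x \<in> U \<Longrightarrow> cycle_I \<omega>\<^sub>1 \<omega>\<^sub>3 i x (\<Gamma> x)"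
    and solution: "heun_solution_branch \<omega>\<^sub>1 \<omega>\<^sub>3 l' E (U \<times> {0..1}) (\<lambda>(x, t). \<Gamma> x t) F"
    and log_sigma_xi: "\<And>j. j \<le> 3 \<Longrightarrow> log_branch (U \<times> {0..1}) (\<lambda>(x, t). co j (\<Gamma> x t)) (L j)"
    and log_kernel: "log_branch (U \<times> {0..1}) (\<lambda>(x, t). \<sigma> (x + \<Gamma> x t) * \<sigma> (x - \<Gamma> x t)) M"
    and log_sigma_x: "\<And>j. j \<le> 3 \<Longrightarrow> log_branch U (co j) (N j)"
    and f: "\<And>x. x \<in> U \<Longrightarrow>
          f x = exp (\<alpha>\<^sub>0 * N 0 x) * exp (- l 1 * N 1 x) * exp (- l 2 * N 2 x) * exp (- l 3 * N 3 x) *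
            branch_integral (\<Gamma> x)
              (\<lambda>t. F (x, t) (\<Gamma> x t) *
                   exp ((l' 0 + 1) * L 0 (x, t)) * exp ((l' 1 + 1) * L 1 (x, t)) *
                   exp ((l' 2 + 1) * L 2 (x, t)) * exp ((l' 3 + 1) * L 3 (x, t)) *
                   exp (- \<eta> * M (x, t)))"
begin

definition rate :: "complex \<Rightarrow> complex" where "rate \<xi> = potential l' \<xi> - E"

lemma Gamma_notin: "x \<in> U \<Longrightarrow> t \<in> {0..1} \<Longrightarrow> \<Gamma> x t \<notin> H"
  using contour[of x] unfolding cycle_I_def Let_def path_image_def by blast

lemma Gamma_valid: "x \<in> U \<Longrightarrow> valid_path (\<Gamma> x)" and Gamma_closed: "x \<in> U \<Longrightarrow> \<Gamma> x 1 = \<Gamma> x 0"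
  using contour[of x] by (auto simp: cycle_I_def Let_def pathfinish_def pathstart_def)

lemma U_notin: "x \<in> U \<Longrightarrow> x \<notin> H" using U by blast

lemma L_exp: "j \<le> 3 \<Longrightarrow> x \<in> U \<Longrightarrow> t \<in> {0..1} \<Longrightarrow> exp (L j (x, t)) = co j (\<Gamma> x t)"
  using log_sigma_xi[of j] by (auto simp: log_branch_def)

lemma M_exp: "x \<in> U \<Longrightarrow> t \<in> {0..1} \<Longrightarrow> exp (M (x, t)) = \<sigma> (x + \<Gamma> x t) * \<sigma> (x - \<Gamma> x t)"
  using log_kernel by (auto simp: log_branch_def)

text \<open>An exponential never vanishes, so a logarithm of the kernel along the contours keeps
  them away from the points congruent to \<open>x\<close> and \<open>- x\<close>.\<close>

lemma plus_minus_notin: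
  assumes "x \<in> U" "t \<in> {0..1}"
  shows "x + \<Gamma> x t \<notin> \<Lambda>" "x - \<Gamma> x t \<notin> \<Lambda>"
  using M_exp[OF assms] exp_not_eq_zero[of "M (x, t)"] sigma_eq_0_iff by auto

lemma slice_right: "x \<in> U \<Longrightarrow> continuous_on (U \<times> {0..1}) G \<Longrightarrow> continuous_on {0..1} (\<lambda>t. G (x, t))" for G :: "complex \<times> real \<Rightarrow> complex"
  by (rule continuous_on_compose2[of "U \<times> {0..1}" G]) (auto intro!: continuous_intros)

lemma slice_left: "t \<in> {0..1} \<Longrightarrow> B \<subseteq> U \<Longrightarrow> continuous_on (U \<times> {0..1}) G \<Longrightarrow> continuous_on B (\<lambda>x. G (x, t))" for G :: "complex \<times> real \<Rightarrow> complex"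
  by (rule continuous_on_compose2[of "U \<times> {0..1}" G]) (auto intro!: continuous_intros)

lemma Gamma_cont: "x \<in> U \<Longrightarrow> continuous_on {0..1} (\<Gamma> x)"
  using slice_right[OF _ contour_cont] by simp

lemma L_cont: "j \<le> 3 \<Longrightarrow> continuous_on (U \<times> {0..1}) (L j)" and M_cont: "continuous_on (U \<times> {0..1}) M"
  using log_sigma_xi log_kernel by (auto simp: log_branch_def)

lemma F_germs: "germ_branch rate (U \<times> {0..1}) (\<lambda>(x, t). \<Gamma> x t) F"
  using solution unfolding heun_solution_branch_def germ_branch_def heun_solution_iff_ode rate_def .

end

text \<open>One radius for all local branches at \<open>x\<^sub>0\<close>. It is doubled for sum and
  difference because \<open>x\<close> and \<xi> may each move by up to
  \<open>\<rho>\<close>.\<close>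

locale heun_integral_at = heun_integral +
  fixes x\<^sub>0 :: complex and \<rho> :: real
  assumes x0: "x\<^sub>0 \<in> U"
    and rad: "ode_radius rate (\<Gamma> x\<^sub>0 ` {0..1}) \<rho>"
    and ball_U: "ball x\<^sub>0 \<rho> \<subseteq> U"
    and ball_xi: "\<And>t. t \<in> {0..1} \<Longrightarrow> ball (\<Gamma> x\<^sub>0 t) \<rho> \<subseteq> - H"
    and ball_plus: "\<And>t. t \<in> {0..1} \<Longrightarrow> ball (x\<^sub>0 + \<Gamma> x\<^sub>0 t) (2 * \<rho>) \<subseteq> - \<Lambda>"
    and ball_minus: "\<And>t. t \<in> {0..1} \<Longrightarrow> ball (x\<^sub>0 - \<Gamma> x\<^sub>0 t) (2 * \<rho>) \<subseteq> - \<Lambda>"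
begin

abbreviation "\<gamma> \<equiv> \<Gamma> x\<^sub>0"

lemma rho: "\<rho> > 0" using rad by (simp add: ode_radius_def)

lemma gamma_cont: "continuous_on {0..1} \<gamma>" and gamma_closed: "\<gamma> 1 = \<gamma> 0"
  using Gamma_cont[OF x0] Gamma_closed[OF x0] by auto

text \<open>
  Branches which are holomorphic near \<open>\<gamma> t\<close> and continue the given ones at \<open>(x\<^sub>0, t)\<close>; along the nearby
  contours \<open>\<Gamma> x\<close> they coincide with \<open>L\<close>, \<open>M\<close> and \<open>N\<close>.
\<close>

definition Lh :: "nat \<Rightarrow> real \<Rightarrow> complex \<Rightarrow> complex" where
  "Lh j t \<xi> = L j (x\<^sub>0, t) + ball_primitive (\<gamma> t) \<rho> (cozeta j) \<xi>"

definition Mh :: "real \<Rightarrow> complex \<Rightarrow> complex \<Rightarrow> complex" where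
  "Mh t x \<xi> = M (x\<^sub>0, t) + ball_primitive (x\<^sub>0 + \<gamma> t) (2 * \<rho>) \<zeta> (x + \<xi>) + ball_primitive (x\<^sub>0 - \<gamma> t) (2 * \<rho>) \<zeta> (x - \<xi>)"

definition Nh :: "nat \<Rightarrow> complex \<Rightarrow> complex" where
  "Nh j x = N j x\<^sub>0 + ball_primitive x\<^sub>0 \<rho> (cozeta j) x"

section \<open>Holomorphic logarithms near the contour\<close>

lemma cozeta_hol: "A \<subseteq> - H \<Longrightarrow> cozeta j holomorphic_on A"
proof -
  have "cozeta j holomorphic_on - H"
    unfolding holomorphic_on_open[OF open_Compl_half_lattice] using cozeta_deriv by blast
  then show "A \<subseteq> - H \<Longrightarrow> cozeta j holomorphic_on A" by (rule holomorphic_on_subset)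
qed

lemma zeta_hol: "A \<subseteq> - \<Lambda> \<Longrightarrow> \<zeta> holomorphic_on A"
proof -
  have "\<zeta> holomorphic_on - \<Lambda>"
    unfolding holomorphic_on_open[OF open_Compl_lattice] using zeta_deriv by blast
  then show "A \<subseteq> - \<Lambda> \<Longrightarrow> \<zeta> holomorphic_on A" by (rule holomorphic_on_subset)
qed

lemma ball_plus_minus:
  assumes "x \<in> ball x\<^sub>0 \<rho>" "\<xi> \<in> ball (\<gamma> t) \<rho>"
  shows "x + \<xi> \<in> ball (x\<^sub>0 + \<gamma> t) (2 * \<rho>)" "x - \<xi> \<in> ball (x\<^sub>0 - \<gamma> t) (2 * \<rho>)"
proof -
  have "norm (x\<^sub>0 - x) < \<rho>" "norm (\<gamma> t - \<xi>) < \<rho>" using assms by (auto simp: dist_norm)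
  then show "x + \<xi> \<in> ball (x\<^sub>0 + \<gamma> t) (2 * \<rho>)" "x - \<xi> \<in> ball (x\<^sub>0 - \<gamma> t) (2 * \<rho>)"
    using norm_triangle_ineq[of "x\<^sub>0 - x" "\<gamma> t - \<xi>"] norm_triangle_ineq4[of "x\<^sub>0 - x" "\<gamma> t - \<xi>"]
    by (auto simp: dist_norm algebra_simps)
qed

lemma notin:
  assumes "t \<in> {0..1}" "x \<in> ball x\<^sub>0 \<rho>" "\<xi> \<in> ball (\<gamma> t) \<rho>"
  shows "x \<notin> H" "\<xi> \<notin> H" "x + \<xi> \<notin> \<Lambda>" "x - \<xi> \<notin> \<Lambda>"
  using ball_plus_minus[OF assms(2,3)] assms U_notin ball_U ball_xi ball_plus ball_minus by blast+

lemma Lh_deriv: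
  "t \<in> {0..1} \<Longrightarrow> \<xi> \<in> ball (\<gamma> t) \<rho> \<Longrightarrow> (Lh j t has_field_derivative cozeta j \<xi>) (at \<xi>)"
  unfolding Lh_def[abs_def] using ball_primitive(1)[OF cozeta_hol[OF ball_xi]]
  by (auto intro!: derivative_eq_intros)

lemma Lh_exp:
  assumes "j \<le> 3" "t \<in> {0..1}" "\<xi> \<in> ball (\<gamma> t) \<rho>"
  shows "exp (Lh j t \<xi>) = co j \<xi>"
  unfolding Lh_def exp_add L_exp[OF assms(1) x0 assms(2)]
  by (rule exp_ball_primitive_eq[OF cozeta_hol[OF ball_xi[OF assms(2)]] rho cosigma_deriv assms(3)])
    (use ball_xi[OF assms(2)] in auto)

lemma Lh_center: "t \<in> {0..1} \<Longrightarrow> Lh j t (\<gamma> t) = L j (x\<^sub>0, t)"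
  using ball_primitive(2)[OF cozeta_hol[OF ball_xi]] by (simp add: Lh_def)

text \<open>On the overlap the branches at \<open>s\<close> and \<open>t\<close> differ by the
  constant \<open>\<kappa> s\<close>. It tends to 0 by continuity of \<open>L\<close>, while
  \<open>exp (\<kappa> s) = 1\<close> since both are logarithms of the same function; hence it
  vanishes for \<open>s\<close> near \<open>t\<close>.\<close>

lemma Lh_coherent:
  assumes j: "j \<le> 3"
  shows "coherent_on {0..1} \<gamma> \<rho> (Lh j)"
  unfolding coherent_on_def
proof
  fix t :: real assume t: "t \<in> {0..1}"
  define \<kappa> where "\<kappa> s = L j (x\<^sub>0, s) - L j (x\<^sub>0, t) - ball_primitive (\<gamma> t) \<rho> (cozeta j) (\<gamma> s)" for s
  have ev: "\<forall>\<^sub>F s in at t within {0..1}. \<gamma> s \<in> ball (\<gamma> t) \<rho>"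
    by (rule eventually_mem_ball[OF gamma_cont t]) (simp add: rho)
  have "((\<lambda>s. L j (x\<^sub>0, s)) \<longlongrightarrow> L j (x\<^sub>0, t)) (at t within {0..1})"
    using slice_right[OF x0 L_cont[OF j]] t by (simp add: continuous_on_def)
  then have "(\<kappa> \<longlongrightarrow> L j (x\<^sub>0, t) - L j (x\<^sub>0, t) - 0) (at t within {0..1})"
    unfolding \<kappa>_def by (intro tendsto_intros tendsto_ball_primitive cozeta_hol ball_xi rho gamma_cont t)
  then have lim: "(\<kappa> \<longlongrightarrow> 0) (at t within {0..1})" by simp
  have "\<forall>\<^sub>F s in at t within {0..1}. exp (\<kappa> s) = 1"
    using ev eventually_mem_at_within[of "{0..1}" t]
  proof eventually_elim
    case (elim s)
    have "exp (L j (x\<^sub>0, s)) = exp (Lh j t (\<gamma> s))" using L_exp[OF j x0 elim(2)] Lh_exp[OF j t elim(1)] by simp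
    then show ?case by (simp add: \<kappa>_def Lh_def exp_diff exp_add)
  qed
  from eventually_log_zero[OF lim this] ev eventually_mem_at_within[of "{0..1}" t]
  show "\<forall>\<^sub>F s in at t within {0..1}. \<forall>\<xi>\<in>ball (\<gamma> t) \<rho> \<inter> ball (\<gamma> s) \<rho>. Lh j s \<xi> = Lh j t \<xi>"
  proof eventually_elim
    case (elim s)
    show ?case
    proof
      fix \<xi> assume \<xi>: "\<xi> \<in> ball (\<gamma> t) \<rho> \<inter> ball (\<gamma> s) \<rho>"
      have "Lh j s \<xi> = Lh j t \<xi> + \<kappa> s"
        unfolding Lh_def \<kappa>_def ball_primitive_shift[OF cozeta_hol[OF ball_xi[OF t]] cozeta_hol[OF ball_xi[OF elim(3)]] elim(2) \<xi> rho]
        by simp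
      then show "Lh j s \<xi> = Lh j t \<xi>" using elim(1) by simp
    qed
  qed
qed

lemma Mh_deriv:
  assumes "t \<in> {0..1}" "x \<in> ball x\<^sub>0 \<rho>" "\<xi> \<in> ball (\<gamma> t) \<rho>"
  shows "((\<lambda>x. Mh t x \<xi>) has_field_derivative \<zeta> (x + \<xi>) + \<zeta> (x - \<xi>)) (at x)"
    and "(Mh t x has_field_derivative \<zeta> (x + \<xi>) - \<zeta> (x - \<xi>)) (at \<xi>)"
proof -
  note b = ball_plus_minus[OF assms(2,3)]
  note P = ball_primitive(1)[OF zeta_hol[OF ball_plus[OF assms(1)]] b(1)]
  note Q = ball_primitive(1)[OF zeta_hol[OF ball_minus[OF assms(1)]] b(2)]
  have "((\<lambda>x. Mh t x \<xi>) has_field_derivative 0 + \<zeta> (x + \<xi>) * 1 + \<zeta> (x - \<xi>) * 1) (at x)"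
    unfolding Mh_def
    by (intro DERIV_add DERIV_const DERIV_chain2[where g = "\<lambda>x. x + \<xi>" and x = x, OF P]
        DERIV_chain2[where g = "\<lambda>x. x - \<xi>" and x = x, OF Q]) (auto intro!: derivative_eq_intros)
  then show "((\<lambda>x. Mh t x \<xi>) has_field_derivative \<zeta> (x + \<xi>) + \<zeta> (x - \<xi>)) (at x)" by simp
  have "(Mh t x has_field_derivative 0 + \<zeta> (x + \<xi>) * 1 + \<zeta> (x - \<xi>) * (- 1)) (at \<xi>)"
    unfolding Mh_def[abs_def]
    by (intro DERIV_add DERIV_const DERIV_chain2[where g = "\<lambda>\<xi>. x + \<xi>" and x = \<xi>, OF P]
        DERIV_chain2[where g = "\<lambda>\<xi>. x - \<xi>" and x = \<xi>, OF Q]) (auto intro!: derivative_eq_intros)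
  then show "(Mh t x has_field_derivative \<zeta> (x + \<xi>) - \<zeta> (x - \<xi>)) (at \<xi>)" by simp
qed

lemma Mh_exp:
  assumes t: "t \<in> {0..1}" and "x \<in> ball x\<^sub>0 \<rho>" "\<xi> \<in> ball (\<gamma> t) \<rho>"
  shows "exp (Mh t x \<xi>) = \<sigma> (x + \<xi>) * \<sigma> (x - \<xi>)"
proof -
  note b = ball_plus_minus[OF assms(2,3)]
  have "\<sigma> (x\<^sub>0 + \<gamma> t) * exp (ball_primitive (x\<^sub>0 + \<gamma> t) (2 * \<rho>) \<zeta> (x + \<xi>)) = \<sigma> (x + \<xi>)"
    by (rule exp_ball_primitive_eq[OF zeta_hol[OF ball_plus[OF t]] _ sigma_deriv' b(1)]) (use rho ball_plus[OF t] in auto)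
  moreover have "\<sigma> (x\<^sub>0 - \<gamma> t) * exp (ball_primitive (x\<^sub>0 - \<gamma> t) (2 * \<rho>) \<zeta> (x - \<xi>)) = \<sigma> (x - \<xi>)"
    by (rule exp_ball_primitive_eq[OF zeta_hol[OF ball_minus[OF t]] _ sigma_deriv' b(2)]) (use rho ball_minus[OF t] in auto)
  ultimately show ?thesis
    unfolding Mh_def exp_add M_exp[OF x0 t] by (metis mult.assoc mult.left_commute)
qed

lemma Mh_center: "t \<in> {0..1} \<Longrightarrow> Mh t x\<^sub>0 (\<gamma> t) = M (x\<^sub>0, t)"
  using ball_primitive(2)[OF zeta_hol[OF ball_plus]] ball_primitive(2)[OF zeta_hol[OF ball_minus]] by (simp add: Mh_def)

text \<open>The argument of \<open>Lh_coherent\<close>, uniform in \<open>x\<close>: the discrepancy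
  \<open>\<kappa> s\<close> is computed at \<open>x\<^sub>0\<close> and depends neither on
  \<open>x\<close> nor on \<xi>.\<close>

lemma Mh_coherent:
  assumes t: "t \<in> {0..1}"
  shows "\<forall>\<^sub>F s in at t within {0..1}. \<forall>x\<in>ball x\<^sub>0 \<rho>. \<forall>\<xi>\<in>ball (\<gamma> t) \<rho> \<inter> ball (\<gamma> s) \<rho>. Mh s x \<xi> = Mh t x \<xi>"
proof -
  define a where "a s = ball_primitive (x\<^sub>0 + \<gamma> t) (2 * \<rho>) \<zeta> (x\<^sub>0 + \<gamma> s)" for s
  define b where "b s = ball_primitive (x\<^sub>0 - \<gamma> t) (2 * \<rho>) \<zeta> (x\<^sub>0 - \<gamma> s)" for s
  define \<kappa> where "\<kappa> s = M (x\<^sub>0, s) - M (x\<^sub>0, t) - a s - b s" for s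
  have r2: "2 * \<rho> > 0" using rho by simp
  have ev: "\<forall>\<^sub>F s in at t within {0..1}. \<gamma> s \<in> ball (\<gamma> t) \<rho>"
    by (rule eventually_mem_ball[OF gamma_cont t]) (simp add: rho)
  have Mlim: "((\<lambda>s. M (x\<^sub>0, s)) \<longlongrightarrow> M (x\<^sub>0, t)) (at t within {0..1})"
    using slice_right[OF x0 M_cont] t by (simp add: continuous_on_def)
  have alim: "(a \<longlongrightarrow> 0) (at t within {0..1})"
    unfolding a_def by (rule tendsto_ball_primitive[where c = "\<lambda>s. x\<^sub>0 + \<gamma> s" and t = t, OF zeta_hol[OF ball_plus[OF t]] r2 _ t])
      (intro continuous_intros gamma_cont)
  have blim: "(b \<longlongrightarrow> 0) (at t within {0..1})"
    unfolding b_def by (rule tendsto_ball_primitive[where c = "\<lambda>s. x\<^sub>0 - \<gamma> s" and t = t, OF zeta_hol[OF ball_minus[OF t]] r2 _ t])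
      (intro continuous_intros gamma_cont)
  have "(\<kappa> \<longlongrightarrow> M (x\<^sub>0, t) - M (x\<^sub>0, t) - 0 - 0) (at t within {0..1})"
    unfolding \<kappa>_def by (intro tendsto_intros Mlim alim blim)
  then have lim: "(\<kappa> \<longlongrightarrow> 0) (at t within {0..1})" by simp
  have "\<forall>\<^sub>F s in at t within {0..1}. exp (\<kappa> s) = 1"
    using ev eventually_mem_at_within[of "{0..1}" t]
  proof eventually_elim
    case (elim s)
    have "exp (M (x\<^sub>0, s)) = exp (Mh t x\<^sub>0 (\<gamma> s))"
      unfolding M_exp[OF x0 elim(2)] by (rule Mh_exp[symmetric]) (use t elim rho in auto)
    then show ?case by (simp add: \<kappa>_def a_def b_def Mh_def exp_diff exp_add)
  qed
  from eventually_log_zero[OF lim this] ev eventually_mem_at_within[of "{0..1}" t]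
  show ?thesis
  proof eventually_elim
    case (elim s)
    show ?case
    proof (intro ballI)
      fix x \<xi> assume x: "x \<in> ball x\<^sub>0 \<rho>" and \<xi>: "\<xi> \<in> ball (\<gamma> t) \<rho> \<inter> ball (\<gamma> s) \<rho>"
      have b: "x\<^sub>0 + \<gamma> s \<in> ball (x\<^sub>0 + \<gamma> t) (2 * \<rho>)" "x\<^sub>0 - \<gamma> s \<in> ball (x\<^sub>0 - \<gamma> t) (2 * \<rho>)"
        by (rule ball_plus_minus; use elim(2) rho in simp)+
      have y: "x + \<xi> \<in> ball (x\<^sub>0 + \<gamma> t) (2 * \<rho>) \<inter> ball (x\<^sub>0 + \<gamma> s) (2 * \<rho>)"
        "x - \<xi> \<in> ball (x\<^sub>0 - \<gamma> t) (2 * \<rho>) \<inter> ball (x\<^sub>0 - \<gamma> s) (2 * \<rho>)"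
        using ball_plus_minus[OF x] \<xi> by blast+
      have "Mh s x \<xi> = Mh t x \<xi> + \<kappa> s"
        unfolding Mh_def \<kappa>_def a_def b_def
          ball_primitive_shift[OF zeta_hol[OF ball_plus[OF t]] zeta_hol[OF ball_plus[OF elim(3)]] b(1) y(1) r2]
          ball_primitive_shift[OF zeta_hol[OF ball_minus[OF t]] zeta_hol[OF ball_minus[OF elim(3)]] b(2) y(2) r2]
        by simp
      then show "Mh s x \<xi> = Mh t x \<xi>" using elim(1) by simp
    qed
  qed
qed

text \<open>The branches at both ends have the same centre, so only the constants
  \<open>L j (x\<^sub>0, t)\<close> and \<open>M (x\<^sub>0, t)\<close> have to agree at 0 and
  1.\<close>

lemma closed: "j \<le> 3 \<Longrightarrow> Lh j 1 = Lh j 0" "Mh 1 = Mh 0"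
proof -
  note cb = closed_branches[OF contour[OF x0] U_notin[OF x0]]
  have Lc: "L j (x\<^sub>0, 1) = L j (x\<^sub>0, 0)" if "j \<le> 3" for j
    by (rule cb(2)[OF that slice_right[OF x0 L_cont[OF that]]]) (use L_exp[OF that x0] in auto)
  then show "j \<le> 3 \<Longrightarrow> Lh j 1 = Lh j 0" by (simp add: Lh_def fun_eq_iff gamma_closed)
  have "M (x\<^sub>0, 1) = M (x\<^sub>0, 0)"
    by (rule cb(3)[OF slice_right[OF x0 M_cont] _ slice_right[OF x0 L_cont[of 0]]])
      (use M_exp[OF x0] L_exp[of 0, OF _ x0] in \<open>auto simp: cosigma_0\<close>)
  then show "Mh 1 = Mh 0" by (simp add: Mh_def fun_eq_iff gamma_closed)
qed

lemma Nh_deriv: "x \<in> ball x\<^sub>0 \<rho> \<Longrightarrow> (Nh j has_field_derivative cozeta j x) (at x)"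
proof -
  have "ball x\<^sub>0 \<rho> \<subseteq> - H" using ball_U U_notin by blast
  then show "x \<in> ball x\<^sub>0 \<rho> \<Longrightarrow> (Nh j has_field_derivative cozeta j x) (at x)"
    unfolding Nh_def[abs_def] using ball_primitive(1)[OF cozeta_hol] by (auto intro!: derivative_eq_intros)
qed

lemma Nh_eq:
  assumes j: "j \<le> 3" and x: "x \<in> ball x\<^sub>0 \<rho>"
  shows "N j x = Nh j x"
proof (rule exp_eq_connected_imp_eq[of "ball x\<^sub>0 \<rho>" "N j" "Nh j" x\<^sub>0])
  have sub: "ball x\<^sub>0 \<rho> \<subseteq> - H" using ball_U U_notin by blast
  show "continuous_on (ball x\<^sub>0 \<rho>) (N j)"
    using log_sigma_x[OF j] ball_U by (auto simp: log_branch_def intro: continuous_on_subset)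
  show "continuous_on (ball x\<^sub>0 \<rho>) (Nh j)"
    by (rule DERIV_continuous_on[OF has_field_derivative_at_within[OF Nh_deriv]])
  have N: "exp (N j y) = co j y" if "y \<in> U" for y using log_sigma_x[OF j] that by (auto simp: log_branch_def)
  show "exp (N j y) = exp (Nh j y)" if y: "y \<in> ball x\<^sub>0 \<rho>" for y
    unfolding Nh_def exp_add N[OF x0] N[OF subsetD[OF ball_U y]]
    by (rule exp_ball_primitive_eq[OF cozeta_hol[OF sub] rho cosigma_deriv y, symmetric]) (use sub in auto)
  show "N j x\<^sub>0 = Nh j x\<^sub>0" using ball_primitive(2)[OF cozeta_hol[OF sub]] by (simp add: Nh_def)
qed (use x rho in auto)

text \<open>Uniform continuity gives one \<open>\<delta>\<close> for all path parameters; the half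
  radius provides a compact domain inside \<open>U\<close>.\<close>

lemma Gamma_near: "\<exists>\<delta>>0. \<delta> \<le> \<rho> \<and> (\<forall>x\<in>ball x\<^sub>0 \<delta>. \<forall>t\<in>{0..1}. \<Gamma> x t \<in> ball (\<gamma> t) \<rho>)"
proof -
  have sub: "cball x\<^sub>0 (\<rho> / 2) \<subseteq> U" using ball_U rho by (force simp: subset_iff)
  have "uniformly_continuous_on (cball x\<^sub>0 (\<rho> / 2) \<times> {0..1}) (\<lambda>(x, t). \<Gamma> x t)"
    by (intro compact_uniformly_continuous continuous_on_subset[OF contour_cont] compact_Times) (use sub in auto)
  then obtain d where d: "d > 0" "\<And>p p'. p \<in> cball x\<^sub>0 (\<rho> / 2) \<times> {0..1} \<Longrightarrow> p' \<in> cball x\<^sub>0 (\<rho> / 2) \<times> {0..1} \<Longrightarrow>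
      dist p' p < d \<Longrightarrow> dist ((\<lambda>(x, t). \<Gamma> x t) p') ((\<lambda>(x, t). \<Gamma> x t) p) < \<rho>"
    unfolding uniformly_continuous_on_def using rho by metis
  show ?thesis
  proof (intro exI[of _ "min d (\<rho> / 2)"] conjI ballI)
    fix x t assume "x \<in> ball x\<^sub>0 (min d (\<rho> / 2))" "t \<in> {0..1::real}"
    then show "\<Gamma> x t \<in> ball (\<gamma> t) \<rho>"
      using d(2)[of "(x, t)" "(x\<^sub>0, t)"] rho by (auto simp: dist_Pair_Pair)
  qed (use d rho in auto)
qed

end

subsection \<open>Differentiating the integral\<close>

lemma eventually_snd_at_within:
  fixes x :: "'a::metric_space" and t :: "'b::metric_space"
  assumes "\<forall>\<^sub>F s in at t within T. P s" "P t"
  shows "\<forall>\<^sub>F p in at (x, t) within A \<times> T. P (snd p)"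
proof -
  obtain d where d: "d > 0" "\<And>s. s \<in> T \<Longrightarrow> s \<noteq> t \<and> dist s t < d \<Longrightarrow> P s"
    using assms(1) unfolding eventually_at by blast
  have "P (snd p)" if "p \<in> A \<times> T" "dist p (x, t) < d" for p
  proof (cases "snd p = t")
    case False
    have "dist (snd p) t < d" using dist_snd_le[of p "(x, t)"] that(2) by simp
    then show ?thesis using d(2)[of "snd p"] False that(1) by (simp add: mem_Times_iff)
  qed (use assms(2) in simp)
  then show ?thesis unfolding eventually_at using d(1) by (intro exI[of _ d]) auto
qed

lemma (in heun_integral) F_germs_slice:
  assumes x0: "x\<^sub>0 \<in> U"
  shows "germ_branch rate {0..1} (\<Gamma> x\<^sub>0) (\<lambda>t. F (x\<^sub>0, t))"
  unfolding germ_branch_def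
  proof
    fix t :: real assume t: "t \<in> {0..1}"
    have "(x\<^sub>0, t) \<in> U \<times> {0..1}" using x0 t by simp
    from F_germs[unfolded germ_branch_def, rule_format, OF this]
    obtain r where "r > 0" "ode_solution rate (ball (\<Gamma> x\<^sub>0 t) r) (F (x\<^sub>0, t))"
      "\<forall>\<^sub>F p in at (x\<^sub>0, t) within U \<times> {0..1}. \<forall>\<xi>\<in>ball (\<Gamma> x\<^sub>0 t) r. F p \<xi> = F (x\<^sub>0, t) \<xi>"
      by auto
    then show "\<exists>r>0. ode_solution rate (ball (\<Gamma> x\<^sub>0 t) r) (F (x\<^sub>0, t)) \<and>
        (\<forall>\<^sub>F s in at t within {0..1}. \<forall>\<xi>\<in>ball (\<Gamma> x\<^sub>0 t) r. F (x\<^sub>0, s) \<xi> = F (x\<^sub>0, t) \<xi>)"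
      using eventually_slice_right[OF _ x0] by blast
  qed

text \<open>
  The contour \<open>\<Gamma> x\<close> is replaced by a fixed \<open>C\<^sup>1\<close> path \<open>g\<close>, so that one can differentiate under the
  integral sign.
\<close>

locale heun_integral_local = heun_integral_at +
  fixes \<delta> :: real and Fh :: "real \<Rightarrow> complex \<Rightarrow> complex" and g g' :: "real \<Rightarrow> complex"
  assumes delta: "\<delta> > 0" "\<delta> \<le> \<rho>"
    and near: "\<And>x t. x \<in> ball x\<^sub>0 \<delta> \<Longrightarrow> t \<in> {0..1} \<Longrightarrow> \<Gamma> x t \<in> ball (\<Gamma> x\<^sub>0 t) \<rho>"
    and Fh_sol: "\<And>t. t \<in> {0..1} \<Longrightarrow> ode_solution rate (ball (\<Gamma> x\<^sub>0 t) \<rho>) (Fh t)"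
    and Fh_germ: "\<And>t. t \<in> {0..1} \<Longrightarrow> \<exists>d>0. \<forall>\<xi>\<in>ball (\<Gamma> x\<^sub>0 t) d. Fh t \<xi> = F (x\<^sub>0, t) \<xi>"
    and Fh_coherent: "coherent_on {0..1} (\<Gamma> x\<^sub>0) \<rho> Fh"
    and g_valid: "valid_path g" and g_closed: "g 1 = g 0"
    and g_near: "\<And>t. t \<in> {0..1} \<Longrightarrow> g t \<in> ball (\<Gamma> x\<^sub>0 t) \<rho>"
    and g_deriv: "\<And>t. t \<in> {0..1} \<Longrightarrow> vector_derivative g (at t within {0..1}) = g' t"
    and g'_cont: "continuous_on {0..1} g'"
begin

lemma ball_delta: "x \<in> ball x\<^sub>0 \<delta> \<Longrightarrow> x \<in> ball x\<^sub>0 \<rho>" "x \<in> ball x\<^sub>0 \<delta> \<Longrightarrow> x \<in> U"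
  using delta(2) ball_U by auto

lemma Fh_hol: "t \<in> {0..1} \<Longrightarrow> Fh t holomorphic_on ball (\<gamma> t) \<rho>"
  using Fh_sol by (simp add: ode_solution_def)

text \<open>The coefficient of the equation is singular only on \<open>H\<close>, so the contraction
  of the contour in the complement of \<open>H\<close> may cross the points \<open>x\<close> and
  \<open>- x\<close> without affecting the monodromy of \<open>F\<close>.\<close>

lemma Fh_closed: "\<xi> \<in> ball (\<gamma> 0) \<rho> \<Longrightarrow> Fh 1 \<xi> = Fh 0 \<xi>"
proof -
  obtain a where "homotopic_loops (- H) \<gamma> (linepath a a)"
    using closed_branches(1)[OF contour[OF x0] U_notin[OF x0]] by blast
  moreover have "rate holomorphic_on - H"
    unfolding rate_def[abs_def] by (intro holomorphic_intros holomorphic_potential)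
  ultimately obtain d where d: "d > 0" "\<And>\<xi>. \<xi> \<in> ball (\<gamma> 0) d \<Longrightarrow> F (x\<^sub>0, 1) \<xi> = F (x\<^sub>0, 0) \<xi>"
    using monodromy[OF _ open_Compl_half_lattice _ F_germs_slice[OF x0]] by blast
  obtain d0 where d0: "d0 > 0" "\<And>\<xi>. \<xi> \<in> ball (\<gamma> 0) d0 \<Longrightarrow> Fh 0 \<xi> = F (x\<^sub>0, 0) \<xi>" using Fh_germ[of 0] by auto
  obtain d1 where d1: "d1 > 0" "\<And>\<xi>. \<xi> \<in> ball (\<gamma> 0) d1 \<Longrightarrow> Fh 1 \<xi> = F (x\<^sub>0, 1) \<xi>"
    using Fh_germ[of 1] gamma_closed by auto
  have h: "Fh 1 holomorphic_on ball (\<gamma> 0) \<rho>" "Fh 0 holomorphic_on ball (\<gamma> 0) \<rho>"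
    using Fh_hol[of 1] Fh_hol[of 0] gamma_closed by auto
  show "\<xi> \<in> ball (\<gamma> 0) \<rho> \<Longrightarrow> Fh 1 \<xi> = Fh 0 \<xi>"
    by (rule holomorphic_eq_on_ball[OF h, of "\<gamma> 0" "min d (min d0 d1)"]) (use d d0 d1 rho in auto)
qed

lemma Gamma_slice: "t \<in> {0..1} \<Longrightarrow> continuous_on (ball x\<^sub>0 \<delta>) (\<lambda>x. \<Gamma> x t)"
proof -
  assume t: "t \<in> {0..1}"
  have "ball x\<^sub>0 \<delta> \<subseteq> U" using ball_delta(2) by blast
  from slice_left[OF t this contour_cont] show ?thesis by simp
qed

text \<open>For fixed \<open>t\<close> both sides are continuous logarithms of one function of
  \<open>x\<close> on a connected ball, and they agree at its centre. \<open>M_eq\<close> follows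
  the same principle.\<close>

lemma L_eq:
  assumes j: "j \<le> 3" and t: "t \<in> {0..1}" and x: "x \<in> ball x\<^sub>0 \<delta>"
  shows "L j (x, t) = Lh j t (\<Gamma> x t)"
proof (rule exp_eq_connected_imp_eq[of "ball x\<^sub>0 \<delta>" "\<lambda>x. L j (x, t)" "\<lambda>x. Lh j t (\<Gamma> x t)" x\<^sub>0])
  show "continuous_on (ball x\<^sub>0 \<delta>) (\<lambda>x. L j (x, t))"
    by (rule slice_left[OF t _ L_cont[OF j]]) (use ball_delta in auto)
  have "continuous_on (ball (\<gamma> t) \<rho>) (Lh j t)"
    by (rule DERIV_continuous_on[OF has_field_derivative_at_within[OF Lh_deriv[OF t]]])
  then show "continuous_on (ball x\<^sub>0 \<delta>) (\<lambda>x. Lh j t (\<Gamma> x t))"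
    by (rule continuous_on_compose2[OF _ Gamma_slice[OF t]]) (use near t in auto)
  show "exp (L j (y, t)) = exp (Lh j t (\<Gamma> y t))" if "y \<in> ball x\<^sub>0 \<delta>" for y
    using L_exp[OF j ball_delta(2)[OF that] t] Lh_exp[OF j t near[OF that t]] by simp
qed (use x delta Lh_center[OF t] in auto)

lemma M_eq:
  assumes t: "t \<in> {0..1}" and x: "x \<in> ball x\<^sub>0 \<delta>"
  shows "M (x, t) = Mh t x (\<Gamma> x t)"
proof (rule exp_eq_connected_imp_eq[of "ball x\<^sub>0 \<delta>" "\<lambda>x. M (x, t)" "\<lambda>x. Mh t x (\<Gamma> x t)" x\<^sub>0])
  show "continuous_on (ball x\<^sub>0 \<delta>) (\<lambda>x. M (x, t))"
    by (rule slice_left[OF t _ M_cont]) (use ball_delta in auto)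
  have c: "continuous_on (ball (x\<^sub>0 + \<gamma> t) (2 * \<rho>)) (ball_primitive (x\<^sub>0 + \<gamma> t) (2 * \<rho>) \<zeta>)"
    "continuous_on (ball (x\<^sub>0 - \<gamma> t) (2 * \<rho>)) (ball_primitive (x\<^sub>0 - \<gamma> t) (2 * \<rho>) \<zeta>)"
    by (intro holomorphic_on_imp_continuous_on ball_primitive_holomorphic zeta_hol ball_plus ball_minus t)+
  show "continuous_on (ball x\<^sub>0 \<delta>) (\<lambda>x. Mh t x (\<Gamma> x t))"
    unfolding Mh_def
    by (intro continuous_intros continuous_on_compose2[OF c(1)] continuous_on_compose2[OF c(2)] Gamma_slice[OF t])
      (use ball_plus_minus[OF ball_delta(1) near[OF _ t]] in auto)
  show "exp (M (y, t)) = exp (Mh t y (\<Gamma> y t))" if "y \<in> ball x\<^sub>0 \<delta>" for y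
    using M_exp[OF ball_delta(2)[OF that] t] Mh_exp[OF t ball_delta(1)[OF that] near[OF that t]] by simp
qed (use x delta Mh_center[OF t] in auto)

text \<open>For fixed \<open>t\<close>, whether the germ \<open>F (x, t)\<close> agrees with
  \<open>Fh t\<close> near \<open>\<Gamma> x t\<close> is a locally constant question in
  \<open>x\<close>, and at \<open>x\<^sub>0\<close> the answer is known.\<close>

lemma F_eq:
  assumes t: "t \<in> {0..1}" and x: "x \<in> ball x\<^sub>0 \<delta>"
  shows "F (x, t) (\<Gamma> x t) = Fh t (\<Gamma> x t)"
proof -
  define G where "G x = (\<exists>d>0. \<forall>\<xi>\<in>ball (\<Gamma> x t) d. F (x, t) \<xi> = Fh t \<xi>)" for x
  have "G x\<^sub>0 = G x"
  proof (rule connected_local_const[of "ball x\<^sub>0 \<delta>"], simp, use delta in simp, rule x, intro ballI)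
    fix y assume y: "y \<in> ball x\<^sub>0 \<delta>"
    have "(y, t) \<in> U \<times> {0..1}" using ball_delta(2)[OF y] t by simp
    from F_germs[unfolded germ_branch_def, rule_format, OF this]
    obtain r where r: "r > 0" "ode_solution rate (ball (\<Gamma> y t) r) (F (y, t))"
      "\<forall>\<^sub>F p in at (y, t) within U \<times> {0..1}. \<forall>\<xi>\<in>ball (\<Gamma> y t) r. F p \<xi> = F (y, t) \<xi>"
      by auto
    have "open (ball (\<gamma> t) \<rho>)" "\<Gamma> y t \<in> ball (\<gamma> t) \<rho>" using near[OF y t] by auto
    then obtain r' where r': "r' > 0" "ball (\<Gamma> y t) r' \<subseteq> ball (\<gamma> t) \<rho>" by (rule openE)
    define s where "s = min r r'"
    have s: "s > 0" "ball (\<Gamma> y t) s \<subseteq> ball (\<Gamma> y t) r" "ball (\<Gamma> y t) s \<subseteq> ball (\<gamma> t) \<rho>"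
      using r(1) r' by (auto simp: s_def)
    have hol: "F (y, t) holomorphic_on ball (\<Gamma> y t) s" "Fh t holomorphic_on ball (\<Gamma> y t) s"
      using r(2) Fh_hol[OF t] s(2,3) by (auto simp: ode_solution_def intro: holomorphic_on_subset)
    have "\<forall>\<^sub>F z in at y within ball x\<^sub>0 \<delta>. \<forall>\<xi>\<in>ball (\<Gamma> y t) r. F (z, t) \<xi> = F (y, t) \<xi>"
      by (rule eventually_slice_left[OF r(3) t]) (use ball_delta in auto)
    moreover have "\<forall>\<^sub>F z in at y within ball x\<^sub>0 \<delta>. \<Gamma> z t \<in> ball (\<Gamma> y t) s"
      by (rule eventually_mem_ball[OF Gamma_slice[OF t] y]) (use s in simp)
    ultimately show "\<forall>\<^sub>F z in at y within ball x\<^sub>0 \<delta>. G y = G z"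
    proof eventually_elim
      case (elim z)
      \<comment> \<open>By the identity theorem, agreement near any one centre in the ball about
        \<open>\<Gamma> y t\<close> amounts to agreement on that whole ball. Applied to the centres
        of \<open>y\<close> and \<open>z\<close>, this makes \<open>G y\<close> and
        \<open>G z\<close> the same statement.\<close>
      have *: "G' \<longleftrightarrow> (\<forall>\<xi>\<in>ball (\<Gamma> y t) s. F (y, t) \<xi> = Fh t \<xi>)"
        if c: "c \<in> ball (\<Gamma> y t) s" and G': "G' = (\<exists>d>0. \<forall>\<xi>\<in>ball c d. F (z', t) \<xi> = Fh t \<xi>)"
          and z': "\<And>\<xi>. \<xi> \<in> ball (\<Gamma> y t) s \<Longrightarrow> F (z', t) \<xi> = F (y, t) \<xi>" for c z' G'
      proof
        assume G'
        then obtain d where d: "d > 0" "\<And>\<xi>. \<xi> \<in> ball c d \<Longrightarrow> F (z', t) \<xi> = Fh t \<xi>" unfolding G' by blast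
        obtain d' where d': "d' > 0" "ball c d' \<subseteq> ball (\<Gamma> y t) s" using openE[OF open_ball c] by blast
        show "\<forall>\<xi>\<in>ball (\<Gamma> y t) s. F (y, t) \<xi> = Fh t \<xi>"
        proof
          fix \<xi> assume "\<xi> \<in> ball (\<Gamma> y t) s"
          then show "F (y, t) \<xi> = Fh t \<xi>"
          proof (rule holomorphic_eq_on_ball[OF hol c, rotated 2])
            show "min d d' > 0" using d d' by simp
            fix \<eta> assume "\<eta> \<in> ball c (min d d')"
            then have "\<eta> \<in> ball c d" "\<eta> \<in> ball (\<Gamma> y t) s" using d'(2) by auto
            then show "F (y, t) \<eta> = Fh t \<eta>" using trans[OF z'[symmetric] d(2)] by blast
          qed
        qed
      next
        assume eq: "\<forall>\<xi>\<in>ball (\<Gamma> y t) s. F (y, t) \<xi> = Fh t \<xi>"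
        obtain d' where d': "d' > 0" "ball c d' \<subseteq> ball (\<Gamma> y t) s" using openE[OF open_ball c] by blast
        show G' unfolding G' using d' eq z' by (intro exI[of _ d']) (auto simp: subset_iff)
      qed
      have "G y \<longleftrightarrow> (\<forall>\<xi>\<in>ball (\<Gamma> y t) s. F (y, t) \<xi> = Fh t \<xi>)"
        by (rule *[of "\<Gamma> y t" _ y]) (use s(1) in \<open>auto simp: G_def\<close>)
      moreover have "G z \<longleftrightarrow> (\<forall>\<xi>\<in>ball (\<Gamma> y t) s. F (y, t) \<xi> = Fh t \<xi>)"
        by (rule *[of "\<Gamma> z t" _ z]) (use elim s(2) in \<open>auto simp: G_def\<close>)
      ultimately show ?case by simp
    qed
  qed
  moreover have "G x\<^sub>0" using Fh_germ[OF t] unfolding G_def by metis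
  ultimately have "G x" by simp
  then show ?thesis unfolding G_def by auto
qed

section \<open>The logarithm of the kernel and its derivatives\<close>

definition sumN :: "complex \<Rightarrow> complex" where
  "sumN x = \<alpha>\<^sub>0 * Nh 0 x - l 1 * Nh 1 x - l 2 * Nh 2 x - l 3 * Nh 3 x"

definition sumL :: "real \<Rightarrow> complex \<Rightarrow> complex" where
  "sumL t \<xi> = (l' 0 + 1) * Lh 0 t \<xi> + (l' 1 + 1) * Lh 1 t \<xi> + (l' 2 + 1) * Lh 2 t \<xi> + (l' 3 + 1) * Lh 3 t \<xi>"

text \<open>A holomorphic branch, near \<open>x\<^sub>0\<close> and \<open>\<gamma> t\<close>, of
  the logarithm of the kernel: prefactor times integrand without \<open>F\<close>.\<close>

definition lam :: "real \<Rightarrow> complex \<Rightarrow> complex \<Rightarrow> complex" where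
  "lam t x \<xi> = sumN x + sumL t \<xi> - \<eta> * Mh t x \<xi>"

text \<open>\<open>A\<close> and \<open>B\<close> are the derivatives of \<open>lam\<close> in
  \<open>x\<close> and in \<xi>, and \<open>A'\<close>, \<open>B'\<close> are their derivatives in
  the same variable. They carry no branch index, since logarithmic derivatives are
  single-valued.\<close>

definition A :: "complex \<Rightarrow> complex \<Rightarrow> complex" where
  "A x \<xi> = \<alpha>\<^sub>0 * cozeta 0 x - l 1 * cozeta 1 x - l 2 * cozeta 2 x - l 3 * cozeta 3 x - \<eta> * (\<zeta> (x + \<xi>) + \<zeta> (x - \<xi>))"

definition B :: "complex \<Rightarrow> complex \<Rightarrow> complex" where
  "B x \<xi> = (l' 0 + 1) * cozeta 0 \<xi> + (l' 1 + 1) * cozeta 1 \<xi> + (l' 2 + 1) * cozeta 2 \<xi> + (l' 3 + 1) * cozeta 3 \<xi>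
    - \<eta> * (\<zeta> (x + \<xi>) - \<zeta> (x - \<xi>))"

definition A' :: "complex \<Rightarrow> complex \<Rightarrow> complex" where
  "A' x \<xi> = (- \<alpha>\<^sub>0 * \<P> (x + \<omega> 0) + l 1 * \<P> (x + \<omega> 1) + l 2 * \<P> (x + \<omega> 2) + l 3 * \<P> (x + \<omega> 3))
    + \<eta> * (\<P> (x + \<xi>) + \<P> (x - \<xi>))"

definition B' :: "complex \<Rightarrow> complex \<Rightarrow> complex" where
  "B' x \<xi> = - ((l' 0 + 1) * \<P> (\<xi> + \<omega> 0) + (l' 1 + 1) * \<P> (\<xi> + \<omega> 1) + (l' 2 + 1) * \<P> (\<xi> + \<omega> 2) + (l' 3 + 1) * \<P> (\<xi> + \<omega> 3))
    + \<eta> * (\<P> (x + \<xi>) + \<P> (x - \<xi>))"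

text \<open>This restores the term common to \<open>A'\<close> and \<open>B'\<close> that
  \<open>kernel_identity\<close> leaves out. In this form it is the equality of the two operators on
  the kernel, divided by minus the kernel.\<close>

lemma kernel:
  assumes "t \<in> {0..1}" "x \<in> ball x\<^sub>0 \<rho>" "\<xi> \<in> ball (\<gamma> t) \<rho>"
  shows "(A x \<xi>)\<^sup>2 + A' x \<xi> - potential l x = (B x \<xi>)\<^sup>2 + B' x \<xi> - potential l' \<xi>"
proof -
  have "a + p - v = b - q - v' \<Longrightarrow> a + (p + k) - v = b + (- q + k) - v'" for a p v b q v' k :: complex
    by (simp add: algebra_simps)
  from this[OF kernel_identity[OF alpha l' eta notin[OF assms]]] show ?thesis
    unfolding A_def B_def A'_def B'_def .
qed

lemma lam_deriv:
  assumes "t \<in> {0..1}" "x \<in> ball x\<^sub>0 \<rho>" "\<xi> \<in> ball (\<gamma> t) \<rho>"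
  shows "((\<lambda>x. lam t x \<xi>) has_field_derivative A x \<xi>) (at x)"
    and "(lam t x has_field_derivative B x \<xi>) (at \<xi>)"
  unfolding lam_def[abs_def] sumN_def sumL_def A_def B_def
  by (rule derivative_eq_intros Nh_deriv Lh_deriv Mh_deriv assms refl | simp add: algebra_simps)+

lemma zeta_shift_derivs:
  assumes "t \<in> {0..1}" "x \<in> ball x\<^sub>0 \<rho>" "\<xi> \<in> ball (\<gamma> t) \<rho>"
  shows "((\<lambda>x. \<zeta> (x + \<xi>)) has_field_derivative - \<P> (x + \<xi>)) (at x)"
    "((\<lambda>x. \<zeta> (x - \<xi>)) has_field_derivative - \<P> (x - \<xi>)) (at x)"
    "((\<lambda>\<xi>. \<zeta> (x + \<xi>)) has_field_derivative - \<P> (x + \<xi>)) (at \<xi>)"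
    "((\<lambda>\<xi>. \<zeta> (x - \<xi>)) has_field_derivative \<P> (x - \<xi>)) (at \<xi>)"
proof -
  note n = notin(3,4)[OF assms]
  have "((\<lambda>x. \<zeta> (x + \<xi>)) has_field_derivative - \<P> (x + \<xi>) * 1) (at x)"
    by (rule DERIV_chain2[where g = "\<lambda>x. x + \<xi>" and x = x, OF zeta_deriv[OF n(1)]]) (auto intro!: derivative_eq_intros)
  moreover have "((\<lambda>x. \<zeta> (x - \<xi>)) has_field_derivative - \<P> (x - \<xi>) * 1) (at x)"
    by (rule DERIV_chain2[where g = "\<lambda>x. x - \<xi>" and x = x, OF zeta_deriv[OF n(2)]]) (auto intro!: derivative_eq_intros)
  moreover have "((\<lambda>\<xi>. \<zeta> (x + \<xi>)) has_field_derivative - \<P> (x + \<xi>) * 1) (at \<xi>)"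
    by (rule DERIV_chain2[where g = "\<lambda>\<xi>. x + \<xi>" and x = \<xi>, OF zeta_deriv[OF n(1)]]) (auto intro!: derivative_eq_intros)
  moreover have "((\<lambda>\<xi>. \<zeta> (x - \<xi>)) has_field_derivative - \<P> (x - \<xi>) * (- 1)) (at \<xi>)"
    by (rule DERIV_chain2[where g = "\<lambda>\<xi>. x - \<xi>" and x = \<xi>, OF zeta_deriv[OF n(2)]]) (auto intro!: derivative_eq_intros)
  ultimately show "((\<lambda>x. \<zeta> (x + \<xi>)) has_field_derivative - \<P> (x + \<xi>)) (at x)"
    "((\<lambda>x. \<zeta> (x - \<xi>)) has_field_derivative - \<P> (x - \<xi>)) (at x)"
    "((\<lambda>\<xi>. \<zeta> (x + \<xi>)) has_field_derivative - \<P> (x + \<xi>)) (at \<xi>)"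
    "((\<lambda>\<xi>. \<zeta> (x - \<xi>)) has_field_derivative \<P> (x - \<xi>)) (at \<xi>)"
    by simp_all
qed

lemma A_deriv:
  assumes "t \<in> {0..1}" "x \<in> ball x\<^sub>0 \<rho>" "\<xi> \<in> ball (\<gamma> t) \<rho>"
  shows "((\<lambda>x. A x \<xi>) has_field_derivative A' x \<xi>) (at x)"
    and "(B x has_field_derivative B' x \<xi>) (at \<xi>)"
  unfolding A_def[abs_def] B_def[abs_def] A'_def B'_def
  by (rule derivative_eq_intros cozeta_deriv zeta_shift_derivs assms notin(1,2)[OF assms] refl | simp add: algebra_simps)+

lemma lam_coherent:
  assumes t: "t \<in> {0..1}"
  shows "\<forall>\<^sub>F s in at t within {0..1}. \<forall>x\<in>ball x\<^sub>0 \<rho>. \<forall>\<xi>\<in>ball (\<gamma> t) \<rho> \<inter> ball (\<gamma> s) \<rho>. lam s x \<xi> = lam t x \<xi> \<and> Fh s \<xi> = Fh t \<xi>"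
proof -
  have L: "\<forall>\<^sub>F s in at t within {0..1}. \<forall>\<xi>\<in>ball (\<gamma> t) \<rho> \<inter> ball (\<gamma> s) \<rho>. Lh j s \<xi> = Lh j t \<xi>" if "j \<le> 3" for j
    using Lh_coherent[OF that] t by (simp add: coherent_on_def)
  have Fc: "\<forall>\<^sub>F s in at t within {0..1}. \<forall>\<xi>\<in>ball (\<gamma> t) \<rho> \<inter> ball (\<gamma> s) \<rho>. Fh s \<xi> = Fh t \<xi>"
    using Fh_coherent t by (simp add: coherent_on_def)
  have "(0::nat) \<le> 3" "(1::nat) \<le> 3" "(2::nat) \<le> 3" "(3::nat) \<le> 3" by simp_all
  note Ls = this[THEN L]
  show ?thesis
    using Mh_coherent[OF t] Ls Fc by eventually_elim (simp add: lam_def sumL_def)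
qed

lemma lam_closed: "lam 1 x \<xi> = lam 0 x \<xi>"
  using closed by (simp add: lam_def sumL_def)

lemma joint_continuity:
  fixes G :: "real \<Rightarrow> complex \<Rightarrow> complex \<Rightarrow> complex"
  assumes coh: "\<And>t. t \<in> {0..1} \<Longrightarrow>
      \<forall>\<^sub>F s in at t within {0..1}. \<forall>x\<in>ball x\<^sub>0 \<rho>. \<forall>\<xi>\<in>ball (\<gamma> t) \<rho> \<inter> ball (\<gamma> s) \<rho>. G s x \<xi> = G t x \<xi>"
    and cont: "\<And>t. t \<in> {0..1} \<Longrightarrow> continuous_on (ball x\<^sub>0 \<rho> \<times> ball (\<gamma> t) \<rho>) (\<lambda>(x, \<xi>). G t x \<xi>)"
  shows "continuous_on (ball x\<^sub>0 \<delta> \<times> {0..1}) (\<lambda>(x, t). G t x (g t) * g' t)"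
proof -
  have gc: "continuous_on {0..1} g" using valid_path_imp_path[OF g_valid] by (simp add: path_def)
  have "continuous_on (ball x\<^sub>0 \<delta> \<times> {0..1}) (\<lambda>p. G (snd p) (fst p) (g (snd p)))"
  proof (rule continuous_on_locally_eq)
    fix p assume p: "p \<in> ball x\<^sub>0 \<delta> \<times> {0..1::real}"
    obtain y t where yt: "p = (y, t)" "y \<in> ball x\<^sub>0 \<delta>" "t \<in> {0..1}" using p by (cases p) auto
    define h where "h q = (\<lambda>(x, \<xi>). G t x \<xi>) (fst q, g (snd q))" for q
    have "h p = G (snd p) (fst p) (g (snd p))" by (simp add: h_def yt)
    moreover have "continuous (at p within ball x\<^sub>0 \<delta> \<times> {0..1}) h"
      unfolding h_def
    proof (rule continuous_within_compose3[where g = "\<lambda>(x, \<xi>). G t x \<xi>"])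
      have "open (ball x\<^sub>0 \<rho> \<times> ball (\<gamma> t) \<rho>)" by (intro open_Times open_ball)
      moreover have "(fst p, g (snd p)) \<in> ball x\<^sub>0 \<rho> \<times> ball (\<gamma> t) \<rho>"
        using yt ball_delta(1)[OF yt(2)] g_near[OF yt(3)] by simp
      ultimately show "isCont (\<lambda>(x, \<xi>). G t x \<xi>) (fst p, g (snd p))"
        using cont[OF yt(3)] continuous_on_eq_continuous_at by blast
      have "continuous_on (ball x\<^sub>0 \<delta> \<times> {0..1}) (\<lambda>q. (fst q, g (snd q)))"
        by (intro continuous_intros continuous_on_compose2[OF gc]) auto
      then show "continuous (at p within ball x\<^sub>0 \<delta> \<times> {0..1}) (\<lambda>q. (fst q, g (snd q)))"
        using p unfolding continuous_on_eq_continuous_within by blast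
    qed
    moreover have "\<forall>\<^sub>F q in at p within ball x\<^sub>0 \<delta> \<times> {0..1}. G (snd q) (fst q) (g (snd q)) = h q"
    proof -
      have "\<forall>\<^sub>F s in at t within {0..1}. \<forall>x\<in>ball x\<^sub>0 \<rho>. G s x (g s) = G t x (g s)"
        using coh[OF yt(3)] eventually_mem_ball[OF gc yt(3) g_near[OF yt(3)]] eventually_mem_at_within[of "{0..1}" t]
        by eventually_elim (use g_near in auto)
      then have "\<forall>\<^sub>F q in at (y, t) within ball x\<^sub>0 \<delta> \<times> {0..1}. \<forall>x\<in>ball x\<^sub>0 \<rho>. G (snd q) x (g (snd q)) = G t x (g (snd q))"
        by (rule eventually_snd_at_within) simp
      then show ?thesis
        using eventually_mem_at_within[of "ball x\<^sub>0 \<delta> \<times> {0..1}" p] unfolding yt(1)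
        by eventually_elim (use ball_delta(1) in \<open>auto simp: h_def\<close>)
    qed
    ultimately show "\<exists>h. h p = G (snd p) (fst p) (g (snd p)) \<and> continuous (at p within ball x\<^sub>0 \<delta> \<times> {0..1}) h \<and>
        (\<forall>\<^sub>F q in at p within ball x\<^sub>0 \<delta> \<times> {0..1}. G (snd q) (fst q) (g (snd q)) = h q)" by blast
  qed
  then have "continuous_on (ball x\<^sub>0 \<delta> \<times> {0..1}) (\<lambda>p. G (snd p) (fst p) (g (snd p)) * g' (snd p))"
    by (intro continuous_on_mult continuous_on_compose2[OF g'_cont] continuous_intros) auto
  then show ?thesis by (simp add: case_prod_unfold)
qed

text \<open>The prefactor sits inside the exponential, so that \<open>f\<close> becomes a single
  integral of \<open>W\<close>.\<close>

definition W :: "real \<Rightarrow> complex \<Rightarrow> complex \<Rightarrow> complex" where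
  "W t x \<xi> = Fh t \<xi> * exp (lam t x \<xi>)"

lemma continuous_parts:
  assumes t: "t \<in> {0..1}"
  defines "D \<equiv> ball x\<^sub>0 \<rho> \<times> ball (\<gamma> t) \<rho>"
  shows "continuous_on D (\<lambda>p. W t (fst p) (snd p))" "continuous_on D (\<lambda>p. A (fst p) (snd p))"
    "continuous_on D (\<lambda>p. A' (fst p) (snd p))"
proof -
  have D: "fst p \<notin> H" "snd p \<notin> H" "fst p + snd p \<notin> \<Lambda>" "fst p - snd p \<notin> \<Lambda>" if "p \<in> D" for p
    using notin[OF t, of "fst p" "snd p"] that by (auto simp: D_def)
  have Pc: "continuous_on (- \<Lambda>) \<P>" by (rule holomorphic_on_imp_continuous_on[OF holomorphic_p])
  have Zc: "continuous_on (- \<Lambda>) \<zeta>" by (rule holomorphic_on_imp_continuous_on[OF zeta_hol]) simp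
  have Cc: "continuous_on (- H) (cozeta j)" for j by (rule holomorphic_on_imp_continuous_on[OF cozeta_hol]) simp
  show "continuous_on D (\<lambda>p. A (fst p) (snd p))"
    unfolding A_def
    by (intro continuous_intros continuous_on_compose2[OF Zc] continuous_on_compose2[OF Cc]) (use D in auto)
  show "continuous_on D (\<lambda>p. A' (fst p) (snd p))"
    unfolding A'_def
    by (intro continuous_intros continuous_on_compose2[OF Pc]) (use D notin_half_lattice(2) in auto)
  have Nc: "continuous_on (ball x\<^sub>0 \<rho>) (Nh j)" for j
    by (rule DERIV_continuous_on[OF has_field_derivative_at_within[OF Nh_deriv]])
  have Lc: "continuous_on (ball (\<gamma> t) \<rho>) (Lh j t)" for j
    by (rule DERIV_continuous_on[OF has_field_derivative_at_within[OF Lh_deriv[OF t]]])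
  have Fc: "continuous_on (ball (\<gamma> t) \<rho>) (Fh t)" by (rule holomorphic_on_imp_continuous_on[OF Fh_hol[OF t]])
  have c: "continuous_on (ball (x\<^sub>0 + \<gamma> t) (2 * \<rho>)) (ball_primitive (x\<^sub>0 + \<gamma> t) (2 * \<rho>) \<zeta>)"
    "continuous_on (ball (x\<^sub>0 - \<gamma> t) (2 * \<rho>)) (ball_primitive (x\<^sub>0 - \<gamma> t) (2 * \<rho>) \<zeta>)"
    by (intro holomorphic_on_imp_continuous_on ball_primitive_holomorphic zeta_hol ball_plus ball_minus t)+
  have b: "(\<lambda>p. fst p + snd p) ` D \<subseteq> ball (x\<^sub>0 + \<gamma> t) (2 * \<rho>)" "(\<lambda>p. fst p - snd p) ` D \<subseteq> ball (x\<^sub>0 - \<gamma> t) (2 * \<rho>)"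
    "fst ` D \<subseteq> ball x\<^sub>0 \<rho>" "snd ` D \<subseteq> ball (\<gamma> t) \<rho>"
    using ball_plus_minus unfolding D_def by force+
  show "continuous_on D (\<lambda>p. W t (fst p) (snd p))"
    unfolding W_def lam_def sumN_def sumL_def Mh_def
    by (intro continuous_intros continuous_on_compose2[OF Nc] continuous_on_compose2[OF Lc] continuous_on_compose2[OF Fc]
        continuous_on_compose2[OF c(1)] continuous_on_compose2[OF c(2)] b)
qed

lemma W_coherent:
  assumes "t \<in> {0..1}"
  shows "\<forall>\<^sub>F s in at t within {0..1}. \<forall>x\<in>ball x\<^sub>0 \<rho>. \<forall>\<xi>\<in>ball (\<gamma> t) \<rho> \<inter> ball (\<gamma> s) \<rho>. W s x \<xi> = W t x \<xi>"
  using lam_coherent[OF assms] by eventually_elim (simp add: W_def)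

lemma W_deriv_x:
  assumes "t \<in> {0..1}" "x \<in> ball x\<^sub>0 \<rho>" "\<xi> \<in> ball (\<gamma> t) \<rho>"
  shows "((\<lambda>x. W t x \<xi>) has_field_derivative W t x \<xi> * A x \<xi>) (at x)"
    and "((\<lambda>x. W t x \<xi> * A x \<xi>) has_field_derivative W t x \<xi> * ((A x \<xi>)\<^sup>2 + A' x \<xi>)) (at x)"
proof -
  show 1: "((\<lambda>x. W t x \<xi>) has_field_derivative W t x \<xi> * A x \<xi>) (at x)"
    unfolding W_def using lam_deriv(1)[OF assms] by (auto intro!: derivative_eq_intros)
  show "((\<lambda>x. W t x \<xi> * A x \<xi>) has_field_derivative W t x \<xi> * ((A x \<xi>)\<^sup>2 + A' x \<xi>)) (at x)"
    using DERIV_mult[OF 1 A_deriv(1)[OF assms]] by (simp add: algebra_simps power2_eq_square)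
qed

section \<open>The differential equation at one point\<close>

text \<open>Along \<open>\<Gamma> x\<close> the local branches coincide with the given ones. Both
  \<open>\<Gamma> x\<close> and \<open>g\<close> follow \<open>\<gamma>\<close> within distance
  \<open>\<rho>\<close>, so the contour can be deformed to \<open>g\<close>. Integrability along
  \<open>g\<close> is continuity; along \<open>\<Gamma> x\<close> it comes from adding the
  integrable difference.\<close>

lemma f_eq:
  assumes x: "x \<in> ball x\<^sub>0 \<delta>"
  shows "f x = integral {0..1} (\<lambda>t. W t x (g t) * g' t)"
proof -
  note xr = ball_delta(1)[OF x] and xU = ball_delta(2)[OF x]
  have "continuous_on (ball x\<^sub>0 \<delta> \<times> {0..1}) (\<lambda>(x, t). W t x (g t) * g' t)"
    by (rule joint_continuity[OF W_coherent]) (use continuous_parts(1) in \<open>auto simp: case_prod_unfold\<close>)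
  then have "continuous_on {0..1} (\<lambda>t. (\<lambda>(x, t). W t x (g t) * g' t) (x, t))"
    by (rule continuous_on_compose2) (use x in \<open>auto intro!: continuous_intros\<close>)
  then have "(\<lambda>t. W t x (g t) * g' t) integrable_on {0..1}"
    using integrable_continuous_real by simp
  then have I: "((\<lambda>t. W t x (g t) * g' t) has_integral integral {0..1} (\<lambda>t. W t x (g t) * g' t)) {0..1}"
    by (rule integrable_integral)
  have "((\<lambda>t. W t x (\<Gamma> x t) * vector_derivative (\<Gamma> x) (at t within {0..1}) -
      W t x (g t) * vector_derivative g (at t within {0..1})) has_integral 0) {0..1}"
  proof (rule coherent_deformation_integral[where c = \<gamma> and \<rho> = \<rho>])
    show "W t x holomorphic_on ball (\<gamma> t) \<rho>" if t: "t \<in> {0..1}" for t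
    proof -
      have "lam t x holomorphic_on ball (\<gamma> t) \<rho>"
        unfolding holomorphic_on_open[OF open_ball] using lam_deriv(2)[OF t xr] by blast
      then show ?thesis unfolding W_def[abs_def] by (intro holomorphic_intros Fh_hol t)
    qed
    show "coherent_on {0..1} \<gamma> \<rho> (\<lambda>t. W t x)"
      unfolding coherent_on_def
    proof
      fix t :: real assume "t \<in> {0..1}"
      from W_coherent[OF this] show "\<forall>\<^sub>F s in at t within {0..1}. \<forall>\<xi>\<in>ball (\<gamma> t) \<rho> \<inter> ball (\<gamma> s) \<rho>. W s x \<xi> = W t x \<xi>"
        by eventually_elim (use xr in auto)
    qed
  qed (use gamma_closed Fh_closed lam_closed Gamma_valid[OF xU] Gamma_closed[OF xU] near[OF x] g_valid g_near g_closed in \<open>auto simp: W_def\<close>)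
  moreover have "((\<lambda>t. W t x (g t) * vector_derivative g (at t within {0..1})) has_integral integral {0..1} (\<lambda>t. W t x (g t) * g' t)) {0..1}"
    using I by (rule has_integral_eq[rotated]) (simp add: g_deriv)
  ultimately have "((\<lambda>t. (W t x (\<Gamma> x t) * vector_derivative (\<Gamma> x) (at t within {0..1}) -
      W t x (g t) * vector_derivative g (at t within {0..1})) + W t x (g t) * vector_derivative g (at t within {0..1}))
      has_integral 0 + integral {0..1} (\<lambda>t. W t x (g t) * g' t)) {0..1}"
    by (rule has_integral_add)
  then have "((\<lambda>t. W t x (\<Gamma> x t) * vector_derivative (\<Gamma> x) (at t within {0..1})) has_integral integral {0..1} (\<lambda>t. W t x (g t) * g' t)) {0..1}"
    by simp
  then have int: "integral {0..1} (\<lambda>t. W t x (\<Gamma> x t) * vector_derivative (\<Gamma> x) (at t within {0..1})) = integral {0..1} (\<lambda>t. W t x (g t) * g' t)"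
    by (rule integral_unique)
  have N: "exp (\<alpha>\<^sub>0 * N 0 x) * exp (- l 1 * N 1 x) * exp (- l 2 * N 2 x) * exp (- l 3 * N 3 x) = exp (sumN x)"
    unfolding sumN_def using Nh_eq[OF _ xr] by (simp add: exp_add[symmetric])
  have "f x = exp (sumN x) * integral {0..1} (\<lambda>t. (F (x, t) (\<Gamma> x t) *
                   exp ((l' 0 + 1) * L 0 (x, t)) * exp ((l' 1 + 1) * L 1 (x, t)) *
                   exp ((l' 2 + 1) * L 2 (x, t)) * exp ((l' 3 + 1) * L 3 (x, t)) *
                   exp (- \<eta> * M (x, t))) * vector_derivative (\<Gamma> x) (at t within {0..1}))"
    unfolding f[OF xU] N branch_integral_def ..
  also have "\<dots> = integral {0..1} (\<lambda>t. exp (sumN x) * ((F (x, t) (\<Gamma> x t) *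
                   exp ((l' 0 + 1) * L 0 (x, t)) * exp ((l' 1 + 1) * L 1 (x, t)) *
                   exp ((l' 2 + 1) * L 2 (x, t)) * exp ((l' 3 + 1) * L 3 (x, t)) *
                   exp (- \<eta> * M (x, t))) * vector_derivative (\<Gamma> x) (at t within {0..1})))"
    by (rule integral_mult_right[symmetric])
  also have "\<dots> = integral {0..1} (\<lambda>t. W t x (\<Gamma> x t) * vector_derivative (\<Gamma> x) (at t within {0..1}))"
  proof (rule integral_cong)
    fix t :: real assume t: "t \<in> {0..1}"
    have "exp (sumN x) * (u * exp (a 0) * exp (a 1) * exp (a 2) * exp (a 3) * exp b * v)
        = u * exp (sumN x + (a 0 + a 1 + a 2 + a 3) + b) * v" for u b v and a :: "nat \<Rightarrow> complex"
      by (simp add: exp_add mult_ac)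
    from this[of "F (x, t) (\<Gamma> x t)" "\<lambda>j. (l' j + 1) * L j (x, t)" "- \<eta> * M (x, t)" "vector_derivative (\<Gamma> x) (at t within {0..1})"]
    show "exp (sumN x) * ((F (x, t) (\<Gamma> x t) *
                   exp ((l' 0 + 1) * L 0 (x, t)) * exp ((l' 1 + 1) * L 1 (x, t)) *
                   exp ((l' 2 + 1) * L 2 (x, t)) * exp ((l' 3 + 1) * L 3 (x, t)) *
                   exp (- \<eta> * M (x, t))) * vector_derivative (\<Gamma> x) (at t within {0..1}))
        = W t x (\<Gamma> x t) * vector_derivative (\<Gamma> x) (at t within {0..1})"
      unfolding W_def lam_def sumL_def F_eq[OF t x, symmetric] M_eq[OF t x, symmetric]
      using L_eq[OF _ t x] by simp
  qed
  also note int
  finally show ?thesis .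
qed

text \<open>Two differentiations under the integral give \<open>f''\<close> as the integral of
  \<open>\<phi>2\<close>. The combination \<open>\<phi>2 - (V - E) * \<phi>\<close> is minus the
  derivative of \<open>R\<close> along \<open>g\<close>, and that integral vanishes.\<close>

lemma heun_at:
  "f field_differentiable at x\<^sub>0 \<and> heun_operator \<omega>\<^sub>1 \<omega>\<^sub>3 l f x\<^sub>0 = E * f x\<^sub>0"
proof -
  define \<phi> where "\<phi> x t = W t x (g t) * g' t" for x t
  define \<phi>1 where "\<phi>1 x t = (W t x (g t) * A x (g t)) * g' t" for x t
  define \<phi>2 where "\<phi>2 x t = (W t x (g t) * ((A x (g t))\<^sup>2 + A' x (g t))) * g' t" for x t
  have cont: "continuous_on (ball x\<^sub>0 \<delta> \<times> {0..1}) (\<lambda>(x, t). \<phi> x t)"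
    "continuous_on (ball x\<^sub>0 \<delta> \<times> {0..1}) (\<lambda>(x, t). \<phi>1 x t)"
    "continuous_on (ball x\<^sub>0 \<delta> \<times> {0..1}) (\<lambda>(x, t). \<phi>2 x t)"
  proof -
    have WA: "\<forall>\<^sub>F s in at t within {0..1}. \<forall>x\<in>ball x\<^sub>0 \<rho>. \<forall>\<xi>\<in>ball (\<gamma> t) \<rho> \<inter> ball (\<gamma> s) \<rho>. W s x \<xi> * K x \<xi> = W t x \<xi> * K x \<xi>"
      if "t \<in> {0..1}" for t K
      using W_coherent[OF that] by eventually_elim auto
    show "continuous_on (ball x\<^sub>0 \<delta> \<times> {0..1}) (\<lambda>(x, t). \<phi> x t)"
      unfolding \<phi>_def by (rule joint_continuity[OF W_coherent]) (use continuous_parts(1) in \<open>auto simp: case_prod_unfold\<close>)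
    show "continuous_on (ball x\<^sub>0 \<delta> \<times> {0..1}) (\<lambda>(x, t). \<phi>1 x t)"
      unfolding \<phi>1_def
      by (rule joint_continuity[OF WA]) (use continuous_parts(1,2) in \<open>auto simp: case_prod_unfold intro: continuous_on_mult\<close>)
    show "continuous_on (ball x\<^sub>0 \<delta> \<times> {0..1}) (\<lambda>(x, t). \<phi>2 x t)"
      unfolding \<phi>2_def
      by (rule joint_continuity[OF WA])
        (use continuous_parts in \<open>auto simp: case_prod_unfold intro!: continuous_on_mult continuous_on_add continuous_on_power\<close>)
  qed
  have d0: "((\<lambda>x. integral {0..1} (\<phi> x)) has_field_derivative integral {0..1} (\<phi>1 x)) (at x)" if "x \<in> ball x\<^sub>0 \<delta>" for x
  proof (rule leibniz_ball[OF _ cont(1,2) that])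
    fix y t assume "y \<in> ball x\<^sub>0 \<delta>" "t \<in> {0..1::real}"
    then show "((\<lambda>x. \<phi> x t) has_field_derivative \<phi>1 y t) (at y)"
      unfolding \<phi>_def \<phi>1_def by (intro DERIV_cmult_right W_deriv_x(1) ball_delta g_near)
  qed
  have d1: "((\<lambda>x. integral {0..1} (\<phi>1 x)) has_field_derivative integral {0..1} (\<phi>2 x)) (at x)" if "x \<in> ball x\<^sub>0 \<delta>" for x
  proof (rule leibniz_ball[OF _ cont(2,3) that])
    fix y t assume "y \<in> ball x\<^sub>0 \<delta>" "t \<in> {0..1::real}"
    then show "((\<lambda>x. \<phi>1 x t) has_field_derivative \<phi>2 y t) (at y)"
      unfolding \<phi>1_def \<phi>2_def by (intro DERIV_cmult_right W_deriv_x(2) ball_delta g_near)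
  qed
  have fi: "integral {0..1} (\<phi> x) = f x" if "x \<in> ball x\<^sub>0 \<delta>" for x
    using f_eq[OF that] by (simp add: \<phi>_def[abs_def])
  have f1: "(f has_field_derivative integral {0..1} (\<phi>1 x)) (at x)" if "x \<in> ball x\<^sub>0 \<delta>" for x
    by (rule has_field_derivative_transform_within_open[OF d0[OF that] open_ball that fi])
  have x0\<delta>: "x\<^sub>0 \<in> ball x\<^sub>0 \<delta>" and x0\<rho>: "x\<^sub>0 \<in> ball x\<^sub>0 \<rho>" using delta rho by auto
  have "(deriv f has_field_derivative integral {0..1} (\<phi>2 x\<^sub>0)) (at x\<^sub>0)"
    by (rule has_field_derivative_transform_within_open[OF d1[OF x0\<delta>] open_ball x0\<delta>]) (use f1 DERIV_imp_deriv in metis)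
  then have f2: "(deriv ^^ 2) f x\<^sub>0 = integral {0..1} (\<phi>2 x\<^sub>0)" by (simp add: numeral_2_eq_2 DERIV_imp_deriv)
  \<comment> \<open>With kernel \<open>K\<close>, this is the Wronskian of \<open>K\<close> and
    \<open>Fh t\<close> in \<xi>. In its derivative the mixed terms cancel, the equation replaces
    the second derivative of \<open>Fh t\<close>, and \<open>kernel\<close> moves what remains to
    the variable \<open>x\<close>.\<close>
  define R where "R t \<xi> = (deriv (Fh t) \<xi> - Fh t \<xi> * B x\<^sub>0 \<xi>) * exp (lam t x\<^sub>0 \<xi>)" for t \<xi>
  define V where "V = potential l x\<^sub>0"
  have R': "(R t has_field_derivative - (W t x\<^sub>0 \<xi> * ((A x\<^sub>0 \<xi>)\<^sup>2 + A' x\<^sub>0 \<xi> - V + E))) (at \<xi>)"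
    if t: "t \<in> {0..1}" and \<xi>: "\<xi> \<in> ball (\<gamma> t) \<rho>" for t \<xi>
  proof -
    have F1: "(Fh t has_field_derivative deriv (Fh t) \<xi>) (at \<xi>)"
      by (rule holomorphic_derivI[OF Fh_hol[OF t] open_ball \<xi>])
    have "(deriv (Fh t) has_field_derivative deriv (deriv (Fh t)) \<xi>) (at \<xi>)"
      by (rule holomorphic_derivI[OF holomorphic_deriv[OF Fh_hol[OF t] open_ball] open_ball \<xi>])
    moreover have "deriv (deriv (Fh t)) \<xi> = (potential l' \<xi> - E) * Fh t \<xi>"
      using Fh_sol[OF t] \<xi> by (simp add: ode_solution_def numeral_2_eq_2 rate_def)
    ultimately have F2: "(deriv (Fh t) has_field_derivative (potential l' \<xi> - E) * Fh t \<xi>) (at \<xi>)" by simp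
    note Bd = A_deriv(2)[OF t x0\<rho> \<xi>] and ld = lam_deriv(2)[OF t x0\<rho> \<xi>]
    have "(R t has_field_derivative
        ((potential l' \<xi> - E) * Fh t \<xi> - (deriv (Fh t) \<xi> * B x\<^sub>0 \<xi> + B' x\<^sub>0 \<xi> * Fh t \<xi>)) * exp (lam t x\<^sub>0 \<xi>)
        + exp (lam t x\<^sub>0 \<xi>) * B x\<^sub>0 \<xi> * (deriv (Fh t) \<xi> - Fh t \<xi> * B x\<^sub>0 \<xi>)) (at \<xi>)"
      unfolding R_def[abs_def]
      by (intro DERIV_mult DERIV_diff F1 F2 Bd DERIV_chain2[OF DERIV_exp ld])
    moreover have "((potential l' \<xi> - E) * Fh t \<xi> - (deriv (Fh t) \<xi> * B x\<^sub>0 \<xi> + B' x\<^sub>0 \<xi> * Fh t \<xi>)) * exp (lam t x\<^sub>0 \<xi>)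
        + exp (lam t x\<^sub>0 \<xi>) * B x\<^sub>0 \<xi> * (deriv (Fh t) \<xi> - Fh t \<xi> * B x\<^sub>0 \<xi>)
        = - (W t x\<^sub>0 \<xi> * ((A x\<^sub>0 \<xi>)\<^sup>2 + A' x\<^sub>0 \<xi> - V + E))"
      unfolding V_def kernel[OF t x0\<rho> \<xi>] W_def by (simp add: algebra_simps power2_eq_square)
    ultimately show ?thesis by simp
  qed
  have Rint: "((\<lambda>t. deriv (R t) (g t) * vector_derivative g (at t within {0..1})) has_integral 0) {0..1}"
  proof (rule coherent_total_derivative_integral[where c = \<gamma> and \<rho> = \<rho>])
    show "R t holomorphic_on ball (\<gamma> t) \<rho>" if "t \<in> {0..1}" for t
      unfolding holomorphic_on_open[OF open_ball] using R'[OF that] by blast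
    show "coherent_on {0..1} \<gamma> \<rho> R"
      unfolding coherent_on_def
    proof
      fix t :: real assume t: "t \<in> {0..1}"
      from lam_coherent[OF t] show "\<forall>\<^sub>F s in at t within {0..1}. \<forall>\<xi>\<in>ball (\<gamma> t) \<rho> \<inter> ball (\<gamma> s) \<rho>. R s \<xi> = R t \<xi>"
      proof eventually_elim
        case (elim s)
        show ?case
        proof
          fix \<xi> assume \<xi>: "\<xi> \<in> ball (\<gamma> t) \<rho> \<inter> ball (\<gamma> s) \<rho>"
          have "deriv (Fh s) \<xi> = deriv (Fh t) \<xi>"
          proof (rule deriv_cong_ev)
            have "open (ball (\<gamma> t) \<rho> \<inter> ball (\<gamma> s) \<rho>)" by (intro open_Int open_ball)
            from eventually_nhds_in_open[OF this \<xi>] show "\<forall>\<^sub>F x in nhds \<xi>. Fh s x = Fh t x"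
              by eventually_elim (use elim x0\<rho> in blast)
          qed simp
          moreover have "lam s x\<^sub>0 \<xi> = lam t x\<^sub>0 \<xi>" "Fh s \<xi> = Fh t \<xi>" using elim x0\<rho> \<xi> by blast+
          ultimately show "R s \<xi> = R t \<xi>" by (simp add: R_def)
        qed
      qed
    qed
    show "R 1 (g 1) = R 0 (g 0)"
    proof -
      have g0: "g 0 \<in> ball (\<gamma> 0) \<rho>" using g_near[of 0] by simp
      have "deriv (Fh 1) (g 0) = deriv (Fh 0) (g 0)"
      proof (rule deriv_cong_ev)
        from eventually_nhds_in_open[OF open_ball g0] show "\<forall>\<^sub>F x in nhds (g 0). Fh 1 x = Fh 0 x"
          by eventually_elim (rule Fh_closed)
      qed simp
      then show ?thesis unfolding R_def g_closed lam_closed Fh_closed[OF g0] by simp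
    qed
  qed (use g_valid g_near in auto)
  have intble: "\<phi> x\<^sub>0 integrable_on {0..1}" "\<phi>2 x\<^sub>0 integrable_on {0..1}"
    using continuous_on_compose2[OF cont(1), of "{0..1}" "\<lambda>t. (x\<^sub>0, t)"] continuous_on_compose2[OF cont(3), of "{0..1}" "\<lambda>t. (x\<^sub>0, t)"] x0\<delta>
    by (auto simp: image_subset_iff continuous_on_Pair intro!: integrable_continuous_real)
  have "((\<lambda>t. \<phi>2 x\<^sub>0 t - (V - E) * \<phi> x\<^sub>0 t) has_integral integral {0..1} (\<phi>2 x\<^sub>0) - (V - E) * integral {0..1} (\<phi> x\<^sub>0)) {0..1}"
    by (intro has_integral_diff has_integral_mult_right integrable_integral intble)
  moreover have "((\<lambda>t. - (deriv (R t) (g t) * vector_derivative g (at t within {0..1}))) has_integral - 0) {0..1}"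
    by (rule has_integral_neg[OF Rint])
  then have "((\<lambda>t. \<phi>2 x\<^sub>0 t - (V - E) * \<phi> x\<^sub>0 t) has_integral - 0) {0..1}"
  proof (rule has_integral_eq[rotated])
    fix t :: real assume t: "t \<in> {0..1}"
    show "- (deriv (R t) (g t) * vector_derivative g (at t within {0..1})) = \<phi>2 x\<^sub>0 t - (V - E) * \<phi> x\<^sub>0 t"
      unfolding DERIV_imp_deriv[OF R'[OF t g_near[OF t]]] g_deriv[OF t] \<phi>2_def \<phi>_def by (simp add: algebra_simps)
  qed
  ultimately have "integral {0..1} (\<phi>2 x\<^sub>0) - (V - E) * integral {0..1} (\<phi> x\<^sub>0) = - 0"
    by (rule has_integral_unique)
  then have "(deriv ^^ 2) f x\<^sub>0 = (V - E) * f x\<^sub>0" unfolding f2 fi[OF x0\<delta>] by simp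
  then have "heun_operator \<omega>\<^sub>1 \<omega>\<^sub>3 l f x\<^sub>0 = E * f x\<^sub>0"
    unfolding heun_operator_def V_def potential_def by (simp add: algebra_simps)
  then show ?thesis using f1[OF x0\<delta>] by (auto simp: field_differentiable_def)
qed

end

section \<open>From a neighbourhood of each point to the whole of \<open>U\<close>\<close>

context heun_integral
begin

lemma heun_solution_f: "heun_solution \<omega>\<^sub>1 \<omega>\<^sub>3 l E U f"
proof -
  have main: "f field_differentiable at x\<^sub>0 \<and> heun_operator \<omega>\<^sub>1 \<omega>\<^sub>3 l f x\<^sub>0 = E * f x\<^sub>0" if x0: "x\<^sub>0 \<in> U" for x\<^sub>0
  proof -
    define \<gamma> where "\<gamma> = \<Gamma> x\<^sub>0"
    have \<gamma>c: "continuous_on {0..1} \<gamma>" unfolding \<gamma>_def by (rule Gamma_cont[OF x0])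
    have nbhd: "\<exists>e>0. \<forall>t\<in>{0..1}. ball (h t) e \<subseteq> S" if h: "continuous_on {0..1} h" and S: "open S" and hS: "\<And>t. t \<in> {0..1} \<Longrightarrow> h t \<in> S"
      for h :: "real \<Rightarrow> complex" and S
    proof -
      have "compact (h ` {0..1})" using h by (intro compact_continuous_image) auto
      then obtain e where "e > 0" "(\<Union>x\<in>h ` {0..1}. ball x e) \<subseteq> S"
        using compact_subset_open_imp_ball_epsilon_subset[OF _ S, of "h ` {0..1}"] hS
        by (metis image_subsetI)
      then show ?thesis by (intro exI[of _ e]) auto
    qed
    have "\<exists>e>0. \<forall>t\<in>{0..1}. ball (x\<^sub>0 + \<gamma> t) e \<subseteq> - \<Lambda>"
      by (rule nbhd) (use plus_minus_notin(1)[OF x0] in \<open>auto simp: \<gamma>_def intro!: continuous_intros \<gamma>c[unfolded \<gamma>_def]\<close>)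
    then obtain e1 where e1: "e1 > 0" "\<And>t. t \<in> {0..1} \<Longrightarrow> ball (x\<^sub>0 + \<gamma> t) e1 \<subseteq> - \<Lambda>" by blast
    have "\<exists>e>0. \<forall>t\<in>{0..1}. ball (x\<^sub>0 - \<gamma> t) e \<subseteq> - \<Lambda>"
      by (rule nbhd) (use plus_minus_notin(2)[OF x0] in \<open>auto simp: \<gamma>_def intro!: continuous_intros \<gamma>c[unfolded \<gamma>_def]\<close>)
    then obtain e2 where e2: "e2 > 0" "\<And>t. t \<in> {0..1} \<Longrightarrow> ball (x\<^sub>0 - \<gamma> t) e2 \<subseteq> - \<Lambda>" by blast
    obtain e3 where e3: "e3 > 0" "ball x\<^sub>0 e3 \<subseteq> U" using openE[OF U(1) x0] by blast
    have K: "compact (\<gamma> ` {0..1})" "\<gamma> ` {0..1} \<subseteq> - H"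
      using \<gamma>c Gamma_notin[OF x0] by (auto simp: \<gamma>_def intro!: compact_continuous_image)
    have ratehol: "rate holomorphic_on - H"
      unfolding rate_def[abs_def] by (intro holomorphic_intros holomorphic_potential)
    \<comment> \<open>The halves of \<open>e1\<close> and \<open>e2\<close> leave room for the balls
      of radius \<open>2 * \<rho>\<close> about the sums and differences.\<close>
    obtain \<rho> where \<rho>: "ode_radius rate (\<gamma> ` {0..1}) \<rho>" "\<rho> < min (e1 / 2) (min (e2 / 2) e3)"
      "\<And>z. z \<in> \<gamma> ` {0..1} \<Longrightarrow> ball z \<rho> \<subseteq> - H"
      by (rule ode_radius_exists[OF K open_Compl_half_lattice ratehol, of "min (e1 / 2) (min (e2 / 2) e3)"])
        (use e1 e2 e3 in auto)
    interpret at: heun_integral_at \<omega>\<^sub>1 \<omega>\<^sub>3 E \<alpha>\<^sub>0 \<eta> l l' i U \<Gamma> F L M N f x\<^sub>0 \<rho>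
    proof
      show "ball x\<^sub>0 \<rho> \<subseteq> U" using e3(2) \<rho>(2) by (auto simp: subset_iff)
      show "ball (x\<^sub>0 + \<Gamma> x\<^sub>0 t) (2 * \<rho>) \<subseteq> - \<Lambda>" "ball (x\<^sub>0 - \<Gamma> x\<^sub>0 t) (2 * \<rho>) \<subseteq> - \<Lambda>" if "t \<in> {0..1}" for t
        using order_trans[OF subset_ball e1(2)[OF that]] order_trans[OF subset_ball e2(2)[OF that]] \<rho>(2)
        by (auto simp: \<gamma>_def)
    qed (use x0 \<rho> in \<open>auto simp: \<gamma>_def\<close>)
    obtain \<delta> where \<delta>: "\<delta> > 0" "\<delta> \<le> \<rho>" "\<And>x t. x \<in> ball x\<^sub>0 \<delta> \<Longrightarrow> t \<in> {0..1} \<Longrightarrow> \<Gamma> x t \<in> ball (\<Gamma> x\<^sub>0 t) \<rho>"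
      using at.Gamma_near by blast
    have germs: "germ_branch rate {0..1} \<gamma> (\<lambda>t. F (x\<^sub>0, t))"
      unfolding \<gamma>_def by (rule F_germs_slice[OF x0])
    obtain Fh where Fh: "\<And>t. t \<in> {0..1} \<Longrightarrow> ode_solution rate (ball (\<gamma> t) \<rho>) (Fh t)"
      "\<And>t. t \<in> {0..1} \<Longrightarrow> \<exists>d>0. \<forall>\<xi>\<in>ball (\<gamma> t) d. Fh t \<xi> = F (x\<^sub>0, t) \<xi>" "coherent_on {0..1} \<gamma> \<rho> Fh"
      using extend_germ_branch[OF germs \<gamma>c \<rho>(1)] by metis
    have "path \<gamma>" using \<gamma>c by (simp add: path_def)
    \<comment> \<open>A polynomial path supplies a continuous derivative, shares the endpoints of
      \<open>\<gamma>\<close> and is therefore closed, and stays inside the tube where the local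
      branches live.\<close>
    then obtain g where g: "polynomial_function g" "pathstart g = pathstart \<gamma>" "pathfinish g = pathfinish \<gamma>"
        "\<And>t. t \<in> {0..1} \<Longrightarrow> norm (g t - \<gamma> t) < \<rho>"
      using path_approx_polynomial_function[of \<gamma> \<rho>] at.rho by metis
    obtain g' where g': "polynomial_function g'" "\<And>t. (g has_vector_derivative g' t) (at t)"
      using has_vector_derivative_polynomial_function[OF g(1)] by blast
    interpret loc: heun_integral_local \<omega>\<^sub>1 \<omega>\<^sub>3 E \<alpha>\<^sub>0 \<eta> l l' i U \<Gamma> F L M N f x\<^sub>0 \<rho> \<delta> Fh g g'
    proof
      show "valid_path g" by (rule valid_path_polynomial_function[OF g(1)])
      show "g 1 = g 0" using g(2,3) Gamma_closed[OF x0] by (simp add: pathstart_def pathfinish_def \<gamma>_def)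
      show "g t \<in> ball (\<Gamma> x\<^sub>0 t) \<rho>" if "t \<in> {0..1}" for t
        using g(4)[OF that] by (simp add: \<gamma>_def dist_norm norm_minus_commute)
      show "vector_derivative g (at t within {0..1}) = g' t" if "t \<in> {0..1}" for t
        using that g'(2) by (intro vector_derivative_at_within_ivl) auto
      show "continuous_on {0..1} g'" using g'(1) by (rule continuous_on_polymonial_function)
    qed (use \<delta> Fh in \<open>auto simp: \<gamma>_def\<close>)
    show ?thesis by (rule loc.heun_at)
  qed
  then have "f holomorphic_on U"
    unfolding holomorphic_on_def using field_differentiable_at_within by blast
  then show ?thesis using main unfolding heun_solution_def by blast
qed

end

theorem proposition6p2:
  fixes \<omega>\<^sub>1 \<omega>\<^sub>3 E \<alpha>\<^sub>0 \<eta> :: complex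
    and l l' :: "nat \<Rightarrow> complex"
    and i :: nat
    and U :: "complex set"
    and \<Gamma> :: "complex \<Rightarrow> real \<Rightarrow> complex"
    and F :: "complex \<times> real \<Rightarrow> complex \<Rightarrow> complex"
    and L :: "nat \<Rightarrow> complex \<times> real \<Rightarrow> complex"
    and M :: "complex \<times> real \<Rightarrow> complex"
    and N :: "nat \<Rightarrow> complex \<Rightarrow> complex"
    and f :: "complex \<Rightarrow> complex"
  assumes periods: "Im (\<omega>\<^sub>3 / \<omega>\<^sub>1) \<noteq> 0"
    and alpha: "\<alpha>\<^sub>0 \<in> {- l 0, l 0 + 1}"
    and l'0: "l' 0 = (- \<alpha>\<^sub>0 - l 1 - l 2 - l 3) / 2 - 1"
    and l'1: "l' 1 = (\<alpha>\<^sub>0 + l 1 - l 2 - l 3) / 2 - 1"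
    and l'2: "l' 2 = (\<alpha>\<^sub>0 - l 1 + l 2 - l 3) / 2 - 1"
    and l'3: "l' 3 = (\<alpha>\<^sub>0 - l 1 - l 2 + l 3) / 2 - 1"
    and eta: "\<eta> = (\<alpha>\<^sub>0 - l 1 - l 2 - l 3) / 2"
    and i: "i \<le> 3"
    and U: "open U" "U \<inter> half_period_lattice \<omega>\<^sub>1 \<omega>\<^sub>3 = {}"
    and contour_cont: "continuous_on (U \<times> {0..1}) (\<lambda>(x, t). \<Gamma> x t)"
    and contour: "\<And>x. x \<in> U \<Longrightarrow> cycle_I \<omega>\<^sub>1 \<omega>\<^sub>3 i x (\<Gamma> x)"
    and solution: "heun_solution_branch \<omega>\<^sub>1 \<omega>\<^sub>3 l' E (U \<times> {0..1}) (\<lambda>(x, t). \<Gamma> x t) F"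
    and log_sigma_xi: "\<And>j. j \<le> 3 \<Longrightarrow>
          log_branch (U \<times> {0..1}) (\<lambda>(x, t). cosigma \<omega>\<^sub>1 \<omega>\<^sub>3 j (\<Gamma> x t)) (L j)"
    and log_kernel: "log_branch (U \<times> {0..1})
          (\<lambda>(x, t). weierstrass_sigma \<omega>\<^sub>1 \<omega>\<^sub>3 (x + \<Gamma> x t) * weierstrass_sigma \<omega>\<^sub>1 \<omega>\<^sub>3 (x - \<Gamma> x t)) M"
    and log_sigma_x: "\<And>j. j \<le> 3 \<Longrightarrow> log_branch U (cosigma \<omega>\<^sub>1 \<omega>\<^sub>3 j) (N j)"
    and f: "\<And>x. x \<in> U \<Longrightarrow>
          f x = exp (\<alpha>\<^sub>0 * N 0 x) * exp (- l 1 * N 1 x) * exp (- l 2 * N 2 x) * exp (- l 3 * N 3 x) *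
            branch_integral (\<Gamma> x)
              (\<lambda>t. F (x, t) (\<Gamma> x t) *
                   exp ((l' 0 + 1) * L 0 (x, t)) * exp ((l' 1 + 1) * L 1 (x, t)) *
                   exp ((l' 2 + 1) * L 2 (x, t)) * exp ((l' 3 + 1) * L 3 (x, t)) *
                   exp (- \<eta> * M (x, t)))"
  shows "heun_solution \<omega>\<^sub>1 \<omega>\<^sub>3 l E U f"
proof -
  interpret heun_integral \<omega>\<^sub>1 \<omega>\<^sub>3 E \<alpha>\<^sub>0 \<eta> l l' i U \<Gamma> F L M N f
    by unfold_locales (fact assms)+
  show ?thesis by (rule heun_solution_f)
qed

end
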